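(* Let $A$ be a quaternion algebra over a field $k$. For each $(i,j)\in\{-1,1\}^2$, the category $\mathscr{X}^{c(i,j)}(A)$ is equivalent to the groupoid $\mathscr{Z}^c(A)$ of the action of $A^\ast/k^\ast$ on $(A^\ast/k^\ast)^2$ given by $s\cdot(a,b)=(sas^{-1},sbs^{-1})$. Equivalences $\mathscr{H}^c_{i,j}:\mathscr{Z}^c(A)\to\mathscr{X}^{c(i,j)}(A)$ are given by $\mathscr{H}^c_{i,j}(s)=c_s$ for morphisms, and on objects by \begin{align*} \mathscr{H}^c_{1,1}(a,b)&=[\mathrm{L}_a,\mathrm{R}_b], & \mathscr{H}^c_{-1,1}(a,b)&=[\mathrm{R}_a\kappa,\mathrm{R}_b],\\ \mathscr{H}^c_{1,-1}(a,b)&=[\mathrm{L}_a,\mathrm{L}_b\kappa], & \mathscr{H}^c_{-1,-1}(a,b)&=[\mathrm{L}_a\kappa,\mathrm{R}_b\kappa]. \end{align*}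
   Context: A quaternion algebra over $k$ is a four-dimensional central simple associative $k$-algebra $A$ (any characteristic, possibly split); $n:A\to k$ is its (reduced) norm, a quadratic form with non-degenerate associated bilinear form, $\kappa:x\mapsto\bar x$ is its canonical involution, with $x\bar x=\bar xx=n(x)1$ and $x+\bar x\in k1$. $A^\ast$ is the group of invertible elements. $\mathrm{L}_a(x)=ax$, $\mathrm{R}_a(x)=xa$, and $\mathbb{I}$ is the identity map. $\mathrm{GO}(A)$ is the group of similitudes of $(A,n)$: invertible linear $\varphi$ with $n(\varphi(x))=\mu(\varphi)n(x)$ for all $x\in A$, with $\mu(\varphi)\in k^\ast$ independent of $x$. A similitude is proper if $\det(\varphi)=\mu(\varphi)^2$ when $\mathrm{char}\,k\neq2$, and if its Dickson invariant is zero when $\mathrm{char}\,k=2$ (equivalently, if the automorphism $vw\mapsto\mu(\varphi)^{-1}\varphi(v)\varphi(w)$ of the even Clifford algebra of $(A,n)$ is trivial on its centre); otherwise it is improper. Proper similitudes form a normal subgroup $\mathrm{GO}^+(A)$ of index two. Write $\mathrm{PGL}(A)=\mathrm{GL}(A)/(k^\ast\mathbb{I})$, $\mathrm{PGO}^{+1}(A)=\mathrm{PGO}^+(A)=\mathrm{GO}^+(A)/(k^\ast\mathbb{I})$, and let $\mathrm{PGO}^{-1}(A)$ be the set of classes in $\mathrm{PGL}(A)$ of improper similitudes. Every $\varphi\in\mathrm{GO}^+(A)$ admits triality components, i.e. $\varphi_1,\varphi_2\in\mathrm{GO}^+(A)$ with $\varphi(xy)=\varphi_1(x)\varphi_2(y)$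 for all $x,y\in A$. $X_A$ is the orbit set of the action of $A^\ast$ on $\mathrm{PGL}(A)^2$ given by $w\cdot([\alpha],[\beta])=([\mathrm{R}_w^{-1}\alpha],[\mathrm{L}_w\beta])$, and $[\alpha,\beta]$ denotes the orbit of $([\alpha],[\beta])$. The group $\mathrm{PGO}^+(A)$ acts on $X_A$ by $[\varphi]\cdot[\alpha,\beta]=[\varphi_1\alpha\varphi^{-1},\varphi_2\beta\varphi^{-1}]$ (independent of choices). For a group $G$ acting on a set $X$, the groupoid of the action has object class $X$, and morphisms $x\to y$ are the $g\in G$ with $g\cdot x=y$. Let $\mathscr{X}(A)$ be the groupoid of the action of $\mathrm{PGO}^+(A)$ on $X_A$ given by $[\varphi]\cdot[\alpha,\beta]=[\varphi_1\alpha\varphi^{-1},\varphi_2\beta\varphi^{-1}]$, and let $\mathscr{X}^{c(i,j)}(A)$ be its full subcategory with object set $\left(\mathrm{PGO}^i(A)\times\mathrm{PGO}^j(A)\right)/A^\ast\subset X_A$. (The objects of these four subcategories together are exactly the classes $[\alpha,\beta]$ for which the algebra $A$ with multiplication $x\circ y=\alpha(x)\beta(y)$ is a composition algebra.) For $s\in A^\ast$, $c_s=[\mathrm{L}_s\mathrm{R}_s^{-1}]\in\mathrm{PGO}^+(A)$, which depends only on the class of $s$ in $A^\ast/k^\ast$. Elements of $A^\ast/k^\ast$ are written by representatives. *)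

theory Defs
  imports "HOL-Analysis.Determinants" "HOL-Library.Numeral_Type" "HOL-Algebra.Group_Action"
begin

section \<open>Categories, functors, equivalences\<close>

text \<open>
  Categories are given by families of hom-sets, which need not be disjoint. Composition is
  therefore indexed by objects: \<open>Comp C x y z g f\<close> composes \<open>f : x \<rightarrow> y\<close> with \<open>g : y \<rightarrow> z\<close>.
\<close>

record ('o, 'm) cat =
  Obj :: "'o set"
  Hom :: "'o \<Rightarrow> 'o \<Rightarrow> 'm set"
  Comp :: "'o \<Rightarrow> 'o \<Rightarrow> 'o \<Rightarrow> 'm \<Rightarrow> 'm \<Rightarrow> 'm"
  Ide :: "'o \<Rightarrow> 'm"

locale category =
  fixes C :: "('o, 'm) cat"
  assumes Ide_in_Hom: "x \<in> Obj C \<Longrightarrow> Ide C x \<in> Hom C x x"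
    and Comp_in_Hom:
      "\<lbrakk>x \<in> Obj C; y \<in> Obj C; z \<in> Obj C; f \<in> Hom C x y; g \<in> Hom C y z\<rbrakk>
        \<Longrightarrow> Comp C x y z g f \<in> Hom C x z"
    and Comp_Ide_right:
      "\<lbrakk>x \<in> Obj C; y \<in> Obj C; f \<in> Hom C x y\<rbrakk> \<Longrightarrow> Comp C x x y f (Ide C x) = f"
    and Comp_Ide_left:
      "\<lbrakk>x \<in> Obj C; y \<in> Obj C; f \<in> Hom C x y\<rbrakk> \<Longrightarrow> Comp C x y y (Ide C y) f = f"
    and Comp_assoc:
      "\<lbrakk>w \<in> Obj C; x \<in> Obj C; y \<in> Obj C; z \<in> Obj C;
        f \<in> Hom C w x; g \<in> Hom C x y; h \<in> Hom C y z\<rbrakk>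
        \<Longrightarrow> Comp C w y z h (Comp C w x y g f) = Comp C w x z (Comp C x y z h g) f"

locale category_functor = C: category C + D: category D
  for C :: "('o1, 'm1) cat" and D :: "('o2, 'm2) cat" +
  fixes F0 :: "'o1 \<Rightarrow> 'o2" and F1 :: "'o1 \<Rightarrow> 'o1 \<Rightarrow> 'm1 \<Rightarrow> 'm2"
  assumes F0_in_Obj: "x \<in> Obj C \<Longrightarrow> F0 x \<in> Obj D"
    and F1_in_Hom:
      "\<lbrakk>x \<in> Obj C; y \<in> Obj C; f \<in> Hom C x y\<rbrakk> \<Longrightarrow> F1 x y f \<in> Hom D (F0 x) (F0 y)"
    and F1_Ide: "x \<in> Obj C \<Longrightarrow> F1 x x (Ide C x) = Ide D (F0 x)"
    and F1_Comp:
      "\<lbrakk>x \<in> Obj C; y \<in> Obj C; z \<in> Obj C; f \<in> Hom C x y; g \<in> Hom C y z\<rbrakk>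
        \<Longrightarrow> F1 x z (Comp C x y z g f) = Comp D (F0 x) (F0 y) (F0 z) (F1 y z g) (F1 x y f)"

definition isomorphism_in :: "('o, 'm) cat \<Rightarrow> 'o \<Rightarrow> 'o \<Rightarrow> 'm \<Rightarrow> bool" where
  "isomorphism_in C x y f \<longleftrightarrow>
    f \<in> Hom C x y \<and>
    (\<exists>g\<in>Hom C y x. Comp C x y x g f = Ide C x \<and> Comp C y x y f g = Ide C y)"

definition natural_isomorphism ::
  "('o1, 'm1) cat \<Rightarrow> ('o2, 'm2) cat \<Rightarrow>
   ('o1 \<Rightarrow> 'o2) \<Rightarrow> ('o1 \<Rightarrow> 'o1 \<Rightarrow> 'm1 \<Rightarrow> 'm2) \<Rightarrow>
   ('o1 \<Rightarrow> 'o2) \<Rightarrow> ('o1 \<Rightarrow> 'o1 \<Rightarrow> 'm1 \<Rightarrow> 'm2) \<Rightarrow> ('o1 \<Rightarrow> 'm2) \<Rightarrow> bool" where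
  "natural_isomorphism C D F0 F1 G0 G1 \<eta> \<longleftrightarrow>
    (\<forall>x\<in>Obj C. isomorphism_in D (F0 x) (G0 x) (\<eta> x)) \<and>
    (\<forall>x\<in>Obj C. \<forall>y\<in>Obj C. \<forall>f\<in>Hom C x y.
      Comp D (F0 x) (F0 y) (G0 y) (\<eta> y) (F1 x y f) =
      Comp D (F0 x) (G0 x) (G0 y) (G1 x y f) (\<eta> x))"

definition equivalence_of_categories ::
  "('o1, 'm1) cat \<Rightarrow> ('o2, 'm2) cat \<Rightarrow>
   ('o1 \<Rightarrow> 'o2) \<Rightarrow> ('o1 \<Rightarrow> 'o1 \<Rightarrow> 'm1 \<Rightarrow> 'm2) \<Rightarrow> bool" where
  "equivalence_of_categories C D F0 F1 \<longleftrightarrow>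
    category_functor C D F0 F1 \<and>
    (\<exists>G0 G1. category_functor D C G0 G1 \<and>
      (\<exists>\<eta>. natural_isomorphism C C (\<lambda>x. x) (\<lambda>x y f. f)
        (\<lambda>x. G0 (F0 x)) (\<lambda>x y f. G1 (F0 x) (F0 y) (F1 x y f)) \<eta>) \<and>
      (\<exists>\<epsilon>. natural_isomorphism D D
        (\<lambda>x. F0 (G0 x)) (\<lambda>x y f. F1 (G0 x) (G0 y) (G1 x y f)) (\<lambda>x. x) (\<lambda>x y f. f) \<epsilon>))"

definition full_subcategory :: "('o, 'm) cat \<Rightarrow> 'o set \<Rightarrow> ('o, 'm) cat" where
  "full_subcategory C S = C\<lparr>Obj := S\<rparr>"

definition action_groupoid :: "'g monoid \<Rightarrow> 'x set \<Rightarrow> ('g \<Rightarrow> 'x \<Rightarrow> 'x) \<Rightarrow> ('x, 'g) cat" where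
  "action_groupoid G X act =
    \<lparr>Obj = X, Hom = (\<lambda>x y. {g \<in> carrier G. act g x = y}),
     Comp = (\<lambda>x y z g f. g \<otimes>\<^bsub>G\<^esub> f), Ide = (\<lambda>x. \<one>\<^bsub>G\<^esub>)\<rparr>"


section \<open>Quaternion algebras\<close>

locale quaternion_algebra = vector_space scale
  for scale :: "'k::field \<Rightarrow> 'a::ring_1 \<Rightarrow> 'a" +
  assumes scale_mult_left: "scale c x * y = scale c (x * y)"
    and scale_mult_right: "x * scale c y = scale c (x * y)"
    and dim_4: "dim (UNIV :: 'a set) = 4"
    and central: "(\<forall>y. x * y = y * x) \<Longrightarrow> \<exists>c. x = scale c 1"
    and simple: "\<lbrakk>0 \<in> (I :: 'a set); \<forall>x\<in>I. \<forall>y\<in>I. x + y \<in> I; \<forall>a. \<forall>x\<in>I. a * x \<in> I \<and> x * a \<in> I\<rbrakk>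
      \<Longrightarrow> I = {0} \<or> I = UNIV"
begin

subsection \<open>Canonical involution, norm, multiplications\<close>

text \<open>
  The canonical involution is the unique linear involution of the algebra (anti-automorphism
  of order at most two) for which all \<open>x + \<kappa> x\<close> and \<open>x * \<kappa> x\<close> are scalars.
\<close>

definition canonical_involution :: "'a \<Rightarrow> 'a" (\<open>\<kappa>\<close>) where
  "\<kappa> = (THE \<iota>. Vector_Spaces.linear scale scale \<iota> \<and>
    (\<forall>x y. \<iota> (x * y) = \<iota> y * \<iota> x) \<and> (\<forall>x. \<iota> (\<iota> x) = x) \<and>
    (\<forall>x. \<exists>c. x + \<iota> x = scale c 1) \<and> (\<forall>x. \<exists>c. x * \<iota> x = scale c 1))"

definition nrd :: "'a \<Rightarrow> 'k" where
  "nrd x = (THE c. x * \<kappa> x = scale c 1)"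

definition polar :: "'a \<Rightarrow> 'a \<Rightarrow> 'k" where
  "polar x y = nrd (x + y) - nrd x - nrd y"

definition L :: "'a \<Rightarrow> 'a \<Rightarrow> 'a" where "L a = (\<lambda>x. a * x)"

definition R :: "'a \<Rightarrow> 'a \<Rightarrow> 'a" where "R a = (\<lambda>x. x * a)"

definition Astar :: "'a monoid" where
  "Astar = \<lparr>carrier = {a. \<exists>b. a * b = 1 \<and> b * a = 1}, monoid.mult = (*), one = 1\<rparr>"

definition kstar :: "'a set" where
  "kstar = {scale c 1 | c. c \<noteq> 0}"

text \<open>The group \<open>A\<^sup>* / k\<^sup>*\<close> and the class of an element.\<close>

definition PAstar :: "'a set monoid" where
  "PAstar = Astar Mod kstar"

definition Acls :: "'a \<Rightarrow> 'a set" where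
  "Acls a = kstar #>\<^bsub>Astar\<^esub> a"


subsection \<open>Determinant and trace of linear endomorphisms\<close>

definition frame :: "(4 \<Rightarrow> 'a) \<Rightarrow> bool" where
  "frame e \<longleftrightarrow> inj e \<and> independent (range e) \<and> span (range e) = UNIV"

definition matrix_in :: "(4 \<Rightarrow> 'a) \<Rightarrow> ('a \<Rightarrow> 'a) \<Rightarrow> 'k^4^4" where
  "matrix_in e \<phi> = (\<chi> i j. representation (range e) (\<phi> (e j)) (e i))"

definition det_endo :: "('a \<Rightarrow> 'a) \<Rightarrow> 'k" where
  "det_endo \<phi> = det (matrix_in (SOME e. frame e) \<phi>)"

definition trace_endo :: "('a \<Rightarrow> 'a) \<Rightarrow> 'k" where
  "trace_endo \<phi> = trace (matrix_in (SOME e. frame e) \<phi>)"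


subsection \<open>Similitudes\<close>

definition GL :: "('a \<Rightarrow> 'a) monoid" where
  "GL = \<lparr>carrier = {\<phi>. Vector_Spaces.linear scale scale \<phi> \<and> bij \<phi>},
    monoid.mult = (\<circ>), one = id\<rparr>"

definition GO :: "('a \<Rightarrow> 'a) set" where
  "GO = {\<phi> \<in> carrier GL. \<exists>\<mu>. \<mu> \<noteq> 0 \<and> (\<forall>x. nrd (\<phi> x) = \<mu> * nrd x)}"

definition multiplier :: "('a \<Rightarrow> 'a) \<Rightarrow> 'k" where
  "multiplier \<phi> = (THE \<mu>. \<mu> \<noteq> 0 \<and> (\<forall>x. nrd (\<phi> x) = \<mu> * nrd x))"

text \<open>
  Dickson invariant of a similitude in characteristic two (Knus, Merkurjev, Rost, Tignol,
  The Book of Involutions, Section 12.C). In matrix form: if \<open>M\<close> represents the quadratic form,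
  \<open>W = M + M\<^sup>T\<close>, and \<open>G\<^sup>T M G = \<mu> M + R + R\<^sup>T\<close> for the matrix \<open>G\<close> of \<open>\<phi>\<close>, then the invariant is
  \<open>tr (\<mu>\<^sup>-\<^sup>1 W\<^sup>-\<^sup>1 R)\<close>, independently of \<open>M\<close> and \<open>R\<close>. Below, \<open>m\<close> is the bilinear form of \<open>M\<close>, and
  \<open>\<rho>\<close> is the endomorphism \<open>W\<^sup>-\<^sup>1 R\<close>, so that \<open>polar x (\<rho> y)\<close> is the bilinear form of \<open>R\<close>.
\<close>

definition dickson :: "('a \<Rightarrow> 'a) \<Rightarrow> 'k" where
  "dickson \<phi> = (THE d. \<exists>m \<rho>.
    (\<forall>x. Vector_Spaces.linear scale (*) (m x)) \<and>
    (\<forall>y. Vector_Spaces.linear scale (*) (\<lambda>x. m x y)) \<and>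
    (\<forall>x. m x x = nrd x) \<and>
    Vector_Spaces.linear scale scale \<rho> \<and>
    (\<forall>x y. m (\<phi> x) (\<phi> y) = multiplier \<phi> * m x y + polar x (\<rho> y) + polar y (\<rho> x)) \<and>
    d = trace_endo \<rho> / multiplier \<phi>)"

definition proper :: "('a \<Rightarrow> 'a) \<Rightarrow> bool" where
  "proper \<phi> \<longleftrightarrow>
    (if CHAR('k) \<noteq> 2 then det_endo \<phi> = (multiplier \<phi>)\<^sup>2 else dickson \<phi> = 0)"

definition GOp :: "('a \<Rightarrow> 'a) monoid" where
  "GOp = GL\<lparr>carrier := {\<phi> \<in> GO. proper \<phi>}\<rparr>"


subsection \<open>Projective groups\<close>

definition homotheties :: "('a \<Rightarrow> 'a) set" where
  "homotheties = {scale c | c. c \<noteq> 0}"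

definition PGL :: "('a \<Rightarrow> 'a) set monoid" where
  "PGL = GL Mod homotheties"

definition PGOp :: "('a \<Rightarrow> 'a) set monoid" where
  "PGOp = GOp Mod homotheties"

definition cls :: "('a \<Rightarrow> 'a) \<Rightarrow> ('a \<Rightarrow> 'a) set" where
  "cls \<phi> = homotheties #>\<^bsub>GL\<^esub> \<phi>"

text \<open>The sets \<open>PGO\<^sup>+\<^sup>1(A)\<close> and \<open>PGO\<^sup>-\<^sup>1(A)\<close>; only \<open>i = 1\<close> and \<open>i = -1\<close> are meaningful.\<close>

definition PGO :: "int \<Rightarrow> ('a \<Rightarrow> 'a) set set" where
  "PGO i = (if i = 1 then carrier PGOp else {cls \<phi> | \<phi>. \<phi> \<in> GO \<and> \<not> proper \<phi>})"


subsection \<open>The orbit set and the triality action\<close>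

definition Astar_act ::
  "'a \<Rightarrow> ('a \<Rightarrow> 'a) set \<times> ('a \<Rightarrow> 'a) set \<Rightarrow> ('a \<Rightarrow> 'a) set \<times> ('a \<Rightarrow> 'a) set" where
  "Astar_act w = (\<lambda>(P, Q). (cls (inv\<^bsub>GL\<^esub> (R w)) \<otimes>\<^bsub>PGL\<^esub> P, cls (L w) \<otimes>\<^bsub>PGL\<^esub> Q))"

definition X_A :: "(('a \<Rightarrow> 'a) set \<times> ('a \<Rightarrow> 'a) set) set set" where
  "X_A = orbits Astar (carrier PGL \<times> carrier PGL) Astar_act"

definition cls2 :: "('a \<Rightarrow> 'a) \<Rightarrow> ('a \<Rightarrow> 'a) \<Rightarrow> (('a \<Rightarrow> 'a) set \<times> ('a \<Rightarrow> 'a) set) set" where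
  "cls2 \<alpha> \<beta> = orbit Astar Astar_act (cls \<alpha>, cls \<beta>)"

definition triality_components :: "('a \<Rightarrow> 'a) \<Rightarrow> ('a \<Rightarrow> 'a) \<Rightarrow> ('a \<Rightarrow> 'a) \<Rightarrow> bool" where
  "triality_components \<phi> \<phi>\<^sub>1 \<phi>\<^sub>2 \<longleftrightarrow>
    \<phi>\<^sub>1 \<in> carrier GOp \<and> \<phi>\<^sub>2 \<in> carrier GOp \<and> (\<forall>x y. \<phi> (x * y) = \<phi>\<^sub>1 x * \<phi>\<^sub>2 y)"

text \<open>The value does not depend on the choices of \<open>\<phi>\<close>, its components, \<open>\<alpha>\<close> and \<open>\<beta>\<close>.\<close>

definition triality_act ::
  "('a \<Rightarrow> 'a) set \<Rightarrow> (('a \<Rightarrow> 'a) set \<times> ('a \<Rightarrow> 'a) set) set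
    \<Rightarrow> (('a \<Rightarrow> 'a) set \<times> ('a \<Rightarrow> 'a) set) set" where
  "triality_act \<Phi> x = (THE y. \<exists>\<phi> \<phi>\<^sub>1 \<phi>\<^sub>2 \<alpha> \<beta>.
    \<phi> \<in> carrier GOp \<and> \<Phi> = cls \<phi> \<and> triality_components \<phi> \<phi>\<^sub>1 \<phi>\<^sub>2 \<and>
    \<alpha> \<in> carrier GL \<and> \<beta> \<in> carrier GL \<and> x = cls2 \<alpha> \<beta> \<and>
    y = cls2 (\<phi>\<^sub>1 \<circ> \<alpha> \<circ> inv\<^bsub>GL\<^esub> \<phi>) (\<phi>\<^sub>2 \<circ> \<beta> \<circ> inv\<^bsub>GL\<^esub> \<phi>))"

definition XX ::
  "((('a \<Rightarrow> 'a) set \<times> ('a \<Rightarrow> 'a) set) set, ('a \<Rightarrow> 'a) set) cat" where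
  "XX = action_groupoid PGOp X_A triality_act"

definition XXc ::
  "int \<Rightarrow> int \<Rightarrow> ((('a \<Rightarrow> 'a) set \<times> ('a \<Rightarrow> 'a) set) set, ('a \<Rightarrow> 'a) set) cat" where
  "XXc i j = full_subcategory XX (orbits Astar (PGO i \<times> PGO j) Astar_act)"


subsection \<open>The conjugation groupoid and the functors into the triality groupoid\<close>

definition conj_act :: "'a set \<Rightarrow> 'a set \<times> 'a set \<Rightarrow> 'a set \<times> 'a set" where
  "conj_act s = (\<lambda>(a, b). (s \<otimes>\<^bsub>PAstar\<^esub> a \<otimes>\<^bsub>PAstar\<^esub> inv\<^bsub>PAstar\<^esub> s,
                           s \<otimes>\<^bsub>PAstar\<^esub> b \<otimes>\<^bsub>PAstar\<^esub> inv\<^bsub>PAstar\<^esub> s))"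

definition ZZc :: "('a set \<times> 'a set, 'a set) cat" where
  "ZZc = action_groupoid PAstar (carrier PAstar \<times> carrier PAstar) conj_act"

definition conj_cls :: "'a \<Rightarrow> ('a \<Rightarrow> 'a) set" where
  "conj_cls s = cls (L s \<circ> inv\<^bsub>GL\<^esub> (R s))"

definition Hc_obj :: "int \<Rightarrow> int \<Rightarrow> 'a \<Rightarrow> 'a \<Rightarrow> (('a \<Rightarrow> 'a) set \<times> ('a \<Rightarrow> 'a) set) set" where
  "Hc_obj i j a b =
    (if (i, j) = (1, 1) then cls2 (L a) (R b)
     else if (i, j) = (-1, 1) then cls2 (R a \<circ> \<kappa>) (R b)
     else if (i, j) = (1, -1) then cls2 (L a) (L b \<circ> \<kappa>)
     else cls2 (L a \<circ> \<kappa>) (R b \<circ> \<kappa>))"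

end

end

theory Submission
  imports Defs
begin

text \<open>
  The objects of the four categories are classes of pairs of similitudes, so the proof rests on
  knowing all similitudes of the norm. They are the maps \<open>x \<mapsto> a x b\<close> and \<open>x \<mapsto> a \<kappa>(x) b\<close> with
  units \<open>a\<close> and \<open>b\<close>, and the proper ones are those of the first kind. Write \<open>[a, b]\<close> for such a map,
  up to scalars, with a flag for the presence of \<open>\<kappa>\<close>. In a pair \<open>([a, b], [c, d])\<close> the action of
  \<open>A\<^sup>*\<close> replaces \<open>b\<close> by \<open>b w\<^sup>-\<^sup>1\<close> and \<open>c\<close> by \<open>w c\<close>, so the orbit is determined by the two flags and
  the triple \<open>(a, b c, d)\<close>, taken modulo scalars (\<open>cls2_sandwich\<close>, \<open>triple_eq_iff\<close>).

  A proper similitude \<open>x \<mapsto> p x q\<close> has the triality components \<open>x \<mapsto> p x\<close> and \<open>x \<mapsto> x q\<close>. As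
  \<open>\<kappa>(q\<^sup>-\<^sup>1)\<close> is a scalar multiple of \<open>q\<close>, it acts on a triple by multiplying every entry on either side
  by \<open>p\<close>, \<open>q\<close> or one of their inverses (\<open>triality_act_triple\<close>). For each choice of the flags there
  is an entry, say \<open>B\<close>, that is sent to \<open>p B q\<close> or to \<open>q\<^sup>-\<^sup>1 B p\<^sup>-\<^sup>1\<close>. A suitable \<open>q\<close> moves this entry to
  \<open>1\<close>, which shows essential surjectivity, and the remaining freedom \<open>q = p\<^sup>-\<^sup>1\<close> acts on the two
  other entries by simultaneous conjugation with \<open>p\<close>. The triples with this entry equal to
  \<open>1\<close> are the values of the functor on objects, and \<open>x \<mapsto> p x p\<^sup>-\<^sup>1\<close> is its value on the class of \<open>p\<close>;
  so the functor is full and faithful (\<open>triality_act_Hc_iff\<close>, \<open>Hc_reaches_every_triple\<close>).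

  What precedes this is the structure theory of a central simple algebra of dimension four. Every
  element satisfies a quadratic equation, and elements that are linearly independent modulo the
  scalars do not commute; this makes the trace linear and yields the canonical involution
  (\<open>quadratic\<close>, \<open>noncommuting\<close>, \<open>canonical_involution_eq_bar\<close>). A similitude is reduced, by
  left multiplication and conjugation, to an isometry fixing \<open>1\<close> and a generator \<open>x\<close> of a separable
  quadratic subalgebra \<open>K\<close>. It then acts on \<open>A = K \<oplus> K y\<close> in an explicit way
  (\<open>similitude_is_sandwich\<close>). Whether the map is proper is decided by a determinant in
  characteristic different from two, and otherwise by the Dickson invariant, which turns out to be
  additive under composition (\<open>proper_sandwich_iff\<close>).
\<close>

section \<open>The quadratic equation of an element\<close>

context quaternion_algebra
begin

text \<open>
  Field arithmetic merges equal coefficients into multiples of \<open>2\<close>, which the distributive laws do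
  not expand again. Splitting them restores a normal form for linear combinations.
\<close>

lemma scale_double:
  "scale 2 x = x + x" "scale (2 * c) x = scale c x + scale c x" "scale (c * 2) x = scale c x + scale c x"
  "scale (a * (c * 2)) x = scale (a * c) x + scale (a * c) x"
  "scale (a * (b * (c * 2))) x = scale (a * (b * c)) x + scale (a * (b * c)) x"
  by (simp_all only: one_add_one[symmetric] distrib_right distrib_left mult_1 mult_1_right scale_left_distrib scale_one)

lemmas qa_simps = scale_double distrib_left distrib_right left_diff_distrib right_diff_distrib
  scale_left_distrib scale_right_distrib scale_left_diff_distrib scale_right_diff_distrib
  scale_mult_left scale_mult_right mult.assoc

definition scalar :: "'a \<Rightarrow> bool" where
  "scalar x \<longleftrightarrow> (\<exists>c. x = scale c 1)"

lemma scalar_iff_central: "scalar x \<longleftrightarrow> (\<forall>y. x * y = y * x)"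
  using central[of x] by (auto simp: scalar_def scale_mult_left scale_mult_right)

lemma independent_2:
  assumes "\<not> scalar x" "scale a 1 + scale b x = 0"
  shows "a = 0 \<and> b = 0"
proof -
  have one: "(1::'a) \<noteq> 0" using dim_4 dim_empty
    by (metis dim_singleton scalar_def assms(1) mult_1 mult_zero_left scale_zero_left)
  have "b = 0"
  proof (rule ccontr)
    assume b: "b \<noteq> 0"
    have "x = scale (inverse b) (scale b x)" using b by simp
    also have "scale b x = scale (-a) 1" using assms(2) by (simp add: eq_neg_iff_add_eq_0 add.commute)
    finally have "x = scale (inverse b * (- a)) 1" by simp
    then show False using assms(1) unfolding scalar_def by blast
  qed
  with assms one show ?thesis by auto
qed

lemma independent_3:
  assumes "\<not> scalar x" "\<And>a b. y \<noteq> scale a 1 + scale b x"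
    and "scale a 1 + scale b x + scale c y = 0"
  shows "a = 0 \<and> b = 0 \<and> c = 0"
proof -
  have "c = 0"
  proof (rule ccontr)
    assume c: "c \<noteq> 0"
    have "y = scale (inverse c) (scale c y)" using c by simp
    also have "scale c y = scale (-a) 1 + scale (-b) x"
      using assms(3) by (simp add: eq_neg_iff_add_eq_0 algebra_simps)
    finally have "y = scale (inverse c * (- a)) 1 + scale (inverse c * (- b)) x"
      by (simp add: scale_right_distrib scale_right_diff_distrib)
    then show False using assms(2) by blast
  qed
  with assms independent_2 show ?thesis by auto
qed

lemma compare_coeffs:
  assumes "\<not> scalar x" "scale a 1 + scale b x = scale c 1 + scale d x"
  shows "a = c \<and> b = d"
proof -
  have "scale (a - c) 1 + scale (b - d) x = 0" using assms(2)
    by (simp add: scale_left_diff_distrib algebra_simps)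
  from independent_2[OF assms(1) this] show ?thesis by simp
qed

lemma finite_basis: "\<exists>B. finite_dimensional_vector_space scale B \<and> card B = 4"
proof -
  obtain B where B: "independent B" "span B = UNIV" "card B = 4"
    using dim_4 unfolding dim_def
    by (smt (verit, best) someI_ex span_UNIV zero_neq_numeral)
  have "finite B" using B(3) by (metis card.infinite zero_neq_numeral)
  then have "finite_dimensional_vector_space scale B"
    by unfold_locales (use B in auto)
  with B show ?thesis by auto
qed

lemma independent_4_spans:
  assumes "independent S" "card S = 4" shows "span S = UNIV"
proof -
  obtain B where B: "finite_dimensional_vector_space scale B" "card B = 4" using finite_basis by auto
  interpret F: finite_dimensional_vector_space scale B by fact
  have f: "finite S" using assms(2) by (metis card.infinite zero_neq_numeral)
  have "dim (UNIV::'a set) = card S" using dim_4 assms by simp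
  then show ?thesis using F.card_eq_dim[of S UNIV] assms by (auto simp: f)
qed

lemma spanning_card:
  assumes "span S = UNIV" "finite S" shows "4 \<le> card S"
  using dim_4 dim_le_card[of UNIV S] assms by auto

lemma extend_independent_3:
  assumes "independent S" "card S = 3" "z \<notin> span S"
  shows "span (insert z S) = UNIV"
proof -
  have "finite S" using assms(2) by (metis card.infinite zero_neq_numeral)
  moreover have "z \<notin> S" using assms(3) span_base by blast
  ultimately show ?thesis
    using assms by (intro independent_4_spans independent_insertI) auto
qed

lemma independent_3_set:
  assumes "\<not> scalar x" "\<And>a b. y \<noteq> scale a 1 + scale b x"
  shows "independent {1, x, y} \<and> card {1, x, y} = 3"
proof -
  have d: "1 \<noteq> x" "1 \<noteq> y" "x \<noteq> y"
    using assms(1) assms(2)[of 1 0] assms(2)[of 0 1] unfolding scalar_def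
    by (metis scale_one, auto)
  moreover have "independent {1,x,y}"
  proof
    assume "dependent {1,x,y}"
    then obtain u v where v: "v \<in> {1,x,y}" "u v \<noteq> 0" and s: "(\<Sum>v\<in>{1,x,y}. scale (u v) v) = 0"
      by (auto simp: dependent_finite)
    have "scale (u 1) 1 + scale (u x) x + scale (u y) y = 0" using s d by (simp add: add.assoc)
    from independent_3[OF assms this] v show False by auto
  qed
  ultimately show ?thesis by simp
qed

text \<open>
  The elements \<open>z\<close> with \<open>z A c = 0\<close> form a two-sided ideal.
\<close>

lemma prime_algebra:
  assumes "u \<noteq> 0" "\<And>r. u * r * c = 0" shows "c = (0::'a)"
proof -
  let ?I = "{z. \<forall>r. z * r * c = 0}"
  have "?I = {0} \<or> ?I = UNIV"
  proof (rule simple)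
    show "\<forall>a. \<forall>x\<in>?I. a * x \<in> ?I \<and> x * a \<in> ?I" 
    proof (intro allI ballI conjI)
      fix a z assume z: "z \<in> ?I"
      show "a * z \<in> ?I" using z by (simp add: mult.assoc)
      show "z * a \<in> ?I"
      proof (rule CollectI, rule allI)
        fix r
        have "z * (a * r) * c = 0" using z by blast
        then show "z * a * r * c = 0" by (simp add: mult.assoc)
      qed
    qed
  qed (auto simp: distrib_right)
  then have "?I = UNIV" using assms by auto
  then have "1 \<in> ?I" by simp
  then have "1 * 1 * c = 0" by blast
  then show ?thesis by simp
qed

lemma span_3: "w \<in> span {p, q, r} \<longleftrightarrow> (\<exists>a b c. w = scale a p + scale b q + scale c r)"
  by (auto simp: span_insert span_singleton algebra_simps eq_diff_eq diff_eq_eq)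

text \<open>
  Otherwise \<open>1, x, x\<^sup>2\<close> are independent, with commutative span \<open>K\<close>. If \<open>x\<^sup>3\<close> lies outside \<open>K\<close>, then the
  powers of \<open>x\<close> span the algebra and \<open>x\<close> is central. If \<open>x\<^sup>3\<close> lies in \<open>K\<close>, then \<open>x\<close> acts by a scalar \<open>l\<close>
  on the one-dimensional space \<open>A / K\<close>, so the right ideal \<open>u A\<close> with \<open>u = x - l\<close> is contained in \<open>K\<close>
  and hence commutative. In a prime ring this forces its elements to be central, and again
  \<open>x\<close> is central.
\<close>

lemma quadratic: "\<exists>t n. x * x = scale t x - scale n 1"
proof (rule ccontr)
  assume neg: "\<not> ?thesis"
  have nsc: "\<not> scalar x"
  proof
    assume "scalar x"
    then obtain c where "x = scale c 1" by (auto simp: scalar_def)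
    then have "x * x = scale c x - scale 0 1" by (simp add: qa_simps)
    with neg show False by blast
  qed
  have "x * x \<noteq> scale a 1 + scale b x" for a b
  proof
    assume "x * x = scale a 1 + scale b x"
    then have "x * x = scale b x - scale (-a) 1" by simp
    with neg show False by blast
  qed
  note ind = independent_3_set[OF nsc this]
  let ?S = "{1, x, x * x}"
  have comm: "v * w = w * v" if "v \<in> span ?S" "w \<in> span ?S" for v w
    using that unfolding span_3 by (auto simp: qa_simps algebra_simps)
  show False
  proof (cases "x * (x * x) \<in> span ?S")
    case False
    have U: "span (insert (x * (x * x)) ?S) = UNIV"
      using extend_independent_3 ind False by blast
    have "x * w = w * x" for w
    proof -
      have "w \<in> span (insert (x * (x * x)) ?S)" using U by simp
      then obtain k where "w - scale k (x * (x * x)) \<in> span ?S" by (auto simp: span_insert)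
      then have "x * (w - scale k (x * (x * x))) = (w - scale k (x * (x * x))) * x"
        by (rule comm[rotated]) (simp add: span_base)
      then show ?thesis by (simp add: qa_simps)
    qed
    then show False using nsc scalar_iff_central by blast
  next
    case True
    have xK: "x * v \<in> span ?S" if "v \<in> span ?S" for v
    proof -
      obtain a b c where "v = scale a 1 + scale b x + scale c (x * x)" using \<open>v \<in> span ?S\<close> unfolding span_3 by blast
      then have eq: "x * v = scale a x + scale b (x * x) + scale c (x * (x * x))" by (simp add: qa_simps)
      show ?thesis unfolding eq by (intro span_add span_scale True) (simp_all add: span_base)
    qed
    obtain y where y: "y \<notin> span ?S"
    proof -
      have "card ?S = 3" using ind by simp
      with spanning_card[of ?S] have "span ?S \<noteq> UNIV" by fastforce
      then show ?thesis using that by auto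
    qed
    have U: "span (insert y ?S) = UNIV" using extend_independent_3 ind y by blast
    then have "x * y \<in> span (insert y ?S)" by simp
    then obtain l where "x * y - scale l y \<in> span ?S" by (auto simp: span_insert)
    define u where "u = x - scale l 1"
    have uy: "u * y \<in> span ?S" using \<open>x * y - scale l y \<in> span ?S\<close> by (simp add: u_def qa_simps)
    have uK: "u * r \<in> span ?S" for r
    proof -
      have "r \<in> span (insert y ?S)" using U by simp
      then obtain k where k: "r - scale k y \<in> span ?S" by (auto simp: span_insert)
      have "u * r = (x * (r - scale k y) - scale l (r - scale k y)) + scale k (u * y)"
        by (simp add: u_def qa_simps algebra_simps)
      then show ?thesis using xK[OF k] k uy by (metis span_add span_diff span_scale)
    qed
    have "u \<noteq> 0" using nsc unfolding u_def scalar_def by auto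
    have "a * (u * s) - (u * s) * a = 0" for a s
    proof (rule prime_algebra[OF \<open>u \<noteq> 0\<close>])
      fix r
      have "(u * r) * (a * (u * s)) = (u * s) * (u * r * a)"
        using comm[OF uK[of "r * a"] uK[of s]] by (simp add: mult.assoc)
      also have "\<dots> = (u * r) * (u * s) * a"
        using comm[OF uK[of "r"] uK[of s]] by (simp add: mult.assoc[symmetric])
      finally show "u * r * (a * (u * s) - (u * s) * a) = 0"
        by (simp add: qa_simps)
    qed
    from this[of _ 1] have "scalar u" by (simp add: scalar_iff_central)
    then have "scalar x" unfolding u_def scalar_def
      by (metis diff_add_cancel scale_left_distrib)
    then show False using nsc by simp
  qed
qed

text \<open>
  If \<open>x\<close> and \<open>y\<close> commute, then the centralizer of \<open>x\<close> has codimension one, so the commutators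
  \<open>[x, a]\<close> are the multiples of a single \<open>u = [x, z]\<close>. Evaluating \<open>[x, _]\<close> as a derivation on products
  shows that \<open>u A\<close> and \<open>A u\<close> are both contained in the span of \<open>u\<close> and \<open>u z\<close>. This span is
  then a two-sided ideal of dimension one or two, whereas \<open>A\<close> is simple of dimension four.
\<close>

lemma noncommuting:
  assumes x: "\<not> scalar x" and y: "\<And>a b. y \<noteq> scale a 1 + scale b x"
  shows "x * y \<noteq> y * x"
proof
  assume xy: "x * y = y * x"
  note ind = independent_3_set[OF x y]
  let ?S = "{1, x, y}"
  have C: "x * c = c * x" if "c \<in> span ?S" for c
    using that xy unfolding span_3 by (auto simp: qa_simps)
  obtain z where z: "x * z \<noteq> z * x" using x scalar_iff_central by blast
  have U: "span (insert z ?S) = UNIV" using extend_independent_3 ind C z by blast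
  define u where "u = x * z - z * x"
  have u0: "u \<noteq> 0" using z by (simp add: u_def)
  have dec: "\<exists>c k. a = c + scale k z \<and> x * c = c * x" for a
  proof -
    have "a \<in> span (insert z ?S)" using U by simp
    then obtain k where k: "a - scale k z \<in> span ?S" by (auto simp: span_insert)
    show ?thesis using C[OF k] by (intro exI[of _ "a - scale k z"] exI[of _ k]) auto
  qed
  have ad: "\<exists>k. x * a - a * x = scale k u" for a
    using dec[of a] by (auto simp: u_def qa_simps)
  have uc: "\<exists>k. u * c = scale k u" "\<exists>k. c * u = scale k u" if c: "x * c = c * x" for c
  proof -
    have "x * (z * c) - (z * c) * x = u * c" using c by (simp add: u_def qa_simps)
    then show "\<exists>k. u * c = scale k u" using ad[of "z * c"] by auto
    have "x * (c * z) - (c * z) * x = c * u"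
    proof -
      have "x * (c * z) = c * (x * z)" using c by (simp add: mult.assoc[symmetric])
      then show ?thesis by (simp add: u_def qa_simps)
    qed
    then show "\<exists>k. c * u = scale k u" using ad[of "c * z"] by auto
  qed
  have uz: "\<exists>k. z * u = scale k u - u * z"
  proof -
    have "x * (z * z) - (z * z) * x = u * z + z * u" by (simp add: u_def qa_simps)
    then show ?thesis using ad[of "z * z"] by (auto simp: algebra_simps)
  qed
  obtain t n where zz: "z * z = scale t z - scale n 1" using quadratic by blast
  let ?I = "span {u, u * z}"
  have I: "w \<in> ?I \<longleftrightarrow> (\<exists>a b. w = scale a u + scale b (u * z))" for w
    by (auto simp: span_insert span_singleton algebra_simps eq_diff_eq diff_eq_eq)
  have uI: "u \<in> ?I" "u * z \<in> ?I" by (auto intro: span_base)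
  have r: "u * a \<in> ?I" for a
  proof -
    obtain c k where a: "a = c + scale k z" "x * c = c * x" using dec by blast
    obtain l where "u * c = scale l u" using uc a by blast
    then have "u * a = scale l u + scale k (u * z)" by (simp add: a qa_simps)
    then show ?thesis using I by blast
  qed
  have l: "a * u \<in> ?I" for a
  proof -
    obtain c k where a: "a = c + scale k z" "x * c = c * x" using dec by blast
    obtain l where "c * u = scale l u" using uc a by blast
    moreover obtain m where "z * u = scale m u - u * z" using uz by blast
    ultimately have "a * u = scale (l + k * m) u + scale (-k) (u * z)" by (simp add: a qa_simps)
    then show ?thesis using I by blast
  qed
  have "?I = {0} \<or> ?I = UNIV"
  proof (rule simple)
    show "\<forall>a. \<forall>w\<in>?I. a * w \<in> ?I \<and> w * a \<in> ?I"
    proof (intro allI ballI conjI)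
      fix a w assume "w \<in> ?I"
      then obtain p q where "w = scale p u + scale q (u * z)" using I by blast
      then have w: "w = u * (scale p 1 + scale q z)" by (simp add: qa_simps)
      show "w * a \<in> ?I" using r w by (simp add: mult.assoc)
      obtain p' q' where "a * u = scale p' u + scale q' (u * z)" using l I by blast
      then have "a * u = u * (scale p' 1 + scale q' z)" by (simp add: qa_simps)
      then have "a * w = u * ((scale p' 1 + scale q' z) * (scale p 1 + scale q z))"
        using w by (simp add: mult.assoc[symmetric])
      then show "a * w \<in> ?I" using r by simp
    qed
  qed (auto intro: span_add span_zero)
  then have "?I = UNIV" using u0 uI by auto
  then have "4 \<le> card {u, u * z}" using spanning_card by simp
  also have "card {u, u * z} \<le> 2" by (simp add: card_insert_if)
  finally show False by simp
qed

section \<open>The canonical involution and the norm\<close>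

lemma one_neq_zero: "(1::'a) \<noteq> 0"
proof
  assume "(1::'a) = 0"
  then have "x = 0" for x :: 'a by (metis mult_1 mult_zero_left)
  then have "span {} = UNIV" by auto
  from spanning_card[OF this] show False by simp
qed

lemma scale_one_eq_iff [simp]: "scale c 1 = scale d 1 \<longleftrightarrow> c = d"
  using one_neq_zero by simp

lemma scalar_scale_one [simp]: "scalar (scale c 1)"
  by (auto simp: scalar_def)

text \<open>
  The reduced trace. The linear coefficient of a quadratic equation is unique only for nonscalar
  elements, so the scalars need a separate value: the one that makes the trace linear.
\<close>

definition trd :: "'a \<Rightarrow> 'k" where
  "trd x = (if scalar x then THE t. \<exists>c. x = scale c 1 \<and> t = c + c
    else THE t. \<exists>n. x * x = scale t x - scale n 1)"

lemma trd_scalar [simp]: "trd (scale c 1) = c + c"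
  unfolding trd_def by auto

lemma trd_unique:
  assumes "\<not> scalar x" "x * x = scale t x - scale n 1"
  shows "trd x = t"
proof -
  have "t' = t" if "x * x = scale t' x - scale n' 1" for t' n'
  proof -
    have "scale (- n') 1 + scale t' x = scale (- n) 1 + scale t x"
      using that assms(2) by simp
    from compare_coeffs[OF assms(1) this] show ?thesis by simp
  qed
  with assms show ?thesis unfolding trd_def by (auto intro!: the_equality)
qed

lemma trd_quadratic: "\<exists>n. x * x = scale (trd x) x - scale n 1"
proof (cases "scalar x")
  case True
  then obtain c where x: "x = scale c 1" by (auto simp: scalar_def)
  have "x * x = scale (trd x) x - scale (c * c) 1" by (simp add: x qa_simps)
  then show ?thesis by (rule exI)
next
  case False
  obtain t n where tn: "x * x = scale t x - scale n 1" using quadratic by blast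
  show ?thesis unfolding trd_unique[OF False tn] by (rule exI, rule tn)
qed

lemma trd_affine: "trd (scale a 1 + scale b x) = a + a + b * trd x"
proof (cases "scalar x \<or> b = 0")
  case True
  then show ?thesis
  proof
    assume "scalar x"
    then obtain c where x: "x = scale c 1" by (auto simp: scalar_def)
    have "scale a 1 + scale b x = scale (a + b * c) 1" by (simp add: x scale_left_distrib)
    then show ?thesis by (simp only: x trd_scalar) (simp add: algebra_simps)
  qed simp
next
  case False
  let ?z = "scale a 1 + scale b x"
  have z: "\<not> scalar ?z"
  proof
    assume "scalar ?z"
    then obtain c where "?z = scale c 1 + scale 0 x" by (auto simp: scalar_def)
    from compare_coeffs[OF _ this] False show False by blast
  qed
  obtain n where n: "x * x = scale (trd x) x - scale n 1" using trd_quadratic by blast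
  have "?z * ?z = scale (a + a + b * trd x) ?z - scale (a * a + a * b * trd x + b * b * n) 1"
    by (simp add: qa_simps n algebra_simps)
  then show ?thesis by (rule trd_unique[OF z])
qed

text \<open>
  The element \<open>x y + y x - trd x y\<close> commutes with \<open>x\<close> because of the quadratic equation of \<open>x\<close>. The
  equations of \<open>x\<close>, \<open>y\<close> and \<open>x + y\<close> express it as \<open>d y\<close> plus terms in \<open>x\<close> and \<open>1\<close>, where \<open>d\<close> is the
  defect of additivity; so \<open>d\<close> vanishes, as \<open>x\<close> and \<open>y\<close> do not commute. Comparing \<open>x + y\<close> with
  \<open>x + c y\<close> for a scalar \<open>c\<close> instead would fail over the field with two elements.
\<close>

lemma trd_add_independent:
  assumes x: "\<not> scalar x" and y: "\<And>a b. y \<noteq> scale a 1 + scale b x"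
  shows "trd (x + y) = trd x + trd y"
proof -
  obtain n where n: "x * x = scale (trd x) x - scale n 1" using trd_quadratic by blast
  obtain m where m: "y * y = scale (trd y) y - scale m 1" using trd_quadratic by blast
  obtain N where N: "(x + y) * (x + y) = scale (trd (x + y)) (x + y) - scale N 1" using trd_quadratic by blast
  let ?d = "trd (x + y) - trd x - trd y"
  have yx: "y * x = - (x * y) + scale (trd (x+y) - trd x) x + scale (trd (x + y) - trd y) y - scale (N - n - m) 1"
    using N by (simp add: qa_simps n m algebra_simps)
  have "x * (x * y + y * x - scale (trd x) y) = (x * y + y * x - scale (trd x) y) * x"
  proof -
    have "x * (x * y) = scale (trd x) (x * y) - scale n y"
      by (simp add: mult.assoc[symmetric] n) (simp add: qa_simps)
    then show ?thesis using n by (simp add: qa_simps)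
  qed
  moreover have "x * y + y * x - scale (trd x) y
      = scale ?d y + scale (trd (x + y) - trd x) x - scale (N - n - m) 1"
    unfolding yx by (simp add: qa_simps algebra_simps)
  ultimately have "scale ?d (x * y) = scale ?d (y * x)" by (simp add: qa_simps)
  then have "?d = 0" using noncommuting[OF x y] by (simp add: scale_cancel_left)
  then show ?thesis by (simp add: algebra_simps)
qed

lemma trd_add: "trd (x + y) = trd x + trd y"
proof (cases "scalar x")
  case True
  then obtain c where "x = scale c 1" by (auto simp: scalar_def)
  then show ?thesis using trd_affine[of c 1 y] by simp
next
  case x: False
  show ?thesis
  proof (cases "\<exists>a b. y = scale a 1 + scale b x")
    case True
    then obtain a b where y: "y = scale a 1 + scale b x" by blast
    have "x + y = scale a 1 + scale (1 + b) x" unfolding y by (simp add: scale_left_distrib)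
    then have "trd (x + y) = a + a + (1 + b) * trd x" by (metis trd_affine)
    then show ?thesis unfolding y trd_affine by (simp add: algebra_simps)
  next
    case False
    then show ?thesis using trd_add_independent x by blast
  qed
qed

lemma trd_scale: "trd (scale b x) = b * trd x"
  using trd_affine[of 0 b x] by simp

lemma trd_minus: "trd (- x) = - trd x" using trd_scale[of "-1" x] by simp

lemma trd_diff: "trd (x - y) = trd x - trd y" using trd_add[of x "-y"] by (simp add: trd_minus)

lemma trd_one: "trd 1 = 1 + 1" using trd_scalar[of 1] by simp

lemma polarized_quadratic:
  "\<exists>g. x * y + y * x = scale (trd x) y + scale (trd y) x + scale g 1"
proof -
  obtain n where n: "x * x = scale (trd x) x - scale n 1" using trd_quadratic by blast
  obtain m where m: "y * y = scale (trd y) y - scale m 1" using trd_quadratic by blast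
  obtain N where N: "(x + y) * (x + y) = scale (trd (x + y)) (x + y) - scale N 1" using trd_quadratic by blast
  have "x * y + y * x = scale (trd x) y + scale (trd y) x + scale (n + m - N) 1"
    using N by (simp add: qa_simps n m trd_add algebra_simps)
  then show ?thesis by blast
qed

text \<open>
  The unknown scalar in the polarized equation of \<open>x\<close> and \<open>y\<close> is found from the polarized equation
  of \<open>x\<close> and \<open>x y\<close>, whose left-hand side is \<open>x (x y + y x)\<close>.
\<close>

lemma polarized_quadratic_trd:
  "x * y + y * x = scale (trd x) y + scale (trd y) x + scale (trd (x * y) - trd x * trd y) 1"
proof (cases "scalar x")
  case True
  then obtain c where x: "x = scale c 1" by (auto simp: scalar_def)
  show ?thesis unfolding x by (simp add: trd_scale trd_one qa_simps algebra_simps)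
next
  case False
  obtain g where g: "x * y + y * x = scale (trd x) y + scale (trd y) x + scale g 1"
    using polarized_quadratic by blast
  obtain h where h: "x * (x * y) + (x * y) * x = scale (trd x) (x * y) + scale (trd (x * y)) x + scale h 1"
    using polarized_quadratic by blast
  obtain n where n: "x * x = scale (trd x) x - scale n 1" using trd_quadratic by blast
  have "x * (x * y) + (x * y) * x = x * (x * y + y * x)" by (simp add: qa_simps)
  also have "\<dots> = scale (trd x) (x * y) + scale (trd y) (x * x) + scale g x"
    unfolding g by (simp add: qa_simps)
  finally have "scale h 1 + scale (trd (x * y)) x = scale (- (trd y * n)) 1 + scale (trd x * trd y + g) x"
    unfolding h n by (simp add: qa_simps algebra_simps)
  from compare_coeffs[OF False this] have "g = trd (x * y) - trd x * trd y" by simp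
  with g show ?thesis by simp
qed

definition bar :: "'a \<Rightarrow> 'a" where "bar x = scale (trd x) 1 - x"

text \<open>
  An involution \<open>f\<close> with the defining properties makes \<open>x\<close> a root of the polynomial with coefficients
  \<open>x + f x\<close> and \<open>x f(x)\<close>. For nonscalar \<open>x\<close> the first of them must be the trace.
\<close>

lemma canonical_involution_eq_bar: "\<kappa> = bar"
  unfolding canonical_involution_def
proof (rule the_equality)
  have "bar (x * y) = bar y * bar x" for x y
    using polarized_quadratic_trd[of x y] unfolding bar_def
    by (simp add: qa_simps algebra_simps)
  moreover have "bar (bar x) = x" for x
    unfolding bar_def by (simp add: trd_diff)
  moreover have "\<exists>c. x * bar x = scale c 1" for x
  proof -
    obtain n where n: "x * x = scale (trd x) x - scale n 1" using trd_quadratic by blast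
    then have "x * bar x = scale n 1" unfolding bar_def by (simp add: qa_simps)
    then show ?thesis by blast
  qed
  moreover have "\<exists>c. x + bar x = scale c 1" for x
    unfolding bar_def by auto
  moreover have "Vector_Spaces.linear scale scale bar"
    unfolding Vector_Spaces.linear_iff bar_def
    by (auto simp: trd_add trd_scale qa_simps algebra_simps vector_space_axioms)
  ultimately show "Vector_Spaces.linear scale scale bar \<and>
    (\<forall>x y. bar (x * y) = bar y * bar x) \<and> (\<forall>x. bar (bar x) = x) \<and>
    (\<forall>x. \<exists>c. x + bar x = scale c 1) \<and> (\<forall>x. \<exists>c. x * bar x = scale c 1)" by blast
next
  fix f assume f: "Vector_Spaces.linear scale scale f \<and>
    (\<forall>x y. f (x * y) = f y * f x) \<and> (\<forall>x. f (f x) = x) \<and>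
    (\<forall>x. \<exists>c. x + f x = scale c 1) \<and> (\<forall>x. \<exists>c. x * f x = scale c 1)"
  then interpret f: Vector_Spaces.linear scale scale f by blast
  have f1: "f 1 = 1" using f by (metis mult_1 mult.right_neutral)
  show "f = bar"
  proof
    fix x
    show "f x = bar x"
    proof (cases "scalar x")
      case True
      then obtain c where x: "x = scale c 1" by (auto simp: scalar_def)
      show ?thesis unfolding x bar_def by (simp add: f.scale f1 qa_simps)
    next
      case False
      obtain c d where c: "x + f x = scale c 1" and d: "x * f x = scale d 1" using f by blast
      from c have fx: "f x = scale c 1 - x" by (simp add: algebra_simps)
      have "x * x = scale c x - scale d 1" using d unfolding fx by (simp add: qa_simps algebra_simps)
      from trd_unique[OF False this] fx show ?thesis by (simp add: bar_def)
    qed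
  qed
qed

lemma kappa_eq: "\<kappa> x = scale (trd x) 1 - x"
  by (simp add: canonical_involution_eq_bar bar_def)

lemma kappa_mult: "\<kappa> (x * y) = \<kappa> y * \<kappa> x"
    using polarized_quadratic_trd[of x y] unfolding kappa_eq
    by (simp add: qa_simps algebra_simps)

lemma kappa_kappa [simp]: "\<kappa> (\<kappa> x) = x"
  by (simp add: kappa_eq trd_diff)

lemma kappa_scale: "\<kappa> (scale c x) = scale c (\<kappa> x)"
  and kappa_add: "\<kappa> (x + y) = \<kappa> x + \<kappa> y"
  and kappa_diff: "\<kappa> (x - y) = \<kappa> x - \<kappa> y"
  and kappa_minus: "\<kappa> (- x) = - \<kappa> x"
  and kappa_one [simp]: "\<kappa> 1 = 1"
  by (simp_all add: kappa_eq trd_add trd_scale trd_diff trd_minus trd_one qa_simps algebra_simps)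

lemma trd_zero [simp]: "trd 0 = 0" using trd_scale[of 0 0] by simp

lemma add_kappa: "x + \<kappa> x = scale (trd x) 1"
  by (simp add: kappa_eq)

lemma mult_kappa: "x * \<kappa> x = scale (nrd x) 1"
proof -
  obtain n where n: "x * x = scale (trd x) x - scale n 1" using trd_quadratic by blast
  then have *: "x * \<kappa> x = scale n 1" unfolding kappa_eq by (simp add: qa_simps)
  have "nrd x = n" unfolding nrd_def * by auto
  with * show ?thesis by simp
qed

lemma kappa_mult_self: "\<kappa> x * x = scale (nrd x) 1"
  using mult_kappa[of x] by (simp add: kappa_eq qa_simps)

lemma square_eq: "x * x = scale (trd x) x - scale (nrd x) 1"
  using mult_kappa[of x] by (simp add: kappa_eq qa_simps algebra_simps)

lemma nrd_eqI: "x * \<kappa> x = scale c 1 \<Longrightarrow> nrd x = c"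
  by (simp add: mult_kappa)

lemma nrd_mult: "nrd (x * y) = nrd x * nrd y"
proof (rule nrd_eqI)
  have "x * y * \<kappa> (x * y) = x * (y * \<kappa> y) * \<kappa> x" by (simp add: kappa_mult mult.assoc)
  then show "x * y * \<kappa> (x * y) = scale (nrd x * nrd y) 1"
    by (simp add: mult_kappa qa_simps mult.commute)
qed

lemma nrd_scale: "nrd (scale c x) = c * c * nrd x"
  by (rule nrd_eqI) (simp add: kappa_scale qa_simps mult_kappa)

lemma nrd_one [simp]: "nrd 1 = 1" by (rule nrd_eqI) simp

lemma nrd_zero [simp]: "nrd 0 = 0" by (rule nrd_eqI) simp

lemma nrd_minus [simp]: "nrd (- x) = nrd x" using nrd_scale[of "-1" x] by simp

lemma trd_kappa [simp]: "trd (\<kappa> x) = trd x" by (simp add: kappa_eq trd_diff)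

lemma nrd_kappa [simp]: "nrd (\<kappa> x) = nrd x"
  by (rule nrd_eqI) (simp add: kappa_mult_self)

lemma trd_mult_commute: "trd (x * y) = trd (y * x)"
proof -
  have "scale (trd (x * y) - trd x * trd y) (1::'a) = scale (trd (y * x) - trd y * trd x) 1"
    using polarized_quadratic_trd[of x y] polarized_quadratic_trd[of y x]
    by (simp add: algebra_simps)
  then show ?thesis by (simp add: mult.commute)
qed

lemma polar_eq: "polar x y = trd (x * \<kappa> y)"
proof -
  have "(x + y) * \<kappa> (x + y) = x * \<kappa> x + y * \<kappa> y + (x * \<kappa> y + \<kappa> (x * \<kappa> y))"
    by (simp add: kappa_add kappa_mult qa_simps algebra_simps)
  also have "\<dots> = scale (nrd x + nrd y + trd (x * \<kappa> y)) 1"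
    by (simp add: add_kappa mult_kappa qa_simps)
  finally show ?thesis unfolding polar_def by (subst nrd_eqI[of "x + y"]) auto
qed

lemma nrd_add: "nrd (x + y) = nrd x + nrd y + polar x y"
  by (simp add: polar_def)

lemma polar_commute: "polar x y = polar y x"
  by (simp add: polar_def add.commute)

lemma polar_add_left: "polar (x + y) z = polar x z + polar y z"
  and polar_scale_left: "polar (scale c x) z = c * polar x z"
  and polar_diff_left: "polar (x - y) z = polar x z - polar y z"
  and polar_add_right: "polar z (x + y) = polar z x + polar z y"
  and polar_scale_right: "polar z (scale c x) = c * polar z x"
  and polar_diff_right: "polar z (x - y) = polar z x - polar z y"
  and polar_minus_left: "polar (- x) z = - polar x z"
  and polar_minus_right: "polar z (- x) = - polar z x"
  by (simp_all add: polar_eq kappa_add kappa_scale kappa_diff kappa_minus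
     trd_add trd_scale trd_diff trd_minus qa_simps)

lemmas polar_simps = polar_add_left polar_scale_left polar_diff_left polar_add_right
  polar_scale_right polar_diff_right polar_minus_left polar_minus_right

lemma polar_one_right: "polar x 1 = trd x" by (simp add: polar_eq)

lemma polar_mult_left: "polar (a * x) y = polar x (\<kappa> a * y)"
  using trd_mult_commute[of a "x * \<kappa> y"] by (simp add: polar_eq kappa_mult mult.assoc)

lemma polar_mult_right: "polar (x * a) y = polar x (y * \<kappa> a)"
  by (simp add: polar_eq kappa_mult mult.assoc)

lemma polar_self: "polar x x = nrd x + nrd x"
  by (simp add: polar_eq mult_kappa)

lemma not_commutative: "\<exists>x y. x * y \<noteq> y * (x::'a)"
proof (rule ccontr)
  assume "\<not> ?thesis"
  then have "scalar x" for x using scalar_iff_central by blast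
  then have "span {1} = UNIV" by (auto simp: span_singleton scalar_def)
  from spanning_card[OF this] show False by simp
qed

text \<open>
  The radical of the polar form is a two-sided ideal. If it were the whole algebra, then the trace
  would vanish, so that the characteristic is two and \<open>\<kappa>\<close> is the identity; but \<open>\<kappa>\<close> reverses
  products and \<open>A\<close> is not commutative.
\<close>

lemma nondegenerate:
  assumes "\<And>y. polar x y = 0" shows "x = 0"
proof -
  let ?I = "{x. \<forall>y. polar x y = 0}"
  have "?I = {0} \<or> ?I = UNIV"
  proof (rule simple)
    show "\<forall>a. \<forall>x\<in>?I. a * x \<in> ?I \<and> x * a \<in> ?I"
    proof (intro allI ballI conjI)
      fix a x assume x: "x \<in> ?I"
      show "a * x \<in> ?I" using x by (simp add: polar_mult_left)
      show "x * a \<in> ?I" using x by (simp add: polar_mult_right)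
    qed
  qed (auto simp: polar_simps polar_eq[of 0])
  moreover have "?I \<noteq> UNIV"
  proof
    assume U: "?I = UNIV"
    then have "1 \<in> ?I" by simp
    then have t: "trd y = 0" for y using polar_commute[of 1 y] by (simp add: polar_one_right)
    then have k: "\<kappa> y = - y" for y by (simp add: kappa_eq)
    have "x * y = y * x" for x y :: 'a
    proof -
      have "1 + 1 = (0::'k)" using t[of 1] trd_one by simp
      then have "z + z = 0" for z :: 'a using scale_left_distrib[of 1 1 z] by simp
      then have "z = - z" for z :: 'a by (simp add: eq_neg_iff_add_eq_0)
      then show ?thesis using kappa_mult[of x y] k by (metis minus_mult_minus)
    qed
    then show False using not_commutative by blast
  qed
  ultimately show ?thesis using assms by auto
qed

lemma carrier_Astar: "a \<in> carrier Astar \<longleftrightarrow> nrd a \<noteq> 0"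
proof -
  have "nrd a \<noteq> 0" if "a * b = 1" for b using that nrd_mult[of a b] by auto
  moreover have "a * scale (inverse (nrd a)) (\<kappa> a) = 1 \<and> scale (inverse (nrd a)) (\<kappa> a) * a = 1"
    if "nrd a \<noteq> 0" using that by (simp add: qa_simps mult_kappa kappa_mult_self)
  ultimately show ?thesis unfolding Astar_def by auto
qed

definition ainv :: "'a \<Rightarrow> 'a" where "ainv a = scale (inverse (nrd a)) (\<kappa> a)"

lemma ainv [simp]: "nrd a \<noteq> 0 \<Longrightarrow> a * ainv a = 1" "nrd a \<noteq> 0 \<Longrightarrow> ainv a * a = 1"
  by (simp_all add: ainv_def qa_simps mult_kappa kappa_mult_self)

lemma ainv_cancel [simp]: "nrd a \<noteq> 0 \<Longrightarrow> a * (ainv a * x) = x" "nrd a \<noteq> 0 \<Longrightarrow> ainv a * (a * x) = x"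
  by (simp_all add: mult.assoc[symmetric])

lemma nrd_ainv: "nrd (ainv a) = inverse (nrd a)"
  by (cases "nrd a = 0") (simp_all add: ainv_def nrd_scale)

lemma ainv_unique: "nrd a \<noteq> 0 \<Longrightarrow> a * b = 1 \<Longrightarrow> b = ainv a"
  by (metis ainv(2) mult.assoc mult_1 mult.right_neutral)

lemma ainv_mult: "nrd a \<noteq> 0 \<Longrightarrow> nrd b \<noteq> 0 \<Longrightarrow> ainv (a * b) = ainv b * ainv a"
  by (rule ainv_unique[symmetric]) (simp_all add: nrd_mult mult.assoc)

lemma ainv_ainv [simp]: "nrd a \<noteq> 0 \<Longrightarrow> ainv (ainv a) = a"
  by (rule ainv_unique[symmetric]) (simp_all add: nrd_ainv)

lemma ainv_one [simp]: "ainv 1 = 1" by (rule ainv_unique[symmetric]) simp_all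

lemma ainv_scale: "c \<noteq> 0 \<Longrightarrow> ainv (scale c a) = scale (inverse c) (ainv a)"
  by (simp add: ainv_def nrd_scale kappa_scale field_simps)

section \<open>Isometries and similitudes of the norm\<close>

lemma nrd_diff: "nrd (x - y) = nrd x + nrd y - polar x y"
  using nrd_add[of x "-y"] by (simp add: polar_simps)

lemma square_mult: "x * (x * z) = scale (trd x) (x * z) - scale (nrd x) z"
  and mult_kappa_mult: "x * (\<kappa> x * z) = scale (nrd x) z"
  and kappa_mult_mult: "\<kappa> x * (x * z) = scale (nrd x) z"
  by (simp_all only: mult.assoc[symmetric] square_eq mult_kappa kappa_mult_self)
    (simp_all add: qa_simps)

text \<open>
  Up to sign, this is the discriminant of the characteristic polynomial of \<open>x\<close>. So \<open>x - \<kappa> x\<close> is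
  invertible if and only if \<open>x\<close> generates a separable quadratic subalgebra.
\<close>

lemma nrd_diff_kappa: "nrd (x - \<kappa> x) = 4 * nrd x - trd x * trd x"
proof -
  have "polar x (\<kappa> x) = trd x * trd x - 2 * nrd x"
    by (simp add: polar_eq square_eq trd_diff trd_scale trd_one algebra_simps)
  then show ?thesis by (simp add: nrd_diff)
qed

lemma commutant:
  assumes "\<not> scalar x" "u * x = x * u"
  obtains a b where "u = scale a 1 + scale b x"
  using noncommuting[OF assms(1), of u] assms(2) by metis

lemma commutant_commutative:
  assumes "\<not> scalar x" "u * x = x * u" "v * x = x * v"
  shows "u * v = v * u"
proof -
  obtain a b where u: "u = scale a 1 + scale b x" using commutant assms by blast
  show ?thesis unfolding u using assms(3) by (simp add: qa_simps)
qed

lemma separable_not_scalar: "nrd (x - \<kappa> x) \<noteq> 0 \<Longrightarrow> \<not> scalar x"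
  by (auto simp: scalar_def kappa_scale)

text \<open>
  If \<open>x - \<kappa> x\<close> always has norm \<open>0\<close>, polarization and nondegeneracy give \<open>2 (x - \<kappa> x) = 0\<close>. In
  characteristic different from two this makes every element scalar. In characteristic two the
  norm of \<open>x - \<kappa> x\<close> is the square of the trace, so the trace vanishes.
\<close>

lemma exists_separable: "\<exists>x. nrd (x - \<kappa> x) \<noteq> 0"
proof (rule ccontr)
  assume neg: "\<not> ?thesis"
  have "polar (x - \<kappa> x) (y - \<kappa> y) = 0" for x y
  proof -
    have "(x + y) - \<kappa> (x + y) = (x - \<kappa> x) + (y - \<kappa> y)" by (simp add: kappa_add)
    then show ?thesis using neg nrd_add[of "x - \<kappa> x" "y - \<kappa> y"] by (metis add.right_neutral add_cancel_right_right)
  qed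
  moreover have "polar (x - \<kappa> x) (\<kappa> y) = - polar (x - \<kappa> x) y" for x y
  proof -
    have "polar (x - \<kappa> x) (\<kappa> y) = trd (\<kappa> ((x - \<kappa> x) * y))" by (simp only: polar_eq kappa_kappa trd_kappa)
    also have "\<dots> = trd (\<kappa> y * - (x - \<kappa> x))" by (simp add: kappa_mult kappa_diff)
    also have "\<dots> = trd (- ((x - \<kappa> x) * \<kappa> y))"
      by (simp only: trd_mult_commute[of "\<kappa> y"] minus_mult_left)
    also have "\<dots> = - trd ((x - \<kappa> x) * \<kappa> y)" by (rule trd_minus)
    finally show ?thesis by (simp add: polar_eq)
  qed
  ultimately have "polar ((x - \<kappa> x) + (x - \<kappa> x)) y = 0" for x y
    by (metis polar_add_left polar_diff_right diff_minus_eq_add)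
  then have two: "(x - \<kappa> x) + (x - \<kappa> x) = 0" for x using nondegenerate by blast
  obtain x where x: "\<not> scalar x" using not_commutative scalar_iff_central by blast
  have "scale (- (trd x + trd x)) 1 + scale 4 x = scale 0 1 + scale 0 x"
    using two[of x] scale_left_distrib[of 2 2 x] by (simp add: kappa_eq qa_simps algebra_simps)
  from compare_coeffs[OF x this] have "(4::'k) = 0" by blast
  then have "(2::'k) = 0" using mult_eq_0_iff[of "2::'k" 2] by simp
  then have "trd y = 0" for y using neg nrd_diff_kappa[of y] \<open>4 = 0\<close> by auto
  then show False using nondegenerate[of 1] one_neq_zero by (simp add: polar_eq)
qed

text \<open>
  Every element \<open>g = p z - z \<kappa>(x)\<close> satisfies \<open>g x = p g\<close>. If all of them have norm \<open>0\<close>, polarization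
  and nondegeneracy give \<open>p z x + \<kappa>(p) z \<kappa>(x) = 2 nrd(x) z\<close>. This says that \<open>p\<close> and \<open>\<kappa>(p)\<close> agree on
  \<open>z x - \<kappa>(p) z\<close>, which is therefore \<open>0\<close>; and if that holds for all \<open>z\<close>, then \<open>x\<close> is central.
\<close>

lemma conjugate_if_same_char_poly:
  assumes x: "nrd (x - \<kappa> x) \<noteq> 0" and p: "trd p = trd x" "nrd p = nrd x"
  shows "\<exists>g. nrd g \<noteq> 0 \<and> g * x = p * g"
proof (rule ccontr)
  assume neg: "\<not> ?thesis"
  let ?g = "\<lambda>z. p * z - z * \<kappa> x"
  have "?g z * x = p * ?g z" for z
  proof -
    have "?g z * x = p * (z * x) - scale (nrd x) z" by (simp add: qa_simps kappa_mult_self)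
    also have "\<dots> = p * (p * z) - p * (z * \<kappa> x)"
      by (simp add: square_mult p kappa_eq[of x] qa_simps)
    finally show ?thesis by (simp add: right_diff_distrib)
  qed
  then have g0: "nrd (?g z) = 0" for z using neg by blast
  have E: "p * z * x + \<kappa> p * z * \<kappa> x = scale (nrd x) z + scale (nrd x) z" for z
  proof -
    have "polar (\<kappa> p * ?g z - ?g z * x) w = 0" for w
    proof -
      have "?g (z + w) = ?g z + ?g w" by (simp add: algebra_simps)
      then have "polar (?g z) (?g w) = 0" using nrd_add[of "?g z" "?g w"] g0[of z] g0[of w] g0[of "z + w"]
        by simp
      moreover have "polar (?g z) (p * w) = polar (\<kappa> p * ?g z) w"
        by (simp only: polar_mult_left kappa_kappa)
      moreover have "polar (?g z) (w * \<kappa> x) = polar (?g z * x) w"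
        by (simp only: polar_mult_right)
      ultimately show ?thesis by (simp add: polar_simps)
    qed
    then have "\<kappa> p * ?g z - ?g z * x = 0" using nondegenerate by blast
    moreover have "\<kappa> p * (p * z) = scale (nrd x) z" by (simp add: kappa_mult_mult p)
    moreover have "z * \<kappa> x * x = scale (nrd x) z"
      by (simp add: mult.assoc kappa_mult_self qa_simps)
    ultimately show ?thesis by (simp add: right_diff_distrib left_diff_distrib mult.assoc algebra_simps)
  qed
  have "z * x = \<kappa> p * z" for z
  proof -
    let ?y = "z * x - \<kappa> p * z"
    have "p * (\<kappa> p * z) = scale (nrd x) z" by (simp add: mult_kappa_mult p)
    then have "p * ?y = scale (nrd x) z - \<kappa> p * z * \<kappa> x"
      using E[of z] by (simp add: right_diff_distrib mult.assoc algebra_simps)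
    also have "\<dots> = \<kappa> p * ?y"
    proof -
      have "\<kappa> p * (\<kappa> p * z) = scale (trd x) (\<kappa> p * z) - scale (nrd x) z"
        using square_mult[of "\<kappa> p"] by (simp add: p)
      then show ?thesis by (simp add: kappa_eq[of x] qa_simps algebra_simps)
    qed
    finally have "(p - \<kappa> p) * ?y = 0" by (simp add: left_diff_distrib)
    moreover have "nrd (p - \<kappa> p) \<noteq> 0" using x by (simp add: nrd_diff_kappa p)
    ultimately have "?y = 0" by (metis ainv_cancel(2) mult_zero_right)
    then show ?thesis by simp
  qed
  then have "x = \<kappa> p" "\<And>z. z * x = \<kappa> p * z" by (metis mult_1 mult_1_right, blast)
  then have "scalar x" by (metis scalar_iff_central)
  then show False using separable_not_scalar[OF x] by simp
qed

text \<open>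
  The right-hand side describes the orthogonal complement of \<open>1\<close> and \<open>x\<close>. Hence every isometry
  that fixes \<open>1\<close> and \<open>x\<close> maps the elements \<open>w\<close> among themselves.
\<close>

lemma anticommutant_iff:
  assumes x: "nrd (x - \<kappa> x) \<noteq> 0"
  shows "x * w = w * \<kappa> x \<longleftrightarrow> trd w = 0 \<and> polar w x = 0"
proof -
  have "trd w = 0" if w: "x * w = w * \<kappa> x"
  proof -
    have "\<kappa> (x * w) = \<kappa> (w * \<kappa> x)" using w by simp
    then have "\<kappa> w * \<kappa> x = x * \<kappa> w" by (simp add: kappa_mult)
    with w have "(w + \<kappa> w) * \<kappa> x = x * (w + \<kappa> w)" by (simp add: distrib_left distrib_right)
    then have "scale (trd w) (x - \<kappa> x) = 0" by (auto simp: add_kappa qa_simps)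
    then show ?thesis using x by auto
  qed
  moreover have "x * w = w * \<kappa> x \<longleftrightarrow> polar w x = 0" if t: "trd w = 0"
  proof -
    have "\<kappa> (w * \<kappa> x) = - (x * w)" using t by (simp add: kappa_mult) (simp add: kappa_eq)
    then have "scale (polar w x) 1 = w * \<kappa> x - x * w" using add_kappa[of "w * \<kappa> x"] by (simp add: polar_eq)
    moreover have "scale (polar w x) (1::'a) = 0 \<longleftrightarrow> polar w x = 0" using one_neq_zero by simp
    ultimately show ?thesis by auto
  qed
  ultimately show ?thesis by blast
qed

text \<open>
  On an element \<open>w\<close> of the second kind, \<open>[x, w] = (x - \<kappa> x) w\<close>. Hence the second component of \<open>z\<close> must
  be \<open>(x - \<kappa> x)\<^sup>-\<^sup>1 [x, z]\<close>.
\<close>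

lemma commutant_splitting:
  assumes x: "nrd (x - \<kappa> x) \<noteq> 0"
  shows "\<exists>u w. z = u + w \<and> u * x = x * u \<and> x * w = w * \<kappa> x"
proof -
  let ?d = "x - \<kappa> x"
  let ?c = "x * z - z * x"
  define w where "w = ainv ?d * ?c"
  have dx: "x * ?d = ?d * x" by (simp add: right_diff_distrib left_diff_distrib mult_kappa kappa_mult_self)
  have xd: "x * ainv ?d = ainv ?d * x"
  proof -
    have "x * ainv ?d = ainv ?d * (?d * x) * ainv ?d" using x by simp
    also have "\<dots> = ainv ?d * x" unfolding dx[symmetric] using x by (simp add: mult.assoc)
    finally show ?thesis .
  qed
  have "x * ?c = ?c * \<kappa> x"
    by (simp add: kappa_eq[of x] qa_simps square_mult square_eq[of x])
  then have w: "x * w = w * \<kappa> x" unfolding w_def by (metis xd mult.assoc)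
  have "x * w - w * x = ?c"
  proof -
    have "w * x = \<kappa> x * w" using w by (simp add: kappa_eq qa_simps)
    then have "x * w - w * x = ?d * w" by (simp add: left_diff_distrib)
    also have "\<dots> = ?c" unfolding w_def using x by simp
    finally show ?thesis .
  qed
  then have "(z - w) * x = x * (z - w)" by (simp add: algebra_simps)
  with w show ?thesis by (intro exI[of _ "z - w"] exI[of _ w]) simp
qed

text \<open>
  The two summands of \<open>commutant_splitting\<close> are orthogonal. If the second one contained no unit, it
  would be totally isotropic and thus contained in the radical.
\<close>

lemma exists_anticommuting_unit:
  assumes x: "nrd (x - \<kappa> x) \<noteq> 0"
  shows "\<exists>y. nrd y \<noteq> 0 \<and> x * y = y * \<kappa> x"
proof (rule ccontr)
  assume neg: "\<not> ?thesis"
  note ns = separable_not_scalar[OF x]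
  have isotropic: "nrd w = 0" if "x * w = w * \<kappa> x" for w using neg that by blast
  have "w = 0" if w: "x * w = w * \<kappa> x" for w
  proof (rule nondegenerate)
    fix z
    obtain u v where z: "z = u + v" and u: "u * x = x * u" and v: "x * v = v * \<kappa> x"
      using commutant_splitting[OF x] by blast
    obtain a b where "u = scale a 1 + scale b x" using commutant[OF ns u] .
    then have "polar w u = 0" using w unfolding anticommutant_iff[OF x] by (simp add: polar_simps polar_one_right)
    moreover have "x * (w + v) = (w + v) * \<kappa> x" using w v by (simp add: algebra_simps)
    then have "polar w v = 0" using nrd_add[of w v] isotropic[OF w] isotropic[OF v] isotropic[of "w + v"] by simp
    ultimately show "polar w z = 0" by (simp add: z polar_simps)
  qed
  then have "z * x = x * z" for z using commutant_splitting[OF x, of z] by (metis add.right_neutral)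
  then show False using ns scalar_iff_central by auto
qed

text \<open>
  Hilbert's Theorem 90 for the subalgebra generated by \<open>x\<close>, which may be split. Every
  \<open>d = z + c \<kappa>(z)\<close> solves the equation. The choices \<open>z = 1\<close> and \<open>z = x - \<kappa> x\<close> give the norms
  \<open>2 + trd c\<close> and \<open>(2 - trd c) nrd(x - \<kappa> x)\<close>. Both vanish only if the characteristic is two and
  \<open>trd c = 0\<close>, and then \<open>c = 1\<close>.
\<close>

lemma hilbert_90:
  assumes x: "nrd (x - \<kappa> x) \<noteq> 0" and c: "c * x = x * c" "nrd c = 1"
  shows "\<exists>d. nrd d \<noteq> 0 \<and> d * x = x * d \<and> c * \<kappa> d = d"
proof (cases "nrd (1 + c) \<noteq> 0")
  case True
  have "c * \<kappa> (1 + c) = 1 + c" by (simp add: kappa_add distrib_left mult_kappa c add.commute)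
  with True show ?thesis using c by (intro exI[of _ "1 + c"]) (simp add: distrib_left distrib_right)
next
  case False
  note ns = separable_not_scalar[OF x]
  have t: "2 + trd c = 0" using False by (simp add: nrd_add c polar_eq trd_kappa)
  define d where "d = x - \<kappa> x"
  have dx: "d * x = x * d" by (simp add: d_def algebra_simps mult_kappa kappa_mult_self)
  have kd: "\<kappa> d = - d" by (simp add: d_def kappa_diff)
  have cd: "c * d = d * c" by (rule commutant_commutative[OF ns c(1) dx])
  show ?thesis
  proof (cases "nrd (1 - c) \<noteq> 0")
    case True
    have "\<kappa> c * x = x * \<kappa> c" using c(1) by (simp add: kappa_eq[of c] qa_simps)
    then have "\<kappa> c * d = d * \<kappa> c" by (rule commutant_commutative[OF ns _ dx])
    then have "\<kappa> ((1 - c) * d) = \<kappa> c * d - d" by (simp add: kappa_mult kappa_diff kd algebra_simps)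
    then have "c * \<kappa> ((1 - c) * d) = (1 - c) * d"
      by (simp add: left_diff_distrib right_diff_distrib mult.assoc[symmetric] mult_kappa c)
    moreover have "(1 - c) * d * x = x * ((1 - c) * d)"
    proof -
      have "(1 - c) * x = x * (1 - c)" using c(1) by (simp add: algebra_simps)
      then show ?thesis using dx by (metis mult.assoc)
    qed
    ultimately show ?thesis using True x by (intro exI[of _ "(1 - c) * d"]) (simp add: nrd_mult d_def)
  next
    case False
    then have "2 - trd c = 0" by (simp add: nrd_diff c polar_eq trd_kappa)
    moreover have "(4::'k) = (2 + trd c) + (2 - trd c)" by simp
    ultimately have "(4::'k) = 0" using t by simp
    then have two: "(2::'k) = 0" using mult_eq_0_iff[of "2::'k" 2] by simp
    obtain a b where ab: "c = scale a 1 + scale b x" using commutant[OF ns c(1)] .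
    have "trd c = b * trd x" using two by (simp add: ab trd_add trd_scale trd_one)
    moreover have "trd x \<noteq> 0" using x \<open>4 = 0\<close> by (simp add: nrd_diff_kappa)
    ultimately have "b = 0" using t two by simp
    then have "a * a = 1" using c(2) by (simp add: ab nrd_scale)
    moreover have "(a - 1) * (a - 1) = a * a + (1 - 2 * a)" by (simp add: algebra_simps)
    ultimately have "(a - 1) * (a - 1) = 0" using two by simp
    then have "c = 1" using ab \<open>b = 0\<close> by simp
    then show ?thesis by (intro exI[of _ 1]) simp
  qed
qed

text \<open>
  The discriminant of \<open>a + b x\<close> is \<open>b\<^sup>2\<close> times that of \<open>x\<close>, so \<open>b\<close> is \<open>1\<close> or \<open>-1\<close>.
\<close>

lemma same_char_poly_in_commutant:
  assumes x: "nrd (x - \<kappa> x) \<noteq> 0" and f: "f * x = x * f" "trd f = trd x" "nrd f = nrd x"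
  shows "f = x \<or> f = \<kappa> x"
proof -
  note ns = separable_not_scalar[OF x]
  obtain a b where ab: "f = scale a 1 + scale b x" using commutant[OF ns f(1)] .
  have t: "2 * a + b * trd x = trd x" using f(2) by (simp add: ab trd_add trd_scale trd_one algebra_simps)
  have n: "a * a + a * b * trd x + b * b * nrd x = nrd x"
    using f(3) by (simp add: ab nrd_add nrd_scale polar_simps polar_commute[of 1] polar_one_right algebra_simps)
  have "(b * b - 1) * nrd (x - \<kappa> x) = 0" 
  proof -
    have "(b * b - 1) * (4 * N - T * T) = 4 * (a * a + a * b * T + b * b * N - N) - (2 * a + b * T - T) * (2 * a + b * T + T)"
      for N T :: 'k by (simp add: algebra_simps)
    from this[of "nrd x" "trd x"] show ?thesis using t n by (simp add: nrd_diff_kappa)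
  qed
  then have "(b - 1) * (b + 1) = 0" using x by (simp add: algebra_simps)
  then consider "b = 1" | "b = - 1" "b \<noteq> 1" by (auto simp: eq_neg_iff_add_eq_0)
  then show ?thesis
  proof cases
    case 1
    show ?thesis
    proof (cases "a = 0")
      case True then show ?thesis using ab 1 by simp
    next
      case False
      have two: "(2::'k) = 0" using t 1 False by simp
      have "a * (a + trd x) = 0" using n 1 by (simp add: distrib_left)
      then have "a = - trd x" using False by (simp add: eq_neg_iff_add_eq_0)
      then have "f = - \<kappa> x" by (simp add: ab 1 kappa_eq)
      also have "\<dots> = \<kappa> x" using two scale_double(1)[of "\<kappa> x"] by (simp add: neg_eq_iff_add_eq_0)
      finally show ?thesis by simp
    qed
  next
    case 2
    then have "2 * (a - trd x) = 0" using t by (simp add: algebra_simps)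
    moreover have "(2::'k) \<noteq> 0" using 2 by (metis add_eq_0_iff one_add_one)
    ultimately have "a = trd x" by simp
    then show ?thesis using 2 ab by (simp add: kappa_eq)
  qed
qed

definition twist :: "bool \<Rightarrow> 'a \<Rightarrow> 'a" where
  "twist e x = (if e then \<kappa> x else x)"

text \<open>
  Let \<open>K\<close> be the subalgebra generated by \<open>x\<close>, and \<open>A = K \<oplus> K y\<close>. Then \<open>\<psi>\<close> is the identity on \<open>K\<close> and maps
  the orthogonal complement \<open>K y\<close> to itself, so that \<open>\<psi> y = c y\<close> with \<open>nrd c = 1\<close> and
  \<open>\<psi> (x y) = f c y\<close>, where \<open>f\<close> has the trace and norm of \<open>x\<close>. So \<open>f\<close> is \<open>x\<close> or \<open>\<kappa>(x)\<close>. In the first case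
  \<open>\<psi>\<close> is conjugation by any \<open>d\<close> in \<open>K\<close> with \<open>c = d \<kappa>(d)\<^sup>-\<^sup>1\<close>. The second case reduces to the first,
  since \<open>z \<mapsto> y \<kappa>(z) y\<^sup>-\<^sup>1\<close> maps \<open>u + v y\<close> to \<open>u - \<kappa>(v) y\<close>.
\<close>

lemma isometry_fixing_separable:
  assumes lin: "Vector_Spaces.linear scale scale \<psi>" and iso: "\<And>z. nrd (\<psi> z) = nrd z"
    and fix1: "\<psi> 1 = 1" and x: "nrd (x - \<kappa> x) \<noteq> 0" and fixx: "\<psi> x = x"
  shows "\<exists>e d. nrd d \<noteq> 0 \<and> (\<forall>z. \<psi> z = d * twist e z * ainv d)"
proof -
  interpret lin: Vector_Spaces.linear scale scale \<psi> by fact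
  note ns = separable_not_scalar[OF x]
  note K = commutant_commutative[OF ns]
  have pol: "polar (\<psi> z) (\<psi> w) = polar z w" for z w
    unfolding polar_def by (simp add: lin.add[symmetric] iso)
  have trp: "trd (\<psi> z) = trd z" for z using pol[of z 1] by (simp add: fix1 polar_one_right)
  have W: "x * \<psi> w = \<psi> w * \<kappa> x" if "x * w = w * \<kappa> x" for w
    using that pol[of w x] unfolding anticommutant_iff[OF x] by (simp add: trp fixx)
  obtain y where y: "nrd y \<noteq> 0" "x * y = y * \<kappa> x" using exists_anticommuting_unit[OF x] by blast
  have ty: "trd y = 0" using y anticommutant_iff[OF x] by blast
  then have ky: "\<kappa> y = - y" by (simp add: kappa_eq)
  have iy: "ainv y = - scale (inverse (nrd y)) y" by (simp add: ainv_def ky)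
  have yx: "y * x = \<kappa> x * y" using y(2) by (simp add: kappa_eq qa_simps)
  have yK: "y * u = \<kappa> u * y" if u: "u * x = x * u" for u
  proof -
    obtain a b where ab: "u = scale a 1 + scale b x" using commutant[OF ns u] .
    show ?thesis unfolding ab using yx by (simp add: kappa_add kappa_scale qa_simps)
  qed
  have div: "\<exists>v. w = v * y \<and> v * x = x * v" if w: "x * w = w * \<kappa> x" for w
  proof (intro exI conjI)
    show "w = w * ainv y * y" using y by (simp add: mult.assoc)
    have "ainv y * x = \<kappa> x * ainv y" unfolding iy using yx by (simp add: qa_simps)
    then show "w * ainv y * x = x * (w * ainv y)" using w by (metis mult.assoc)
  qed
  obtain c where c: "\<psi> y = c * y" "c * x = x * c" using div W y by blast
  have "x * (x * y) = (x * y) * \<kappa> x" using y(2) by (metis mult.assoc)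
  then obtain g where g: "\<psi> (x * y) = g * y" "g * x = x * g" using div W by blast
  have nc: "nrd c = 1" using iso[of y] y(1) by (simp add: c nrd_mult)
  have kc: "\<kappa> c * x = x * \<kappa> c" using c(2) by (simp add: kappa_eq[of c] qa_simps)
  define f where "f = g * \<kappa> c"
  have gfc: "g = f * c" unfolding f_def by (simp add: mult.assoc kappa_mult_self nc)
  have fx: "f * x = x * f" unfolding f_def using g(2) kc by (metis mult.assoc)
  have "trd f = trd x"
  proof -
    have "polar (u * y) (v * y) = nrd y * polar u v" for u v
      by (simp add: polar_mult_right mult.assoc mult_kappa qa_simps polar_simps)
    then have "nrd y * polar g c = nrd y * polar x 1"
      using pol[of "x * y" y] by (metis c(1) g(1) mult_1)
    then show ?thesis using y(1) by (simp add: f_def polar_eq)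
  qed
  moreover have "nrd f = nrd x" using iso[of "x * y"] y(1) nc by (simp add: g f_def nrd_mult)
  ultimately have "f = x \<or> f = \<kappa> x" using same_char_poly_in_commutant[OF x fx] by blast
  then obtain e where e: "f = twist e x" by (metis twist_def)
  (* The sign comes from \<kappa> y = - y, see the effect of z \<mapsto> y \<kappa>(z) y\<^sup>-\<^sup>1 above. *)
  let ?c = "if e then - c else c"
  have "?c * x = x * ?c" "nrd ?c = 1" using c(2) nc by auto
  then obtain d where d: "nrd d \<noteq> 0" "d * x = x * d" "?c * \<kappa> d = d"
    using hilbert_90[OF x] by blast
  have dK: "d * u = u * d" if "u * x = x * u" for u using K[OF d(2) that] .
  have "nrd (\<kappa> d) \<noteq> 0" using d(1) by simp
  have dy: "d * y * ainv d = ?c * y"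
  proof -
    have kd: "\<kappa> d * x = x * \<kappa> d" using d(2) by (simp add: kappa_eq[of d] qa_simps)
    have "?c * y * d = ?c * (\<kappa> d * y)" using yK[OF d(2)] by (simp add: mult.assoc)
    also have "\<dots> = d * y" using d(3) by (simp add: mult.assoc[symmetric])
    finally have "d * y * ainv d = ?c * y * d * ainv d" by simp
    then show ?thesis using d(1) by (simp add: mult.assoc)
  qed
  define h where "h = (if e then d * y else d)"
  have nh: "nrd h \<noteq> 0" using d(1) y(1) by (simp add: h_def nrd_mult)
  have "\<psi> z * h = h * twist e z" for z
  proof -
    obtain u w where zu: "z = u + w" and u: "u * x = x * u" and w: "x * w = w * \<kappa> x"
      using commutant_splitting[OF x] by blast
    obtain v where v: "w = v * y" "v * x = x * v" using div[OF w] by blast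
    obtain a b where ab: "u = scale a 1 + scale b x" using commutant[OF ns u] .
    obtain a' b' where ab': "v = scale a' 1 + scale b' x" using commutant[OF ns v(2)] .
    have pu: "\<psi> u = u" by (simp add: ab lin.add lin.scale fix1 fixx)
    have "\<psi> w = scale a' (c * y) + scale b' (f * c * y)"
      unfolding v(1) ab' using c(1) g(1) gfc by (simp add: qa_simps lin.add lin.scale)
    also have "\<dots> = twist e v * c * y"
      unfolding ab' e twist_def by (simp add: kappa_add kappa_scale qa_simps)
    finally have pw: "\<psi> w = twist e v * c * y" .
    have ud: "u * d = d * u" using dK[OF u] by simp
    have kv: "\<kappa> v * x = x * \<kappa> v" using v(2) by (simp add: kappa_eq[of v] qa_simps)
    have cyd: "?c * y * d = d * y"
      using arg_cong[OF dy, of "\<lambda>t. t * d"] d(1) by (simp add: mult.assoc)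
    show ?thesis
    proof (cases e)
      case False
      have "twist e v * c * y * d = v * d * y" using cyd False by (simp add: twist_def mult.assoc)
      then show ?thesis unfolding zu lin.add pu pw using False ud dK[OF v(2)]
        by (simp add: h_def twist_def v(1) distrib_left distrib_right mult.assoc[symmetric])
    next
      case True
      have yy: "y * y = scale (- nrd y) 1" by (simp add: square_eq ty)
      have ku: "\<kappa> u * x = x * \<kappa> u" using u by (simp add: kappa_eq[of u] qa_simps)
      have "c * y * d = - (d * y)" using cyd True by (simp add: equation_minus_iff[of "c * y * d"])
      then have "twist e v * c * y * (d * y) = \<kappa> v * (- (d * y)) * y"
        using True by (simp add: twist_def mult.assoc[symmetric]) (simp add: mult.assoc)
      then have 1: "twist e v * c * y * (d * y) = scale (nrd y) (\<kappa> v * d)"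
        by (simp add: mult.assoc yy qa_simps)
      have 2: "u * (d * y) = d * y * \<kappa> u"
        using ud yK[OF ku] by (metis kappa_kappa mult.assoc)
      have 3: "d * y * \<kappa> (v * y) = scale (nrd y) (\<kappa> v * d)"
      proof -
        have "d * y * \<kappa> (v * y) = - (d * (y * y) * \<kappa> v)" by (simp add: kappa_mult ky mult.assoc)
        then show ?thesis using dK[OF kv] by (simp add: yy qa_simps)
      qed
      show ?thesis unfolding zu lin.add pu pw using True 1 2 3
        by (simp only: h_def twist_def v(1) distrib_left distrib_right kappa_add if_True)
    qed
  qed
  then have "\<psi> z = h * twist e z * ainv h" for z using nh by (metis ainv(1) mult.assoc mult.right_neutral)
  with nh show ?thesis by blast
qed

definition sandwich :: "bool \<Rightarrow> 'a \<Rightarrow> 'a \<Rightarrow> 'a \<Rightarrow> 'a" where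
  "sandwich e a b = (\<lambda>x. a * twist e x * b)"

text \<open>
  Left multiplication by the inverse of \<open>\<phi> 1\<close> gives an isometry fixing \<open>1\<close>. It sends a separable
  generator \<open>x\<close> to an element with the same trace and norm, that is, to a conjugate of \<open>x\<close>, so after a
  conjugation it also fixes \<open>x\<close>.
\<close>

theorem similitude_is_sandwich:
  assumes lin: "Vector_Spaces.linear scale scale \<phi>" and sim: "\<And>z. nrd (\<phi> z) = \<mu> * nrd z" and mu: "\<mu> \<noteq> 0"
  shows "\<exists>e a b. nrd a \<noteq> 0 \<and> nrd b \<noteq> 0 \<and> \<phi> = sandwich e a b"
proof -
  interpret lin: Vector_Spaces.linear scale scale \<phi> by fact
  let ?a = "\<phi> 1"
  have na: "nrd ?a = \<mu>" using sim[of 1] by simp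
  then have a: "nrd ?a \<noteq> 0" using mu by simp
  obtain x where x: "nrd (x - \<kappa> x) \<noteq> 0" using exists_separable by blast
  define p where "p = ainv ?a * \<phi> x"
  have "nrd p = nrd x" using mu by (simp add: p_def nrd_mult nrd_ainv na sim)
  moreover have "trd p = trd x"
  proof -
    have "nrd (ainv ?a * \<phi> (x + 1)) = nrd (x + 1)" using mu by (simp add: nrd_mult nrd_ainv na sim)
    moreover have "ainv ?a * \<phi> (x + 1) = p + 1" using a by (simp add: p_def lin.add distrib_left)
    ultimately show ?thesis using \<open>nrd p = nrd x\<close> by (simp add: nrd_add polar_one_right)
  qed
  ultimately obtain g where g: "nrd g \<noteq> 0" "g * x = p * g" using conjugate_if_same_char_poly[OF x] by blast
  define \<psi> where "\<psi> z = ainv g * (ainv ?a * \<phi> z) * g" for z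
  have "Vector_Spaces.linear scale scale \<psi>"
    unfolding Vector_Spaces.linear_iff \<psi>_def
    by (auto simp: lin.add lin.scale qa_simps vector_space_axioms)
  moreover have "nrd (\<psi> z) = nrd z" for z using g mu by (simp add: \<psi>_def nrd_mult nrd_ainv na sim field_simps)
  moreover have "\<psi> 1 = 1" using a g by (simp add: \<psi>_def)
  moreover have "\<psi> x = x" using g by (simp add: \<psi>_def p_def[symmetric] mult.assoc flip: g(2))
  ultimately obtain e d where d: "nrd d \<noteq> 0" "\<And>z. \<psi> z = d * twist e z * ainv d"
    using isometry_fixing_separable[OF _ _ _ x] by blast
  have "\<phi> z = sandwich e (?a * g * d) (ainv d * ainv g) z" for z
  proof -
    have "\<phi> z = ?a * (g * \<psi> z * ainv g)" using a g by (simp add: \<psi>_def mult.assoc)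
    then show ?thesis by (simp add: d(2) sandwich_def mult.assoc)
  qed
  then have "\<phi> = sandwich e (?a * g * d) (ainv d * ainv g)" by (rule ext)
  moreover have "nrd (?a * g * d) \<noteq> 0" "nrd (ainv d * ainv g) \<noteq> 0"
    using a g d(1) by (simp_all add: nrd_mult nrd_ainv)
  ultimately show ?thesis by blast
qed

end

section \<open>Determinants of similitudes\<close>

lemma det_4:
  "det (A::'a::comm_ring_1^4^4) =
    A$1$1 * (A$2$2 * (A$3$3 * A$4$4 - A$3$4 * A$4$3) - A$2$3 * (A$3$2 * A$4$4 - A$3$4 * A$4$2)
      + A$2$4 * (A$3$2 * A$4$3 - A$3$3 * A$4$2))
    - A$1$2 * (A$2$1 * (A$3$3 * A$4$4 - A$3$4 * A$4$3) - A$2$3 * (A$3$1 * A$4$4 - A$3$4 * A$4$1)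
      + A$2$4 * (A$3$1 * A$4$3 - A$3$3 * A$4$1))
    + A$1$3 * (A$2$1 * (A$3$2 * A$4$4 - A$3$4 * A$4$2) - A$2$2 * (A$3$1 * A$4$4 - A$3$4 * A$4$1)
      + A$2$4 * (A$3$1 * A$4$2 - A$3$2 * A$4$1))
    - A$1$4 * (A$2$1 * (A$3$2 * A$4$3 - A$3$3 * A$4$2) - A$2$2 * (A$3$1 * A$4$3 - A$3$3 * A$4$1)
      + A$2$3 * (A$3$1 * A$4$2 - A$3$2 * A$4$1))"
proof -
  have f: "finite {2::4, 3, 4}" "1 \<notin> {2::4, 3, 4}" by auto
  have g: "finite {3::4, 4}" "2 \<notin> {3::4, 4}" by auto
  have h: "finite {4::4}" "3 \<notin> {4::4}" by auto
  show ?thesis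
    unfolding det_def UNIV_4
    unfolding sum_over_permutations_insert[OF f]
    unfolding sum_over_permutations_insert[OF g]
    unfolding sum_over_permutations_insert[OF h]
    unfolding permutes_sing
    by (simp add: sign_swap_id permutation_swap_id permutation_compose sign_compose sign_id
        swap_id_eq algebra_simps)
qed

context quaternion_algebra
begin

text \<open>
  Using two frames makes changes of frame an instance of composition, as matrices of the identity.
\<close>

definition matrix_between :: "(4 \<Rightarrow> 'a) \<Rightarrow> (4 \<Rightarrow> 'a) \<Rightarrow> ('a \<Rightarrow> 'a) \<Rightarrow> 'k^4^4" where
  "matrix_between e e' \<phi> = (\<chi> i j. representation (range e') (\<phi> (e j)) (e' i))"

lemma frame_expansion:
  assumes "frame e" shows "(\<Sum>i\<in>UNIV. scale (representation (range e) z (e i)) (e i)) = z"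
proof -
  have e: "inj e" "independent (range e)" "z \<in> span (range e)" using assms by (auto simp: frame_def)
  have "(\<Sum>b\<in>range e. scale (representation (range e) z b) b) = z"
    by (rule sum_representation_eq) (use e in auto)
  then show ?thesis by (simp add: sum.reindex[OF e(1)])
qed

lemma representation_frame:
  assumes "frame e" shows "representation (range e) (e j) (e i) = (if i = j then 1 else 0)"
  using assms by (auto simp: frame_def representation_basis inj_eq)

lemma linear_coordinate:
  assumes "frame e" shows "Vector_Spaces.linear scale (*) (\<lambda>z. representation (range e) z (e i))"
  using assms by (auto simp: Vector_Spaces.linear_iff frame_def representation_add representation_scale
     vector_space_axioms vector_space_over_itself.vector_space_axioms)

lemma matrix_between_comp:
  assumes e: "frame e'" and \<phi>: "Vector_Spaces.linear scale scale \<phi>" and e'': "frame e''"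
  shows "matrix_between e e'' (\<phi> \<circ> \<psi>) = matrix_between e' e'' \<phi> ** matrix_between e e' \<psi>"
proof -
  interpret Vector_Spaces.linear scale scale \<phi> by fact
  have coord: "representation (range e'') (\<phi> z) (e'' i)
    = (\<Sum>k\<in>UNIV. representation (range e'') (\<phi> (e' k)) (e'' i) * representation (range e') z (e' k))" for z i
  proof -
    interpret c: Vector_Spaces.linear scale "(*)" "\<lambda>z. representation (range e'') z (e'' i)"
      by (rule linear_coordinate[OF e''])
    have "\<phi> z = (\<Sum>k\<in>UNIV. scale (representation (range e') z (e' k)) (\<phi> (e' k)))"
      using arg_cong[OF frame_expansion[OF e, of z], of \<phi>] by (simp add: sum scale)
    then show ?thesis by (simp add: c.sum c.scale mult.commute)
  qed
  show ?thesis unfolding matrix_between_def matrix_matrix_mult_def vec_eq_iff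
    by (auto intro: coord)
qed

lemma matrix_between_id: "frame e \<Longrightarrow> matrix_between e e id = mat 1"
  by (simp add: matrix_between_def representation_frame mat_def vec_eq_iff)

lemma matrix_in_eq: "matrix_in e \<phi> = matrix_between e e \<phi>"
  by (simp add: matrix_in_def matrix_between_def)

lemma matrix_in_change:
  assumes e: "frame e" and e': "frame e'" and \<phi>: "Vector_Spaces.linear scale scale \<phi>"
  obtains P Q where "matrix_in e' \<phi> = P ** matrix_in e \<phi> ** Q" "Q ** P = mat 1"
proof
  have id: "Vector_Spaces.linear scale scale id" using vector_space_axioms by (simp add: Vector_Spaces.linear_iff)
  show "matrix_in e' \<phi> = matrix_between e e' id ** matrix_in e \<phi> ** matrix_between e' e id"
    unfolding matrix_in_eq
    using matrix_between_comp[OF e \<phi> e', of e' id] matrix_between_comp[OF e id e', of e \<phi>]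
    by simp
  show "matrix_between e' e id ** matrix_between e e' id = mat 1"
    using matrix_between_comp[OF e' id e, of e id] matrix_between_id[OF e] by simp
qed

lemma frame_some: "frame e \<Longrightarrow> frame (SOME e. frame e)"
  by (rule someI[of frame])

lemma det_endo_eq:
  assumes "frame e" "Vector_Spaces.linear scale scale \<phi>"
  shows "det_endo \<phi> = det (matrix_in e \<phi>)"
proof -
  obtain P Q where "matrix_in (SOME e. frame e) \<phi> = P ** matrix_in e \<phi> ** Q" and QP: "Q ** P = mat 1"
    using matrix_in_change assms frame_some by blast
  then have "det_endo \<phi> = (det Q * det P) * det (matrix_in e \<phi>)"
    by (simp add: det_endo_def det_mul)
  also have "det Q * det P = 1" using QP det_mul[of Q P] by simp
  finally show ?thesis by simp
qed

lemma trace_endo_eq: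
  assumes "frame e" "Vector_Spaces.linear scale scale \<phi>"
  shows "trace_endo \<phi> = trace (matrix_in e \<phi>)"
proof -
  obtain P Q where PQ: "matrix_in (SOME e. frame e) \<phi> = P ** matrix_in e \<phi> ** Q" "Q ** P = mat 1"
    using matrix_in_change assms frame_some by blast
  have "trace_endo \<phi> = trace (Q ** (P ** matrix_in e \<phi>))"
    unfolding trace_endo_def PQ(1) by (rule trace_mul_sym)
  also have "\<dots> = trace (matrix_in e \<phi>)" by (simp add: matrix_mul_assoc PQ(2))
  finally show ?thesis .
qed

lemma det_endo_comp:
  assumes "frame e" "Vector_Spaces.linear scale scale \<phi>"
  shows "det_endo (\<phi> \<circ> \<psi>) = det_endo \<phi> * det_endo \<psi>"
  unfolding det_endo_def matrix_in_eq
  by (simp add: matrix_between_comp[OF frame_some[OF assms(1)] assms(2) frame_some[OF assms(1)]] det_mul)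

lemma trace_endo_comp_commute:
  assumes "frame e" "Vector_Spaces.linear scale scale \<phi>" "Vector_Spaces.linear scale scale \<psi>"
  shows "trace_endo (\<phi> \<circ> \<psi>) = trace_endo (\<psi> \<circ> \<phi>)"
  unfolding trace_endo_def matrix_in_eq
  by (simp only: matrix_between_comp[OF frame_some[OF assms(1)] _ frame_some[OF assms(1)]] assms)
    (rule trace_mul_sym)

definition quaternion_frame :: "'a \<Rightarrow> 'a \<Rightarrow> 4 \<Rightarrow> 'a" where
  "quaternion_frame x y i = (if i = 1 then 1 else if i = 2 then x else if i = 3 then y else x * y)"

lemma quaternion_frame_simps [simp]:
  "quaternion_frame x y 1 = 1" "quaternion_frame x y 2 = x"
  "quaternion_frame x y 3 = y" "quaternion_frame x y 4 = x * y"
  by (simp_all add: quaternion_frame_def)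

lemma quaternion_expansion:
  assumes x: "nrd (x - \<kappa> x) \<noteq> 0" and y: "nrd y \<noteq> 0" "x * y = y * \<kappa> x"
  obtains a b c d where "z = scale a 1 + scale b x + scale c y + scale d (x * y)"
proof -
  note ns = separable_not_scalar[OF x]
  obtain u w where z: "z = u + w" and u: "u * x = x * u" and w: "x * w = w * \<kappa> x"
    using commutant_splitting[OF x] by blast
  have "trd y = 0" using y anticommutant_iff[OF x] by blast
  then have iy: "ainv y = - scale (inverse (nrd y)) y" by (simp add: ainv_def kappa_eq)
  have "y * x = \<kappa> x * y" using y(2) by (simp add: kappa_eq qa_simps)
  then have "ainv y * x = \<kappa> x * ainv y" unfolding iy by (simp add: qa_simps)
  then have v: "w * ainv y * x = x * (w * ainv y)" using w by (metis mult.assoc)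
  obtain a b where ab: "u = scale a 1 + scale b x" using commutant[OF ns u] .
  obtain c d where cd: "w * ainv y = scale c 1 + scale d x" using commutant[OF ns v] .
  have "w = w * ainv y * y" using y by (simp add: mult.assoc)
  then have "w = scale c y + scale d (x * y)" unfolding cd by (simp add: qa_simps)
  then show thesis using that[of a b c d] z ab by (simp add: add.assoc)
qed

lemma frame_quaternion_frame:
  assumes "nrd (x - \<kappa> x) \<noteq> 0" "nrd y \<noteq> 0" "x * y = y * \<kappa> x"
  shows "frame (quaternion_frame x y)"
proof -
  let ?e = "quaternion_frame x y"
  have "z \<in> span (range ?e)" for z
  proof -
    obtain a b c d where "z = scale a 1 + scale b x + scale c y + scale d (x * y)"
      using quaternion_expansion[OF assms] .
    then have z: "z = scale a (?e 1) + scale b (?e 2) + scale c (?e 3) + scale d (?e 4)" by simp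
    show ?thesis unfolding z by (intro span_add span_scale span_base rangeI)
  qed
  then have s: "span (range ?e) = UNIV" by auto
  then have "4 \<le> card (range ?e)" by (rule spanning_card) simp
  moreover have "card (range ?e) \<le> 4" using card_image_le[of "UNIV::4 set" ?e] by simp
  ultimately have c: "card (range ?e) = 4" by simp
  then have "inj ?e" by (intro eq_card_imp_inj_on) auto
  moreover have "independent (range ?e)"
  proof -
    obtain B where "finite_dimensional_vector_space scale B" using finite_basis by auto
    then interpret F: finite_dimensional_vector_space scale B .
    show ?thesis by (rule F.card_le_dim_spanning[of _ UNIV]) (use s c dim_4 in auto)
  qed
  ultimately show ?thesis using s by (simp add: frame_def)
qed

lemma representation_quaternion_frame:
  assumes "frame (quaternion_frame x y)"
  shows "representation (range (quaternion_frame x y)) (scale a 1 + scale b x + scale c y + scale d (x * y))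
      (quaternion_frame x y i) = (if i = 1 then a else if i = 2 then b else if i = 3 then c else d)"
proof -
  let ?e = "quaternion_frame x y"
  interpret l: Vector_Spaces.linear scale "(*)" "\<lambda>z. representation (range ?e) z (?e i)"
    by (rule linear_coordinate[OF assms])
  have "scale a 1 + scale b x + scale c y + scale d (x * y)
     = scale a (?e 1) + scale b (?e 2) + scale c (?e 3) + scale d (?e 4)" by simp
  moreover have "i = 1 \<or> i = 2 \<or> i = 3 \<or> i = 4" by (rule exhaust_4)
  ultimately show ?thesis
    by (auto simp only: l.add l.scale representation_frame[OF assms]) auto
qed

lemma coordinates_quaternion_frame:
  assumes "frame (quaternion_frame x y)"
  defines "z a b c d \<equiv> scale a 1 + scale b x + scale c y + scale d (x * y)"
  shows "representation (range (quaternion_frame x y)) (z a b c d) 1 = a"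
    "representation (range (quaternion_frame x y)) (z a b c d) x = b"
    "representation (range (quaternion_frame x y)) (z a b c d) y = c"
    "representation (range (quaternion_frame x y)) (z a b c d) (x * y) = d"
  using representation_quaternion_frame[OF assms(1), of a b c d 1]
    representation_quaternion_frame[OF assms(1), of a b c d 2]
    representation_quaternion_frame[OF assms(1), of a b c d 3]
    representation_quaternion_frame[OF assms(1), of a b c d 4]
  unfolding z_def by simp_all

lemma linear_L: "Vector_Spaces.linear scale scale (L a)"
  and linear_R: "Vector_Spaces.linear scale scale (R a)"
  and linear_kappa: "Vector_Spaces.linear scale scale \<kappa>"
  and linear_twist: "Vector_Spaces.linear scale scale (twist e)"
  by (auto simp: Vector_Spaces.linear_iff vector_space_axioms L_def R_def twist_def kappa_add kappa_scale qa_simps)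

lemma linear_sandwich: "Vector_Spaces.linear scale scale (sandwich e a b)"
  by (auto simp: Vector_Spaces.linear_iff vector_space_axioms sandwich_def twist_def kappa_add kappa_scale qa_simps)

lemma sandwich_eq_comp: "sandwich e a b = L a \<circ> (R b \<circ> twist e)"
  by (auto simp: sandwich_def L_def R_def mult.assoc)

lemma nrd_sandwich: "nrd (sandwich e a b z) = nrd a * nrd b * nrd z"
  by (simp add: sandwich_def twist_def nrd_mult mult_ac)

lemma multiplier_sandwich:
  assumes "nrd a \<noteq> 0" "nrd b \<noteq> 0" shows "multiplier (sandwich e a b) = nrd a * nrd b"
  unfolding multiplier_def nrd_sandwich
proof (rule the_equality)
  fix \<mu> assume "\<mu> \<noteq> 0 \<and> (\<forall>x. nrd a * nrd b * nrd x = \<mu> * nrd x)"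
  then have "nrd a * nrd b * nrd 1 = \<mu> * nrd 1" by blast
  then show "\<mu> = nrd a * nrd b" by simp
qed (use assms in auto)

context
  assumes char_not_2: "(2::'k) \<noteq> 0"
begin

lemma exists_orthogonal_frame:
  "\<exists>x y. trd x = 0 \<and> trd y = 0 \<and> x * y = - (y * x) \<and> frame (quaternion_frame x y)"
proof -
  obtain x' where x': "nrd (x' - \<kappa> x') \<noteq> 0" using exists_separable by blast
  let ?x = "x' - \<kappa> x'"
  have t: "trd ?x = 0" by (simp add: trd_diff)
  have k: "\<kappa> ?x = - ?x" by (simp add: kappa_diff)
  have "nrd (?x - \<kappa> ?x) = 4 * nrd ?x" by (simp only: nrd_diff_kappa t) simp
  moreover have "(4::'k) \<noteq> 0" using char_not_2 mult_eq_0_iff[of "2::'k" 2] by simp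
  ultimately have x: "nrd (?x - \<kappa> ?x) \<noteq> 0" using x' by simp
  obtain y where y: "nrd y \<noteq> 0" "?x * y = y * \<kappa> ?x" using exists_anticommuting_unit[OF x] by blast
  have "trd y = 0" using y anticommutant_iff[OF x] by blast
  then show ?thesis using frame_quaternion_frame[OF x y] t y(2) k by (metis mult_minus_right)
qed

text \<open>
  The multiplier only determines the square of the determinant, so the sign has to be read off a
  matrix. In characteristic different from two there is a frame \<open>1, x, y, x y\<close> with \<open>x\<^sup>2\<close> and \<open>y\<^sup>2\<close>
  scalar and \<open>y x = - x y\<close>, which keeps this matrix simple.
\<close>

lemma det_L: "det_endo (L a) = nrd a * nrd a"
proof -
  obtain x y where xy: "trd x = 0" "trd y = 0" "x * y = - (y * x)" and frame_xy: "frame (quaternion_frame x y)"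
    using exists_orthogonal_frame by blast
  let ?e = "quaternion_frame x y"
  define m n where "m = nrd x" and "n = nrd y"
  have yx: "y * x = - (x * y)" using xy by simp
  have xx: "x * x = - scale m 1" "x * (x * z) = - scale m z" for z
    using xy by (simp_all add: square_eq square_mult m_def)
  have yy: "y * y = - scale n 1" "y * (y * z) = - scale n z" for z
    using xy by (simp_all add: square_eq square_mult n_def)
  have yxz: "y * (x * z) = - (x * (y * z))" for z using yx by (metis mult.assoc mult_minus_left)
  obtain a0 a1 a2 a3 where a: "a = scale a0 1 + scale a1 x + scale a2 y + scale a3 (x * y)"
  proof -
    have "a = (\<Sum>i\<in>UNIV. scale (representation (range ?e) a (?e i)) (?e i))"
      by (rule frame_expansion[OF frame_xy, symmetric])
    then show thesis by (intro that) (simp only: sum_4 quaternion_frame_simps)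
  qed
  have kx: "\<kappa> x = - x" "\<kappa> y = - y" using xy by (simp_all add: kappa_eq)
  have na: "nrd a = a0 * a0 + m * a1 * a1 + n * a2 * a2 + m * n * a3 * a3"
    by (rule nrd_eqI)
      (simp add: a kappa_add kappa_scale kappa_mult kx qa_simps xx yy yx yxz algebra_simps)
  have 1: "L a 1 = scale a0 1 + scale a1 x + scale a2 y + scale a3 (x * y)"
    by (simp add: L_def a)
  have 2: "L a x = scale (- m * a1) 1 + scale a0 x + scale (m * a3) y + scale (- a2) (x * y)"
    by (simp add: L_def a qa_simps xx yy yx yxz algebra_simps)
  have 3: "L a y = scale (- n * a2) 1 + scale (- n * a3) x + scale a0 y + scale a1 (x * y)"
    by (simp add: L_def a qa_simps xx yy yx yxz algebra_simps)
  have 4: "L a (x * y) = scale (- m * n * a3) 1 + scale (n * a2) x + scale (- m * a1) y + scale a0 (x * y)"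
    by (simp add: L_def a qa_simps xx yy yx yxz algebra_simps)
  show ?thesis
    unfolding det_endo_eq[OF frame_xy linear_L] det_4
    by (simp only: matrix_in_def vec_lambda_beta quaternion_frame_simps(1-4)[of x y] 1 2 3 4
       coordinates_quaternion_frame[OF frame_xy] na)
      (simp add: algebra_simps)
qed

lemma det_kappa: "det_endo \<kappa> = - 1"
proof -
  obtain x y where xy: "trd x = 0" "trd y = 0" "x * y = - (y * x)" and frame_xy: "frame (quaternion_frame x y)"
    using exists_orthogonal_frame by blast
  let ?e = "quaternion_frame x y"
  have kx: "\<kappa> x = - x" "\<kappa> y = - y" using xy by (simp_all add: kappa_eq)
  have 1: "\<kappa> 1 = scale 1 1 + scale 0 x + scale 0 y + scale 0 (x * y)" by simp
  have 2: "\<kappa> x = scale 0 1 + scale (-1) x + scale 0 y + scale 0 (x * y)" by (simp add: kx)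
  have 3: "\<kappa> y = scale 0 1 + scale 0 x + scale (-1) y + scale 0 (x * y)" by (simp add: kx)
  have 4: "\<kappa> (x * y) = scale 0 1 + scale 0 x + scale 0 y + scale (-1) (x * y)"
    by (simp only: kappa_mult kx) (simp add: xy(3))
  show ?thesis
    unfolding det_endo_eq[OF frame_xy linear_kappa] det_4
    by (simp only: matrix_in_def vec_lambda_beta quaternion_frame_simps(1-4)[of x y] 1 2 3 4
       coordinates_quaternion_frame[OF frame_xy]) simp
qed

text \<open>
  Right multiplication by \<open>b\<close> is the conjugate by \<open>\<kappa>\<close> of left multiplication by \<open>\<kappa> b\<close>.
\<close>

lemma proper_sandwich_char_not_2:
  assumes "nrd a \<noteq> 0" "nrd b \<noteq> 0"
  shows "det_endo (sandwich e a b) = (multiplier (sandwich e a b))\<^sup>2 \<longleftrightarrow> \<not> e"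
proof -
  obtain f where frame_xy: "frame f" using exists_orthogonal_frame by blast
  have "R b = \<kappa> \<circ> (L (\<kappa> b) \<circ> \<kappa>)" by (auto simp: R_def L_def kappa_mult)
  then have R: "det_endo (R b) = nrd b * nrd b"
    by (simp add: det_endo_comp[OF frame_xy linear_kappa] det_endo_comp[OF frame_xy linear_L] det_L det_kappa)
  have "twist True = \<kappa>" "twist False = id" by (auto simp: twist_def)
  moreover have "det_endo id = 1"
    unfolding det_endo_def matrix_in_eq matrix_between_id[OF frame_some[OF frame_xy]] by simp
  ultimately have T: "det_endo (twist e) = (if e then - 1 else 1)"
    by (cases e) (auto simp: det_kappa)
  have "det_endo (sandwich e a b) = (nrd a * nrd b)\<^sup>2 * (if e then - 1 else 1)"
    unfolding sandwich_eq_comp det_endo_comp[OF frame_xy linear_L] det_endo_comp[OF frame_xy linear_R] T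
    by (simp add: R det_L power2_eq_square)
  then show ?thesis using assms char_not_2[symmetric] by (simp add: multiplier_sandwich)
qed

end

section \<open>The Dickson invariant of similitudes\<close>

definition bilinear_form :: "('a \<Rightarrow> 'a \<Rightarrow> 'k) \<Rightarrow> bool" where
  "bilinear_form \<beta> \<longleftrightarrow> (\<forall>x. Vector_Spaces.linear scale (*) (\<beta> x)) \<and>
    (\<forall>y. Vector_Spaces.linear scale (*) (\<lambda>x. \<beta> x y))"

lemma bilinear_form_iff: "bilinear_form \<beta> \<longleftrightarrow>
    (\<forall>x y z. \<beta> (x + y) z = \<beta> x z + \<beta> y z) \<and> (\<forall>c x z. \<beta> (scale c x) z = c * \<beta> x z) \<and>
    (\<forall>x y z. \<beta> z (x + y) = \<beta> z x + \<beta> z y) \<and> (\<forall>c x z. \<beta> z (scale c x) = c * \<beta> z x)"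
  unfolding bilinear_form_def Vector_Spaces.linear_iff
  using vector_space_axioms vector_space_over_itself.vector_space_axioms by blast

text \<open>
  The bilinear form \<open>m\<close> occurring in the definition of the Dickson invariant: a bilinear form, usually
  not symmetric, whose diagonal is the norm.
\<close>

definition refines_nrd :: "('a \<Rightarrow> 'a \<Rightarrow> 'k) \<Rightarrow> bool" where
  "refines_nrd m \<longleftrightarrow> bilinear_form m \<and> (\<forall>x. m x x = nrd x)"

text \<open>
  The Dickson invariant of a similitude \<open>\<phi>\<close> with multiplier \<open>\<mu>\<close> is obtained by writing this alternating
  form as \<open>polar u (\<rho> v) + polar v (\<rho> u)\<close>; it is the trace of \<open>\<rho>\<close> divided by \<open>\<mu>\<close>.
\<close>

definition defect :: "('a \<Rightarrow> 'a \<Rightarrow> 'k) \<Rightarrow> ('a \<Rightarrow> 'a) \<Rightarrow> 'k \<Rightarrow> 'a \<Rightarrow> 'a \<Rightarrow> 'k" where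
  "defect m \<phi> \<mu> u v = m (\<phi> u) (\<phi> v) - \<mu> * m u v"

definition similitude :: "('a \<Rightarrow> 'a) \<Rightarrow> 'k \<Rightarrow> bool" where
  "similitude \<phi> \<mu> \<longleftrightarrow> \<mu> \<noteq> 0 \<and> (\<forall>z. nrd (\<phi> z) = \<mu> * nrd z) \<and> Vector_Spaces.linear scale scale \<phi> \<and>
    (\<exists>\<phi>'. Vector_Spaces.linear scale scale \<phi>' \<and> \<phi> \<circ> \<phi>' = id)"

lemma similitude_L: "nrd a \<noteq> 0 \<Longrightarrow> similitude (L a) (nrd a)"
  and similitude_R: "nrd a \<noteq> 0 \<Longrightarrow> similitude (R a) (nrd a)"
  and similitude_twist: "similitude (twist e) 1"
proof -
  have "L a \<circ> L (ainv a) = id" "R a \<circ> R (ainv a) = id" if "nrd a \<noteq> 0"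
    using that by (auto simp: L_def R_def mult.assoc)
  then show "nrd a \<noteq> 0 \<Longrightarrow> similitude (L a) (nrd a)" "nrd a \<noteq> 0 \<Longrightarrow> similitude (R a) (nrd a)"
    unfolding similitude_def using linear_L linear_R by (auto simp: L_def R_def nrd_mult)
  have "twist e \<circ> twist e = id" by (auto simp: twist_def)
  then show "similitude (twist e) 1"
    unfolding similitude_def using linear_twist by (auto simp: twist_def)
qed

lemma similitude_comp:
  assumes "similitude \<phi> \<mu>" "similitude \<psi> \<nu>" shows "similitude (\<phi> \<circ> \<psi>) (\<mu> * \<nu>)"
proof -
  obtain \<phi>' \<psi>' where inv: "\<phi> \<circ> \<phi>' = id" "\<psi> \<circ> \<psi>' = id"
    and lin: "Vector_Spaces.linear scale scale \<phi>'" "Vector_Spaces.linear scale scale \<psi>'"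
    using assms by (auto simp: similitude_def)
  have "(\<phi> \<circ> \<psi>) \<circ> (\<psi>' \<circ> \<phi>') = \<phi> \<circ> (\<psi> \<circ> \<psi>') \<circ> \<phi>'" by (simp add: comp_assoc)
  also have "\<dots> = id" by (simp add: inv)
  finally show ?thesis using assms Vector_Spaces.linear_compose[OF lin(1,2)]
    unfolding similitude_def by (auto simp: mult.assoc intro: Vector_Spaces.linear_compose)
qed

lemma polar_similitude: "similitude \<phi> \<mu> \<Longrightarrow> polar (\<phi> u) (\<phi> v) = \<mu> * polar u v"
  by (auto simp: similitude_def polar_def right_diff_distrib Vector_Spaces.linear_iff) metis

lemma refines_nrd_pullback:
  assumes "refines_nrd m" "similitude \<phi> \<mu>"
  shows "refines_nrd (\<lambda>u v. m (\<phi> u) (\<phi> v) / \<mu>)"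
  using assms unfolding refines_nrd_def similitude_def bilinear_form_iff Vector_Spaces.linear_iff
  by (simp add: add_divide_distrib)

lemma separable_char_2:
  assumes two: "(2::'k) = 0" and x: "trd x = 1"
  shows "nrd (x - \<kappa> x) \<noteq> 0"
proof -
  have "(4::'k) = 2 * 2" by simp
  then have "(4::'k) = 0" by (simp only: two mult_zero_left)
  then show ?thesis by (simp add: nrd_diff_kappa x)
qed

text \<open>
  In characteristic two, such \<open>x\<close> and \<open>y\<close> make \<open>1, x, y, x y\<close> a symplectic frame for the polar form, up to
  the factor \<open>nrd y\<close>: the hyperbolic pairs are \<open>(1, x)\<close> and \<open>(y, x y)\<close>.
\<close>

context
  fixes x y :: 'a
  assumes char_2: "(2::'k) = 0" and x: "trd x = 1" and y: "nrd y \<noteq> 0" "x * y = y * \<kappa> x"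
begin

lemma minus_char_2: "- r = (r::'k)"
  using char_2 by (metis add_eq_0_iff mult_2 mult_zero_left)

lemmas separable_x = separable_char_2[OF char_2 x]

lemma frame_xy: "frame (quaternion_frame x y)"
  by (rule frame_quaternion_frame[OF separable_x y])

lemma double_zero: "r + r = (0::'k)"
  using char_2 by (metis mult_2 mult_zero_left)

lemma polar_table:
  "polar 1 1 = 0" "polar x 1 = 1" "polar y 1 = 0" "polar (x * y) 1 = 0"
  "polar 1 x = 1" "polar x x = 0" "polar y x = 0" "polar (x * y) x = 0"
  "polar 1 y = 0" "polar x y = 0" "polar y y = 0" "polar (x * y) y = nrd y"
  "polar 1 (x * y) = 0" "polar x (x * y) = 0" "polar y (x * y) = nrd y" "polar (x * y) (x * y) = 0"
proof -
  have "x * (x * y) = x * y * \<kappa> x" using y(2) by (metis mult.assoc)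
  then have *: "polar (x * y) 1 = 0" "polar (x * y) x = 0" "polar y 1 = 0" "polar y x = 0"
    using y(2) anticommutant_iff[OF separable_x] unfolding polar_one_right by blast+
  then show "polar (x * y) 1 = 0" "polar (x * y) x = 0" "polar y 1 = 0" "polar y x = 0"
    "polar 1 (x * y) = 0" "polar x (x * y) = 0" "polar 1 y = 0" "polar x y = 0"
    by (simp_all only: polar_commute[of _ "x * y"] polar_commute[of _ y])
  show "polar (x * y) y = nrd y"
    by (simp add: polar_mult_right mult_kappa polar_simps polar_one_right x)
  then show "polar y (x * y) = nrd y" by (simp add: polar_commute)
  show "polar x 1 = 1" by (simp add: polar_one_right x)
  then show "polar 1 x = 1" by (simp add: polar_commute)
qed (simp_all add: polar_self double_zero)

lemma symplectic_expansion:
  "z = scale (polar z x) 1 + scale (polar z 1) x + scale (polar z (x * y) / nrd y) y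
     + scale (polar z y / nrd y) (x * y)"
proof -
  obtain a b c d where z: "z = scale a 1 + scale b x + scale c y + scale d (x * y)"
    using quaternion_expansion[OF separable_x y] .
  have "polar z x = a" "polar z 1 = b" "polar z (x * y) = c * nrd y" "polar z y = d * nrd y"
    unfolding z by (simp_all add: polar_simps polar_table)
  then show ?thesis using z y by simp
qed

lemma trace_symplectic:
  assumes "Vector_Spaces.linear scale scale \<rho>"
  shows "trace_endo \<rho> = polar (\<rho> 1) x + polar (\<rho> x) 1 + (polar (\<rho> y) (x * y) + polar (\<rho> (x * y)) y) / nrd y"
proof -
  have c: "representation (range (quaternion_frame x y)) z 1 = polar z x"
    "representation (range (quaternion_frame x y)) z x = polar z 1"
    "representation (range (quaternion_frame x y)) z y = polar z (x * y) / nrd y"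
    "representation (range (quaternion_frame x y)) z (x * y) = polar z y / nrd y" for z
    using coordinates_quaternion_frame[OF frame_xy, of "polar z x" "polar z 1" "polar z (x * y) / nrd y" "polar z y / nrd y"]
    unfolding symplectic_expansion[of z, symmetric] by blast+
  show ?thesis
    unfolding trace_endo_eq[OF frame_xy assms] trace_def sum_4 matrix_in_def
    by (simp add: c add_divide_distrib)
qed

text \<open>
  The trace of \<open>\<rho>\<close>, computed in the symplectic frame \<open>1, x, y, x y\<close>, groups into the values that the form
  \<open>polar u (\<rho> v) + polar v (\<rho> u)\<close> takes at the two hyperbolic pairs, the second one divided by
  \<open>nrd y\<close>. So it depends on this form only.
\<close>

definition half_trace :: "('a \<Rightarrow> 'a \<Rightarrow> 'k) \<Rightarrow> 'k" where
  "half_trace \<beta> = \<beta> 1 x + \<beta> y (x * y) / nrd y"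

lemma half_trace_eq_trace:
  assumes "Vector_Spaces.linear scale scale \<rho>"
    and "\<And>u v. \<beta> u v = polar u (\<rho> v) + polar v (\<rho> u)"
  shows "half_trace \<beta> = trace_endo \<rho>"
  unfolding half_trace_def assms(2) trace_symplectic[OF assms(1)]
  by (simp add: polar_commute[of _ "\<rho> _"] add_divide_distrib add_ac)

text \<open>
  The form \<open>polar u (\<rho> v)\<close> is the part of \<open>\<beta>\<close> strictly above the diagonal in the frame
  \<open>1, x, y, x y\<close>. In characteristic two an alternating form is symmetric, so \<open>\<beta>\<close> is the sum of this
  part and its transpose.
\<close>

lemma alternating_form_splits:
  assumes b: "bilinear_form \<beta>" and alt: "\<And>u. \<beta> u u = 0"
  shows "\<exists>\<rho>. Vector_Spaces.linear scale scale \<rho> \<and> (\<forall>u v. \<beta> u v = polar u (\<rho> v) + polar v (\<rho> u))"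
proof -
  note B = b[unfolded bilinear_form_iff, THEN conjunct1, rule_format]
    b[unfolded bilinear_form_iff, THEN conjunct2, THEN conjunct1, rule_format]
    b[unfolded bilinear_form_iff, THEN conjunct2, THEN conjunct2, THEN conjunct1, rule_format]
    b[unfolded bilinear_form_iff, THEN conjunct2, THEN conjunct2, THEN conjunct2, rule_format]
  have sym: "\<beta> u v = \<beta> v u" for u v
  proof -
    have "\<beta> (u + v) (u + v) = \<beta> u v + \<beta> v u" by (simp only: B) (simp add: alt)
    then have "\<beta> u v + \<beta> v u = 0" by (metis alt)
    then have "\<beta> u v = - \<beta> v u" by (simp add: eq_neg_iff_add_eq_0)
    then show ?thesis by (simp only: minus_char_2)
  qed
  define c1 c2 c3 c4 where "c1 z = polar z x" and "c2 z = polar z 1"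
    and "c3 z = polar z (x * y) / nrd y" and "c4 z = polar z y / nrd y" for z
  note c_defs = c1_def c2_def c3_def c4_def
  define \<rho> where "\<rho> v = scale (c3 v * \<beta> x y + c4 v * \<beta> x (x * y)) 1
    + scale (c2 v * \<beta> 1 x + c3 v * \<beta> 1 y + c4 v * \<beta> 1 (x * y)) x
    + scale (c4 v * \<beta> y (x * y) / nrd y) (x * y)" for v
  have "Vector_Spaces.linear scale scale \<rho>"
    unfolding \<rho>_def c_defs Vector_Spaces.linear_iff
    by (auto simp: vector_space_axioms polar_simps qa_simps add_divide_distrib algebra_simps)
  moreover have "\<beta> u v = polar u (\<rho> v) + polar v (\<rho> u)" for u v
  proof -
    have exp: "z = scale (c1 z) 1 + scale (c2 z) x + scale (c3 z) y + scale (c4 z) (x * y)" for z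
      unfolding c_defs by (rule symplectic_expansion)
    have "\<beta> u v = \<beta> (scale (c1 u) 1 + scale (c2 u) x + scale (c3 u) y + scale (c4 u) (x * y))
      (scale (c1 v) 1 + scale (c2 v) x + scale (c3 v) y + scale (c4 v) (x * y))"
      using exp[of u] exp[of v] by simp
    also have "\<dots> = (c1 u * c2 v + c2 u * c1 v) * \<beta> 1 x + (c1 u * c3 v + c3 u * c1 v) * \<beta> 1 y
      + (c1 u * c4 v + c4 u * c1 v) * \<beta> 1 (x * y) + (c2 u * c3 v + c3 u * c2 v) * \<beta> x y
      + (c2 u * c4 v + c4 u * c2 v) * \<beta> x (x * y) + (c3 u * c4 v + c4 u * c3 v) * \<beta> y (x * y)"
      by (simp only: B alt sym[of x 1] sym[of y 1] sym[of y x] sym[of "x * y" 1] sym[of "x * y" x] sym[of "x * y" y])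
        (simp add: algebra_simps)
    also have "\<dots> = polar u (\<rho> v) + polar v (\<rho> u)"
    proof -
      have "polar z (x * y) = c3 z * nrd y" for z using y by (simp add: c3_def)
      then show ?thesis using y unfolding \<rho>_def polar_add_right polar_scale_right
        c1_def[symmetric] c2_def[symmetric]
        by (simp add: algebra_simps)
    qed
    finally show ?thesis .
  qed
  ultimately show ?thesis by blast
qed

text \<open>
  If \<open>\<rho>\<close> belongs to \<open>\<beta>\<close>, then \<open>\<mu> \<phi>\<^sup>-\<^sup>1 \<rho> \<phi>\<close> belongs to the pullback of \<open>\<beta>\<close>, and traces are invariant under
  conjugation.
\<close>

lemma half_trace_pullback:
  assumes b: "bilinear_form \<beta>" and alt: "\<And>u. \<beta> u u = 0" and \<phi>: "similitude \<phi> \<mu>"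
  shows "half_trace (\<lambda>u v. \<beta> (\<phi> u) (\<phi> v)) = \<mu> * half_trace \<beta>"
proof -
  obtain \<rho> where \<rho>: "Vector_Spaces.linear scale scale \<rho>" "\<And>u v. \<beta> u v = polar u (\<rho> v) + polar v (\<rho> u)"
    using alternating_form_splits[OF b alt] by blast
  obtain \<phi>' where \<phi>': "Vector_Spaces.linear scale scale \<phi>'" "\<phi> \<circ> \<phi>' = id"
    and lin: "Vector_Spaces.linear scale scale \<phi>" and mu: "\<mu> \<noteq> 0" using \<phi> by (auto simp: similitude_def)
  have lin2: "Vector_Spaces.linear scale scale (\<rho> \<circ> \<phi>)" "Vector_Spaces.linear scale scale (\<phi>' \<circ> (\<rho> \<circ> \<phi>))"
    using \<rho>(1) \<phi>'(1) lin by (simp_all add: Vector_Spaces.linear_iff)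
  have "\<phi> ((\<phi>' \<circ> (\<rho> \<circ> \<phi>)) z) = \<rho> (\<phi> z)" for z using \<phi>'(2) by (simp add: fun_eq_iff)
  then have "polar (\<phi> u) (\<rho> (\<phi> v)) = \<mu> * polar u ((\<phi>' \<circ> (\<rho> \<circ> \<phi>)) v)" for u v
    using polar_similitude[OF \<phi>] by metis
  then have "half_trace (\<lambda>u v. \<beta> (\<phi> u) (\<phi> v) / \<mu>) = trace_endo (\<phi>' \<circ> (\<rho> \<circ> \<phi>))"
    using mu by (intro half_trace_eq_trace lin2) (simp add: \<rho>(2) field_simps)
  also have "\<dots> = trace_endo (\<rho> \<circ> \<phi> \<circ> \<phi>')"
    by (rule trace_endo_comp_commute[OF frame_xy \<phi>'(1) lin2(1)])
  also have "\<rho> \<circ> \<phi> \<circ> \<phi>' = \<rho>" using \<phi>'(2) by (simp add: fun_eq_iff)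
  also have "trace_endo \<rho> = half_trace \<beta>" using half_trace_eq_trace[OF \<rho>] by simp
  finally show ?thesis using mu by (simp add: half_trace_def field_simps)
qed

text \<open>
  Two refinements of the norm differ by an alternating form, so \<open>half_trace_pullback\<close> applies to the
  difference of the two defects.
\<close>

lemma half_trace_defect_indep:
  assumes m: "refines_nrd m" "refines_nrd m'" and \<phi>: "similitude \<phi> \<mu>"
  shows "half_trace (defect m \<phi> \<mu>) = half_trace (defect m' \<phi> \<mu>)"
proof -
  let ?\<beta> = "\<lambda>u v. m u v - m' u v"
  have "bilinear_form ?\<beta>" using m unfolding refines_nrd_def bilinear_form_iff
    by (simp add: right_diff_distrib)
  then have "half_trace (\<lambda>u v. ?\<beta> (\<phi> u) (\<phi> v)) = \<mu> * half_trace ?\<beta>"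
    by (rule half_trace_pullback[OF _ _ \<phi>]) (use m in \<open>simp add: refines_nrd_def\<close>)
  then show ?thesis using y by (simp add: half_trace_def defect_def field_simps)
qed

text \<open>
  The pullback of a refinement along \<open>\<phi>\<close>, divided by \<open>\<mu>\<close>, is a refinement as well. By the independence
  of the refinement it may be used to compute the defect of \<open>\<psi>\<close>.
\<close>

lemma half_trace_defect_comp:
  assumes m: "refines_nrd m" and \<phi>: "similitude \<phi> \<mu>" and \<psi>: "similitude \<psi> \<nu>"
  shows "half_trace (defect m (\<phi> \<circ> \<psi>) (\<mu> * \<nu>))
    = \<mu> * half_trace (defect m \<psi> \<nu>) + \<nu> * half_trace (defect m \<phi> \<mu>)"
proof -
  let ?m = "\<lambda>u v. m (\<phi> u) (\<phi> v) / \<mu>"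
  have mu: "\<mu> \<noteq> 0" using \<phi> by (simp add: similitude_def)
  have eq: "half_trace (defect m \<psi> \<nu>) = half_trace (defect ?m \<psi> \<nu>)"
    by (rule half_trace_defect_indep[OF m refines_nrd_pullback[OF m \<phi>] \<psi>])
  show ?thesis unfolding eq unfolding half_trace_def defect_def
    using mu by (simp add: algebra_simps diff_divide_distrib)
qed

text \<open>
  The refinement \<open>polar (\<kappa> u v) x\<close> of the norm is multiplied by \<open>nrd a\<close> under left multiplication by
  \<open>a\<close>, so that its defect is \<open>0\<close>.
\<close>

lemma half_trace_defect_L:
  assumes m: "refines_nrd m" and a: "nrd a \<noteq> 0" shows "half_trace (defect m (L a) (nrd a)) = 0"
proof -
  let ?m = "\<lambda>u v. polar (\<kappa> u * v) x"
  have "refines_nrd ?m" unfolding refines_nrd_def bilinear_form_iff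
    by (auto simp: kappa_add kappa_scale qa_simps polar_simps kappa_mult_self polar_table)
  then have "half_trace (defect m (L a) (nrd a)) = half_trace (defect ?m (L a) (nrd a))"
    using half_trace_defect_indep[OF m _ similitude_L[OF a]] by blast
  also have "\<kappa> (a * u) * (a * v) = scale (nrd a) (\<kappa> u * v)" for u v
    by (simp add: kappa_mult mult.assoc kappa_mult_mult qa_simps)
  then have "defect ?m (L a) (nrd a) = (\<lambda>u v. 0)"
    by (intro ext) (simp add: defect_def L_def polar_simps)
  then have "half_trace (defect ?m (L a) (nrd a)) = 0"
    by (simp add: half_trace_def)
  finally show ?thesis .
qed

text \<open>
  The refinement without defect is \<open>polar (u \<kappa> v) x\<close>, since \<open>a\<close> and \<open>\<kappa> a\<close> meet in the middle.
\<close>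

lemma half_trace_defect_R:
  assumes m: "refines_nrd m" and a: "nrd a \<noteq> 0" shows "half_trace (defect m (R a) (nrd a)) = 0"
proof -
  let ?m = "\<lambda>u v. polar (u * \<kappa> v) x"
  have "refines_nrd ?m" unfolding refines_nrd_def bilinear_form_iff
    by (auto simp: kappa_add kappa_scale qa_simps polar_simps mult_kappa polar_table)
  then have "half_trace (defect m (R a) (nrd a)) = half_trace (defect ?m (R a) (nrd a))"
    using half_trace_defect_indep[OF m _ similitude_R[OF a]] by blast
  also have "(u * a) * \<kappa> (v * a) = scale (nrd a) (u * \<kappa> v)" for u v
    by (simp add: kappa_mult mult.assoc mult_kappa_mult qa_simps)
  then have "defect ?m (R a) (nrd a) = (\<lambda>u v. 0)"
    by (intro ext) (simp add: defect_def R_def polar_simps)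
  then have "half_trace (defect ?m (R a) (nrd a)) = 0"
    by (simp add: half_trace_def)
  finally show ?thesis .
qed

text \<open>
  Only the pair \<open>(1, x)\<close> contributes: as \<open>\<kappa> x = 1 - x\<close>, its contribution is \<open>m 1 1 = nrd 1\<close>.
\<close>

lemma half_trace_defect_twist:
  assumes m: "refines_nrd m" shows "half_trace (defect m (twist e) 1) = (if e then 1 else 0)"
proof -
  note B = m[unfolded refines_nrd_def bilinear_form_iff, THEN conjunct1]
  have minus: "m (- u) v = - m u v" "m u (- v) = - m u v" for u v
    using B by (metis mult_minus1 scale_minus_left scale_one)+
  have k: "\<kappa> y = - y" "\<kappa> (x * y) = - (x * y)" "\<kappa> x = 1 + - x"
    using polar_table(3,4) by (simp_all add: kappa_eq polar_one_right x)
  have "m 1 (1 + - x) = m 1 1 + - m 1 x" using B minus by metis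
  also have "m 1 1 = 1" using m by (simp add: refines_nrd_def)
  finally have "m 1 (\<kappa> x) = 1 + m 1 x" by (simp only: k minus_char_2)
  then show ?thesis by (cases e) (simp_all add: half_trace_def defect_def twist_def k minus)
qed

lemma half_trace_defect_sandwich:
  assumes m: "refines_nrd m" and ab: "nrd a \<noteq> 0" "nrd b \<noteq> 0"
  shows "half_trace (defect m (sandwich e a b) (nrd a * nrd b)) = nrd a * nrd b * (if e then 1 else 0)"
proof -
  have "similitude (R b \<circ> twist e) (nrd b * 1)"
    by (rule similitude_comp[OF similitude_R[OF ab(2)] similitude_twist])
  then show ?thesis
    using half_trace_defect_comp[OF m similitude_L[OF ab(1)], of "R b \<circ> twist e" "nrd b"]
      half_trace_defect_comp[OF m similitude_R[OF ab(2)] similitude_twist[of e]]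
      half_trace_defect_L[OF m ab(1)] half_trace_defect_R[OF m ab(2)] half_trace_defect_twist[OF m, of e]
    by (simp add: sandwich_eq_comp)
qed

lemma dickson_sandwich:
  assumes ab: "nrd a \<noteq> 0" "nrd b \<noteq> 0"
  shows "dickson (sandwich e a b) = (if e then 1 else 0)"
proof -
  let ?\<phi> = "sandwich e a b" and ?\<mu> = "nrd a * nrd b"
  have mu: "multiplier ?\<phi> = ?\<mu>" using multiplier_sandwich ab by blast
  let ?P = "\<lambda>m \<rho>. (\<forall>x. Vector_Spaces.linear scale (*) (m x)) \<and>
    (\<forall>y. Vector_Spaces.linear scale (*) (\<lambda>x. m x y)) \<and>
    (\<forall>x. m x x = nrd x) \<and>
    Vector_Spaces.linear scale scale \<rho> \<and>
    (\<forall>x y. m (?\<phi> x) (?\<phi> y) = multiplier ?\<phi> * m x y + polar x (\<rho> y) + polar y (\<rho> x))"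
  have P_iff: "?P m \<rho> \<longleftrightarrow> refines_nrd m \<and> Vector_Spaces.linear scale scale \<rho> \<and>
    (\<forall>u v. defect m ?\<phi> ?\<mu> u v = polar u (\<rho> v) + polar v (\<rho> u))" for m \<rho>
    unfolding refines_nrd_def bilinear_form_def defect_def mu by (simp add: algebra_simps)
  have val: "trace_endo \<rho> / multiplier ?\<phi> = (if e then 1 else 0)" if "?P m \<rho>" for m \<rho>
  proof -
    have "half_trace (defect m ?\<phi> ?\<mu>) = trace_endo \<rho>"
      using that unfolding P_iff by (intro half_trace_eq_trace) auto
    then show ?thesis using half_trace_defect_sandwich[of m a b e] that ab unfolding P_iff
      by (auto simp: mu)
  qed
  have ex: "\<exists>m \<rho>. ?P m \<rho>"
  proof -
    have "refines_nrd (\<lambda>u v. polar (\<kappa> u * v) x)" unfolding refines_nrd_def bilinear_form_iff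
      by (auto simp: kappa_add kappa_scale qa_simps polar_simps kappa_mult_self polar_table)
    then obtain m where m: "refines_nrd m" by blast
    have "bilinear_form (defect m ?\<phi> ?\<mu>)"
      using m linear_sandwich[of e a b] unfolding refines_nrd_def bilinear_form_iff defect_def Vector_Spaces.linear_iff
      by (auto simp: algebra_simps)
    moreover have "defect m ?\<phi> ?\<mu> u u = 0" for u
      using m by (simp only: refines_nrd_def defect_def nrd_sandwich) simp
    ultimately obtain \<rho> where "Vector_Spaces.linear scale scale \<rho>"
      "\<And>u v. defect m ?\<phi> ?\<mu> u v = polar u (\<rho> v) + polar v (\<rho> u)"
      using alternating_form_splits by blast
    then have "?P m \<rho>" unfolding P_iff using m by blast
    then show ?thesis by (intro exI)
  qed
  obtain m \<rho> where P: "?P m \<rho>" using ex by blast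
  show ?thesis unfolding dickson_def
  proof (rule the_equality)
    show "\<exists>m \<rho>. (\<forall>x. Vector_Spaces.linear scale (*) (m x)) \<and>
      (\<forall>y. Vector_Spaces.linear scale (*) (\<lambda>x. m x y)) \<and> (\<forall>x. m x x = nrd x) \<and>
      Vector_Spaces.linear scale scale \<rho> \<and>
      (\<forall>x y. m (?\<phi> x) (?\<phi> y) = multiplier ?\<phi> * m x y + polar x (\<rho> y) + polar y (\<rho> x)) \<and>
      (if e then 1 else 0) = trace_endo \<rho> / multiplier ?\<phi>"
      using P val[OF P] by (intro exI[of _ m] exI[of _ \<rho>]) simp
  qed (use val in metis)
qed

end

lemma two_eq_zero_iff: "(2::'k) = 0 \<longleftrightarrow> CHAR('k) = 2"
proof -
  have "(2::'k) = 0 \<longleftrightarrow> CHAR('k) dvd 2" using of_nat_eq_0_iff_char_dvd[where ?'a = 'k, of 2] by simp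
  also have "\<dots> \<longleftrightarrow> CHAR('k) = 2"
  proof
    assume d: "CHAR('k) dvd 2"
    have "CHAR('k) \<le> 2" by (rule dvd_imp_le[OF d]) simp
    moreover have "CHAR('k) \<noteq> 0" using d by (metis dvd_0_left_iff zero_neq_numeral)
    moreover have "CHAR('k) \<noteq> 1" unfolding One_nat_def by (rule CHAR_not_1')
    ultimately show "CHAR('k) = 2" by linarith
  qed simp
  finally show ?thesis .
qed

theorem proper_sandwich_iff:
  assumes ab: "nrd a \<noteq> 0" "nrd b \<noteq> 0"
  shows "proper (sandwich e a b) \<longleftrightarrow> \<not> e"
proof (cases "CHAR('k) = 2")
  case False
  then show ?thesis using proper_sandwich_char_not_2[OF _ ab] two_eq_zero_iff by (simp add: proper_def)
next
  case True
  then have two: "(2::'k) = 0" using two_eq_zero_iff by simp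
  obtain c where c: "trd c \<noteq> 0"
    using nondegenerate[of 1] one_neq_zero by (metis polar_commute polar_one_right)
  define x where "x = scale (inverse (trd c)) c"
  have x: "trd x = 1" using c by (simp add: x_def trd_scale)
  obtain y where "nrd y \<noteq> 0" "x * y = y * \<kappa> x"
    using exists_anticommuting_unit[OF separable_char_2[OF two x]] by blast
  from dickson_sandwich[OF two x this ab] show ?thesis using True by (simp add: proper_def)
qed

end

section \<open>Equivalences of categories and action groupoids\<close>

text \<open>
  A quasi-inverse chooses a preimage \<open>G0 d\<close> and an isomorphism \<open>e d : F0 (G0 d) \<rightarrow> d\<close> for every object.
  It sends a morphism \<open>h : d \<rightarrow> d'\<close> to the unique lift of \<open>T d d' h = (e d')\<^sup>-\<^sup>1 h (e d)\<close>.
  All required equations are checked after applying the faithful functor or cancelling an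
  isomorphism.
\<close>

theorem equivalence_if_fully_faithful:
  assumes F: "category_functor C D F0 F1"
    and ff: "\<And>x y. x \<in> Obj C \<Longrightarrow> y \<in> Obj C \<Longrightarrow> bij_betw (F1 x y) (Hom C x y) (Hom D (F0 x) (F0 y))"
    and ess: "\<And>d. d \<in> Obj D \<Longrightarrow> \<exists>c\<in>Obj C. \<exists>f. isomorphism_in D (F0 c) d f"
  shows "equivalence_of_categories C D F0 F1"
proof -
  interpret F: category_functor C D F0 F1 by fact
  have "\<exists>c f f'. c \<in> Obj C \<and> f \<in> Hom D (F0 c) d \<and> f' \<in> Hom D d (F0 c) \<and>
    Comp D (F0 c) d (F0 c) f' f = Ide D (F0 c) \<and> Comp D d (F0 c) d f f' = Ide D d" if "d \<in> Obj D" for d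
    using ess[OF that] unfolding isomorphism_in_def by blast
  then obtain G0 e e' where G0: "\<And>d. d \<in> Obj D \<Longrightarrow> G0 d \<in> Obj C"
    and e: "\<And>d. d \<in> Obj D \<Longrightarrow> e d \<in> Hom D (F0 (G0 d)) d"
    and e': "\<And>d. d \<in> Obj D \<Longrightarrow> e' d \<in> Hom D d (F0 (G0 d))"
    and e'e: "\<And>d. d \<in> Obj D \<Longrightarrow> Comp D (F0 (G0 d)) d (F0 (G0 d)) (e' d) (e d) = Ide D (F0 (G0 d))"
    and ee': "\<And>d. d \<in> Obj D \<Longrightarrow> Comp D d (F0 (G0 d)) d (e d) (e' d) = Ide D d"
    by metis
  define P where "P x y = inv_into (Hom C x y) (F1 x y)" for x y
  have P_Hom: "P x y h \<in> Hom C x y" and F_P: "F1 x y (P x y h) = h"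
    if "x \<in> Obj C" "y \<in> Obj C" "h \<in> Hom D (F0 x) (F0 y)" for x y h
    using ff[OF that(1,2)] that(3) unfolding P_def bij_betw_def
    by (auto intro: inv_into_into f_inv_into_f)
  have faithful: "f = g" if "x \<in> Obj C" "y \<in> Obj C" "f \<in> Hom C x y" "g \<in> Hom C x y" "F1 x y f = F1 x y g"
    for x y f g using ff[OF that(1,2)] that(3-) by (auto simp: bij_betw_def inj_on_def)
  note obj = G0 F.F0_in_Obj
  define T where "T d d' h = Comp D (F0 (G0 d)) d (F0 (G0 d')) (Comp D d d' (F0 (G0 d')) (e' d') h) (e d)" for d d' h
  have T_Hom: "T d d' h \<in> Hom D (F0 (G0 d)) (F0 (G0 d'))"
    if "d \<in> Obj D" "d' \<in> Obj D" "h \<in> Hom D d d'" for d d' h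
    unfolding T_def by (intro F.D.Comp_in_Hom[of _ d] F.D.Comp_in_Hom[of d d'] obj e e' that)
  have e_T: "Comp D (F0 (G0 d)) (F0 (G0 d')) d' (e d') (T d d' h) = Comp D (F0 (G0 d)) d d' h (e d)"
    if d: "d \<in> Obj D" "d' \<in> Obj D" and h: "h \<in> Hom D d d'" for d d' h
  proof -
    have 1: "Comp D d d' (F0 (G0 d')) (e' d') h \<in> Hom D d (F0 (G0 d'))"
      by (intro F.D.Comp_in_Hom[of _ d'] obj e' d h)
    have "Comp D (F0 (G0 d)) (F0 (G0 d')) d' (e d') (T d d' h)
      = Comp D (F0 (G0 d)) d d' (Comp D d (F0 (G0 d')) d' (e d') (Comp D d d' (F0 (G0 d')) (e' d') h)) (e d)"
      unfolding T_def by (intro F.D.Comp_assoc obj e d 1)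
    also have "Comp D d (F0 (G0 d')) d' (e d') (Comp D d d' (F0 (G0 d')) (e' d') h)
      = Comp D d d' d' (Comp D d' (F0 (G0 d')) d' (e d') (e' d')) h"
      by (intro F.D.Comp_assoc obj e e' d h)
    also have "\<dots> = h" using ee' d h F.D.Comp_Ide_left by simp
    finally show ?thesis .
  qed
  have cancel: "f = g" if d: "d \<in> Obj D" "z \<in> Obj D" and fg: "f \<in> Hom D z (F0 (G0 d))" "g \<in> Hom D z (F0 (G0 d))"
    and eq: "Comp D z (F0 (G0 d)) d (e d) f = Comp D z (F0 (G0 d)) d (e d) g" for d z f g
  proof -
    have "Comp D z d (F0 (G0 d)) (e' d) (Comp D z (F0 (G0 d)) d (e d) h) = h"
      if h: "h \<in> Hom D z (F0 (G0 d))" for h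
    proof -
      have "Comp D z d (F0 (G0 d)) (e' d) (Comp D z (F0 (G0 d)) d (e d) h)
        = Comp D z (F0 (G0 d)) (F0 (G0 d)) (Comp D (F0 (G0 d)) d (F0 (G0 d)) (e' d) (e d)) h"
        by (intro F.D.Comp_assoc obj e e' d h)
      also have "\<dots> = h" using e'e d h F.D.Comp_Ide_left obj by simp
      finally show ?thesis .
    qed
    with fg eq show ?thesis by metis
  qed
  define G1 where "G1 d d' h = P (G0 d) (G0 d') (T d d' h)" for d d' h
  have G1_Hom: "G1 d d' h \<in> Hom C (G0 d) (G0 d')" and F_G1: "F1 (G0 d) (G0 d') (G1 d d' h) = T d d' h"
    if "d \<in> Obj D" "d' \<in> Obj D" "h \<in> Hom D d d'" for d d' h
    using P_Hom F_P T_Hom obj that by (auto simp: G1_def)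
  have G: "category_functor D C G0 G1"
  proof
    fix d assume d: "d \<in> Obj D"
    have "T d d (Ide D d) = Ide D (F0 (G0 d))"
      using F.D.Comp_Ide_right e' e'e d obj by (simp add: T_def)
    then show "G1 d d (Ide D d) = Ide C (G0 d)"
      using d by (intro faithful[of "G0 d" "G0 d"])
        (auto simp: F_G1 F.F1_Ide F.D.Ide_in_Hom obj intro!: G1_Hom F.C.Ide_in_Hom)
  next
    fix a b c f g assume o: "a \<in> Obj D" "b \<in> Obj D" "c \<in> Obj D" and f: "f \<in> Hom D a b" and g: "g \<in> Hom D b c"
    have gf: "Comp D a b c g f \<in> Hom D a c" by (intro F.D.Comp_in_Hom[of a b c] o f g)
    have "T a c (Comp D a b c g f) = Comp D (F0 (G0 a)) (F0 (G0 b)) (F0 (G0 c)) (T b c g) (T a b f)"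
    proof (rule cancel)
      have "Comp D (F0 (G0 a)) (F0 (G0 c)) c (e c)
          (Comp D (F0 (G0 a)) (F0 (G0 b)) (F0 (G0 c)) (T b c g) (T a b f))
        = Comp D (F0 (G0 a)) (F0 (G0 b)) c (Comp D (F0 (G0 b)) (F0 (G0 c)) c (e c) (T b c g)) (T a b f)"
        by (intro F.D.Comp_assoc obj e o T_Hom f g)
      also have "\<dots> = Comp D (F0 (G0 a)) (F0 (G0 b)) c (Comp D (F0 (G0 b)) b c g (e b)) (T a b f)"
        by (simp add: e_T o g)
      also have "\<dots> = Comp D (F0 (G0 a)) b c g (Comp D (F0 (G0 a)) (F0 (G0 b)) b (e b) (T a b f))"
        by (intro F.D.Comp_assoc[symmetric] obj e o T_Hom f g)
      also have "\<dots> = Comp D (F0 (G0 a)) b c g (Comp D (F0 (G0 a)) a b f (e a))"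
        by (simp add: e_T o f)
      also have "\<dots> = Comp D (F0 (G0 a)) a c (Comp D a b c g f) (e a)"
        by (intro F.D.Comp_assoc obj e o f g)
      also have "\<dots> = Comp D (F0 (G0 a)) (F0 (G0 c)) c (e c) (T a c (Comp D a b c g f))"
        by (simp add: e_T o gf)
      finally show "Comp D (F0 (G0 a)) (F0 (G0 c)) c (e c) (T a c (Comp D a b c g f)) =
        Comp D (F0 (G0 a)) (F0 (G0 c)) c (e c)
          (Comp D (F0 (G0 a)) (F0 (G0 b)) (F0 (G0 c)) (T b c g) (T a b f))" ..
    qed (intro o obj T_Hom gf f g F.D.Comp_in_Hom[of _ "F0 (G0 b)"])+
    then show "G1 a c (Comp D a b c g f) = Comp C (G0 a) (G0 b) (G0 c) (G1 b c g) (G1 a b f)"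
      using o f g gf by (intro faithful[of "G0 a" "G0 c"] G1_Hom F.C.Comp_in_Hom[of _ "G0 b"])
        (auto simp: F_G1 obj F.F1_Comp[of _ "G0 b"] G1_Hom)
  qed (auto intro: G0 G1_Hom)
  have nat_D: "natural_isomorphism D D
      (\<lambda>x. F0 (G0 x)) (\<lambda>x y f. F1 (G0 x) (G0 y) (G1 x y f)) (\<lambda>x. x) (\<lambda>x y f. f) e"
    unfolding natural_isomorphism_def isomorphism_in_def
    by (auto simp: F_G1 e_T e'e ee' intro!: e bexI[OF _ e'])
  define \<eta> where "\<eta> x = P x (G0 (F0 x)) (e' (F0 x))" for x
  define \<eta>' where "\<eta>' x = P (G0 (F0 x)) x (e (F0 x))" for x
  have \<eta>: "\<eta> x \<in> Hom C x (G0 (F0 x))" "F1 x (G0 (F0 x)) (\<eta> x) = e' (F0 x)"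
    "\<eta>' x \<in> Hom C (G0 (F0 x)) x" "F1 (G0 (F0 x)) x (\<eta>' x) = e (F0 x)" if "x \<in> Obj C" for x
    unfolding \<eta>_def \<eta>'_def by (intro P_Hom F_P obj that e e')+
  have nat_C: "natural_isomorphism C C (\<lambda>x. x) (\<lambda>x y f. f)
        (\<lambda>x. G0 (F0 x)) (\<lambda>x y f. G1 (F0 x) (F0 y) (F1 x y f)) \<eta>"
    unfolding natural_isomorphism_def isomorphism_in_def
  proof (intro conjI ballI)
    fix x assume x: "x \<in> Obj C"
    show "\<eta> x \<in> Hom C x (G0 (F0 x))" using \<eta> x by blast
    have "Comp C x (G0 (F0 x)) x (\<eta>' x) (\<eta> x) = Ide C x"
      by (rule faithful[of x x]) (use x \<eta>[OF x] in
        \<open>auto simp: F.F1_Comp[of _ "G0 (F0 x)"] F.F1_Ide ee' obj intro!: F.C.Comp_in_Hom[of _ "G0 (F0 x)"] F.C.Ide_in_Hom\<close>)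
    moreover have "Comp C (G0 (F0 x)) x (G0 (F0 x)) (\<eta> x) (\<eta>' x) = Ide C (G0 (F0 x))"
      by (rule faithful[of "G0 (F0 x)" "G0 (F0 x)"]) (use x \<eta>[OF x] in
        \<open>auto simp: F.F1_Comp[of _ x] F.F1_Ide e'e obj intro!: F.C.Comp_in_Hom[of _ x] F.C.Ide_in_Hom\<close>)
    ultimately show "\<exists>g\<in>Hom C (G0 (F0 x)) x. Comp C x (G0 (F0 x)) x g (\<eta> x) = Ide C x \<and>
        Comp C (G0 (F0 x)) x (G0 (F0 x)) (\<eta> x) g = Ide C (G0 (F0 x))" using \<eta> x by blast
  next
    fix x y f assume x: "x \<in> Obj C" and y: "y \<in> Obj C" and f: "f \<in> Hom C x y"
    let ?X = "F0 x" and ?Y = "F0 y"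
    have Ff: "F1 x y f \<in> Hom D ?X ?Y" by (rule F.F1_in_Hom[OF x y f])
    note Gf = G1_Hom[OF F.F0_in_Obj[OF x] F.F0_in_Obj[OF y] Ff]
    have "Comp D ?X ?Y (F0 (G0 ?Y)) (e' ?Y) (F1 x y f)
      = Comp D ?X (F0 (G0 ?X)) (F0 (G0 ?Y)) (T ?X ?Y (F1 x y f)) (e' ?X)"
    proof (rule cancel)
      have "Comp D ?X (F0 (G0 ?Y)) ?Y (e ?Y) (Comp D ?X ?Y (F0 (G0 ?Y)) (e' ?Y) (F1 x y f))
        = Comp D ?X ?Y ?Y (Comp D ?Y (F0 (G0 ?Y)) ?Y (e ?Y) (e' ?Y)) (F1 x y f)"
        by (intro F.D.Comp_assoc obj e e' Ff x y)
      also have "\<dots> = F1 x y f" using F.D.Comp_Ide_left Ff obj x y by (simp add: ee')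
      finally have 1: "Comp D ?X (F0 (G0 ?Y)) ?Y (e ?Y) (Comp D ?X ?Y (F0 (G0 ?Y)) (e' ?Y) (F1 x y f)) = F1 x y f" .
      have "Comp D ?X (F0 (G0 ?Y)) ?Y (e ?Y) (Comp D ?X (F0 (G0 ?X)) (F0 (G0 ?Y)) (T ?X ?Y (F1 x y f)) (e' ?X))
        = Comp D ?X (F0 (G0 ?X)) ?Y (Comp D (F0 (G0 ?X)) (F0 (G0 ?Y)) ?Y (e ?Y) (T ?X ?Y (F1 x y f))) (e' ?X)"
        by (intro F.D.Comp_assoc obj e e' Ff x y T_Hom)
      also have "\<dots> = Comp D ?X (F0 (G0 ?X)) ?Y (Comp D (F0 (G0 ?X)) ?X ?Y (F1 x y f) (e ?X)) (e' ?X)"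
        by (simp add: e_T obj x y Ff)
      also have "\<dots> = Comp D ?X ?X ?Y (F1 x y f) (Comp D ?X (F0 (G0 ?X)) ?X (e ?X) (e' ?X))"
        by (intro F.D.Comp_assoc[symmetric] obj e e' Ff x y)
      also have "\<dots> = F1 x y f" using F.D.Comp_Ide_right Ff obj x y by (simp add: ee')
      finally show "Comp D ?X (F0 (G0 ?Y)) ?Y (e ?Y) (Comp D ?X ?Y (F0 (G0 ?Y)) (e' ?Y) (F1 x y f))
        = Comp D ?X (F0 (G0 ?Y)) ?Y (e ?Y) (Comp D ?X (F0 (G0 ?X)) (F0 (G0 ?Y)) (T ?X ?Y (F1 x y f)) (e' ?X))"
        using 1 by simp
    qed (intro obj x y T_Hom Ff e' F.D.Comp_in_Hom[of _ ?Y] F.D.Comp_in_Hom[of _ "F0 (G0 ?X)"])+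
    then show "Comp C x y (G0 ?Y) (\<eta> y) f = Comp C x (G0 ?X) (G0 ?Y) (G1 ?X ?Y (F1 x y f)) (\<eta> x)"
      using \<eta>[OF x] \<eta>[OF y] x y f Ff Gf
      by (intro faithful[of x "G0 ?Y"] F.C.Comp_in_Hom[of _ y] F.C.Comp_in_Hom[of _ "G0 ?X"])
        (auto simp: F_G1 obj F.F1_Comp[of x y] F.F1_Comp[of x "G0 ?X"])
  qed
  show ?thesis unfolding equivalence_of_categories_def using F G nat_C nat_D by blast
qed

locale group_acting = group G for G :: "'g monoid" (structure) +
  fixes X :: "'x set" and act :: "'g \<Rightarrow> 'x \<Rightarrow> 'x"
  assumes act_one: "x \<in> X \<Longrightarrow> act \<one> x = x"
    and act_mult: "\<lbrakk>g \<in> carrier G; h \<in> carrier G; x \<in> X\<rbrakk> \<Longrightarrow> act (g \<otimes> h) x = act g (act h x)"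
begin

lemma category_full_subcategory:
  assumes "S \<subseteq> X" shows "category (full_subcategory (action_groupoid G X act) S)"
  using assms by unfold_locales
    (auto simp: full_subcategory_def action_groupoid_def act_one act_mult subset_iff m_assoc)

lemma isomorphism_in_full_subcategory:
  assumes "S \<subseteq> X" "x \<in> S" "g \<in> carrier G" "act g x = y"
  shows "isomorphism_in (full_subcategory (action_groupoid G X act) S) x y g"
proof -
  have "act (inv g) y = x" using assms act_mult[of "inv g" g x] act_one[of x] by auto
  then show ?thesis using assms
    by (auto simp: isomorphism_in_def full_subcategory_def action_groupoid_def intro!: bexI[of _ "inv g"])
qed

end

section \<open>The orbit set and the triality action\<close>

context quaternion_algebra
begin

definition proportional :: "'a \<Rightarrow> 'a \<Rightarrow> bool" (infix \<open>\<approx>\<close> 50) where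
  "a \<approx> b \<longleftrightarrow> (\<exists>c. c \<noteq> 0 \<and> a = scale c b)"

lemma proportional_scale_right [simp]: "c \<noteq> 0 \<Longrightarrow> a \<approx> scale c b \<longleftrightarrow> a \<approx> b"
proof
  assume c: "c \<noteq> 0"
  assume "a \<approx> scale c b"
  then show "a \<approx> b" using c unfolding proportional_def by (metis mult_eq_0_iff scale_scale)
next
  assume c: "c \<noteq> 0"
  assume "a \<approx> b"
  then obtain d where "d \<noteq> 0" "a = scale d b" unfolding proportional_def by blast
  then show "a \<approx> scale c b" using c unfolding proportional_def by (intro exI[of _ "d / c"]) simp
qed

lemma proportional_refl [simp]: "a \<approx> a"
  unfolding proportional_def by (intro exI[of _ 1]) simp

lemma proportional_sym: "a \<approx> b \<longleftrightarrow> b \<approx> a"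
proof -
  have "b \<approx> a" if ab: "a \<approx> b" for a b
  proof -
    obtain c where "c \<noteq> 0" "a = scale c b" using ab by (auto simp: proportional_def)
    then show ?thesis using proportional_scale_right[of c b b] by simp
  qed
  then show ?thesis by blast
qed

lemma proportional_scale_left [simp]: "c \<noteq> 0 \<Longrightarrow> scale c a \<approx> b \<longleftrightarrow> a \<approx> b"
  using proportional_scale_right proportional_sym by metis

lemma proportional_trans: "a \<approx> b \<Longrightarrow> b \<approx> c \<Longrightarrow> a \<approx> c"
  unfolding proportional_def by (metis mult_eq_0_iff scale_scale)

lemma proportional_mult:
  assumes "a \<approx> a'" "b \<approx> b'" shows "a * b \<approx> a' * b'"
proof -
  obtain c d where "c \<noteq> 0" "a = scale c a'" "d \<noteq> 0" "b = scale d b'"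
    using assms by (auto simp: proportional_def)
  then show ?thesis by (simp add: scale_mult_left scale_mult_right del: scale_scale)
qed

lemma proportional_mult_left_cancel: "nrd u \<noteq> 0 \<Longrightarrow> u * a \<approx> u * b \<longleftrightarrow> a \<approx> b"
  using proportional_mult[of u u a b] proportional_mult[of "ainv u" "ainv u" "u * a" "u * b"] by auto

lemma kappa_ainv_proportional: "nrd a \<noteq> 0 \<Longrightarrow> \<kappa> (ainv a) = scale (inverse (nrd a)) a"
  by (simp add: ainv_def kappa_scale)

lemma mult_Astar [simp]: "a \<otimes>\<^bsub>Astar\<^esub> b = a * b" by (simp add: Astar_def)

lemma Acls_eq: "Acls a = {b. b \<approx> a}"
  by (auto simp: Acls_def r_coset_def kstar_def proportional_def scale_mult_left)

lemma Acls_eq_iff: "Acls a = Acls b \<longleftrightarrow> a \<approx> b"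
proof
  assume "Acls a = Acls b"
  then have "a \<in> {c. c \<approx> b}" unfolding Acls_eq by (metis mem_Collect_eq proportional_refl)
  then show "a \<approx> b" by simp
next
  assume "a \<approx> b"
  then have "x \<approx> a \<longleftrightarrow> x \<approx> b" for x by (metis proportional_sym proportional_trans)
  then show "Acls a = Acls b" unfolding Acls_eq by simp
qed

lemma Acls_mult: "Acls a \<otimes>\<^bsub>PAstar\<^esub> Acls b = Acls (a * b)"
proof -
  have "x \<approx> a * b \<longleftrightarrow> (\<exists>u v. u \<approx> a \<and> v \<approx> b \<and> x = u * v)" for x
  proof
    assume "x \<approx> a * b"
    then obtain c where "c \<noteq> 0" "x = scale c a * b" by (auto simp: proportional_def scale_mult_left)
    then show "\<exists>u v. u \<approx> a \<and> v \<approx> b \<and> x = u * v"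
      by (intro exI[of _ "scale c a"] exI[of _ b]) simp
  qed (auto intro: proportional_mult)
  then show ?thesis by (auto simp: PAstar_def FactGroup_def set_mult_def Acls_eq)
qed

lemma carrier_PAstar: "carrier PAstar = {Acls a | a. nrd a \<noteq> 0}"
  by (auto simp: PAstar_def FactGroup_def RCOSETS_def Acls_def carrier_Astar)

lemma one_PAstar: "\<one>\<^bsub>PAstar\<^esub> = Acls 1"
  by (auto simp: PAstar_def FactGroup_def Acls_eq kstar_def proportional_def)

lemma group_PAstar: "group PAstar"
proof (rule groupI)
  fix x assume "x \<in> carrier PAstar"
  then obtain a where a: "nrd a \<noteq> 0" "x = Acls a" by (auto simp: carrier_PAstar)
  then show "\<exists>y\<in>carrier PAstar. y \<otimes>\<^bsub>PAstar\<^esub> x = \<one>\<^bsub>PAstar\<^esub>"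
    by (intro bexI[of _ "Acls (ainv a)"]) (auto simp: carrier_PAstar Acls_mult one_PAstar nrd_ainv
      intro!: exI[of _ "ainv a"])
next
  show "\<one>\<^bsub>PAstar\<^esub> \<in> carrier PAstar" by (auto simp: carrier_PAstar one_PAstar intro!: exI[of _ 1])
next
  fix x y assume "x \<in> carrier PAstar" "y \<in> carrier PAstar"
  then obtain a b where "nrd a \<noteq> 0" "x = Acls a" "nrd b \<noteq> 0" "y = Acls b" by (auto simp: carrier_PAstar)
  then show "x \<otimes>\<^bsub>PAstar\<^esub> y \<in> carrier PAstar"
    by (auto simp: carrier_PAstar Acls_mult nrd_mult intro!: exI[of _ "a * b"])
qed (auto simp: carrier_PAstar Acls_mult one_PAstar mult.assoc)

lemma inv_PAstar: "nrd a \<noteq> 0 \<Longrightarrow> inv\<^bsub>PAstar\<^esub> (Acls a) = Acls (ainv a)"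
  by (rule group.inv_equality[OF group_PAstar])
    (auto simp: Acls_mult one_PAstar carrier_PAstar nrd_ainv intro: exI[of _ "ainv a"])

lemma conj_act_Acls:
  "nrd s \<noteq> 0 \<Longrightarrow> conj_act (Acls s) (Acls a, Acls b) = (Acls (s * a * ainv s), Acls (s * b * ainv s))"
  by (simp add: conj_act_def inv_PAstar Acls_mult)

lemma ZZc_acting: "group_acting PAstar (carrier PAstar \<times> carrier PAstar) conj_act"
proof -
  interpret group PAstar by (rule group_PAstar)
  show ?thesis
  proof
    fix x assume "x \<in> carrier PAstar \<times> carrier PAstar"
    then show "conj_act \<one>\<^bsub>PAstar\<^esub> x = x"
      by (auto simp: carrier_PAstar one_PAstar conj_act_Acls)
  next
    fix g h x assume "g \<in> carrier PAstar" "h \<in> carrier PAstar" "x \<in> carrier PAstar \<times> carrier PAstar"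
    then show "conj_act (g \<otimes>\<^bsub>PAstar\<^esub> h) x = conj_act g (conj_act h x)"
      by (auto simp: carrier_PAstar conj_act_Acls Acls_mult nrd_mult ainv_mult mult.assoc)
  qed
qed

lemma mult_GL [simp]: "\<phi> \<otimes>\<^bsub>GL\<^esub> \<psi> = \<phi> \<circ> \<psi>" by (simp add: GL_def)

lemma carrier_GL: "\<phi> \<in> carrier GL \<longleftrightarrow> Vector_Spaces.linear scale scale \<phi> \<and> bij \<phi>"
  by (simp add: GL_def)

lemma GL_comp: "\<phi> \<in> carrier GL \<Longrightarrow> \<psi> \<in> carrier GL \<Longrightarrow> \<phi> \<circ> \<psi> \<in> carrier GL"
  by (auto simp: carrier_GL intro: bij_comp Vector_Spaces.linear_compose)

lemma GL_scale: "\<phi> \<in> carrier GL \<Longrightarrow> \<phi> (scale c x) = scale c (\<phi> x)"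
  by (simp add: carrier_GL Vector_Spaces.linear_iff)

lemma inv_GL_eqI:
  assumes "\<psi> \<in> carrier GL" "\<phi> \<circ> \<psi> = id" "\<psi> \<circ> \<phi> = id" shows "inv\<^bsub>GL\<^esub> \<phi> = \<psi>"
  unfolding m_inv_def
proof (rule the_equality)
  show "\<psi> \<in> carrier GL \<and> \<phi> \<otimes>\<^bsub>GL\<^esub> \<psi> = \<one>\<^bsub>GL\<^esub> \<and> \<psi> \<otimes>\<^bsub>GL\<^esub> \<phi> = \<one>\<^bsub>GL\<^esub>" using assms by (simp add: GL_def)
  fix y assume "y \<in> carrier GL \<and> \<phi> \<otimes>\<^bsub>GL\<^esub> y = \<one>\<^bsub>GL\<^esub> \<and> y \<otimes>\<^bsub>GL\<^esub> \<phi> = \<one>\<^bsub>GL\<^esub>"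
  then have "y \<circ> \<phi> = id" by (simp add: GL_def)
  then have "y = y \<circ> (\<phi> \<circ> \<psi>)" using assms by simp
  also have "\<dots> = \<psi>" using \<open>y \<circ> \<phi> = id\<close> by (simp add: comp_assoc[symmetric])
  finally show "y = \<psi>" .
qed

lemma cls_eq: "cls \<phi> = {\<psi>. \<exists>c. c \<noteq> 0 \<and> (\<forall>x. \<psi> x = scale c (\<phi> x))}"
  by (auto simp: cls_def r_coset_def homotheties_def fun_eq_iff) 

lemma cls_eq_iff: "cls \<phi> = cls \<psi> \<longleftrightarrow> (\<exists>c. c \<noteq> 0 \<and> (\<forall>x. \<phi> x = scale c (\<psi> x)))"
proof
  assume "cls \<phi> = cls \<psi>"
  moreover have "\<phi> \<in> cls \<phi>" unfolding cls_eq by (auto intro!: exI[of _ 1])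
  ultimately show "\<exists>c. c \<noteq> 0 \<and> (\<forall>x. \<phi> x = scale c (\<psi> x))" unfolding cls_eq by blast
next
  assume "\<exists>c. c \<noteq> 0 \<and> (\<forall>x. \<phi> x = scale c (\<psi> x))"
  then obtain c where c: "c \<noteq> 0" "\<And>x. \<phi> x = scale c (\<psi> x)" by blast
  have "(\<exists>d. d \<noteq> 0 \<and> (\<forall>x. \<theta> x = scale d (\<phi> x))) \<longleftrightarrow> (\<exists>d. d \<noteq> 0 \<and> (\<forall>x. \<theta> x = scale d (\<psi> x)))" for \<theta>
  proof
    assume "\<exists>d. d \<noteq> 0 \<and> (\<forall>x. \<theta> x = scale d (\<phi> x))"
    then obtain d where "d \<noteq> 0" "\<forall>x. \<theta> x = scale d (\<phi> x)" by blast
    then show "\<exists>d. d \<noteq> 0 \<and> (\<forall>x. \<theta> x = scale d (\<psi> x))" using c by (intro exI[of _ "d * c"]) simp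
  next
    assume "\<exists>d. d \<noteq> 0 \<and> (\<forall>x. \<theta> x = scale d (\<psi> x))"
    then obtain d where "d \<noteq> 0" "\<forall>x. \<theta> x = scale d (\<psi> x)" by blast
    then show "\<exists>d. d \<noteq> 0 \<and> (\<forall>x. \<theta> x = scale d (\<phi> x))" using c by (intro exI[of _ "d / c"]) simp
  qed
  then show "cls \<phi> = cls \<psi>" unfolding cls_eq by blast
qed

lemma set_mult_cls:
  assumes "\<phi> \<in> carrier GL" shows "cls \<phi> <#>\<^bsub>GL\<^esub> cls \<psi> = cls (\<phi> \<circ> \<psi>)"
proof -
  have "(\<exists>\<alpha>\<in>cls \<phi>. \<exists>\<beta>\<in>cls \<psi>. \<theta> = \<alpha> \<circ> \<beta>) \<longleftrightarrow> \<theta> \<in> cls (\<phi> \<circ> \<psi>)" for \<theta>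
  proof
    assume "\<exists>\<alpha>\<in>cls \<phi>. \<exists>\<beta>\<in>cls \<psi>. \<theta> = \<alpha> \<circ> \<beta>"
    then obtain \<alpha> \<beta> c d where "c \<noteq> 0" "d \<noteq> 0" "\<forall>x. \<alpha> x = scale c (\<phi> x)" "\<forall>x. \<beta> x = scale d (\<psi> x)"
      "\<theta> = \<alpha> \<circ> \<beta>" unfolding cls_eq by blast
    then show "\<theta> \<in> cls (\<phi> \<circ> \<psi>)" using GL_scale[OF assms]
      by (auto simp: cls_eq intro!: exI[of _ "c * d"])
  next
    assume "\<theta> \<in> cls (\<phi> \<circ> \<psi>)"
    then obtain c where c: "c \<noteq> 0" "\<forall>x. \<theta> x = scale c (\<phi> (\<psi> x))" by (auto simp: cls_eq)
    show "\<exists>\<alpha>\<in>cls \<phi>. \<exists>\<beta>\<in>cls \<psi>. \<theta> = \<alpha> \<circ> \<beta>"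
    proof (intro bexI)
      show "\<theta> = (\<lambda>x. scale c (\<phi> x)) \<circ> \<psi>" using c by auto
      show "(\<lambda>x. scale c (\<phi> x)) \<in> cls \<phi>" using c by (auto simp: cls_eq)
      show "\<psi> \<in> cls \<psi>" by (auto simp: cls_eq intro: exI[of _ 1])
    qed
  qed
  then show ?thesis by (auto simp: set_mult_def)
qed

lemma cls_comp_left:
  assumes "\<phi> \<in> carrier GL" "cls \<alpha> = cls \<beta>" shows "cls (\<phi> \<circ> \<alpha>) = cls (\<phi> \<circ> \<beta>)"
  using assms set_mult_cls by metis

lemma cls_comp_right: "cls \<alpha> = cls \<beta> \<Longrightarrow> cls (\<alpha> \<circ> \<phi>) = cls (\<beta> \<circ> \<phi>)"
  by (auto simp: cls_eq_iff)

lemma sandwich_comp_left: "sandwich False p q \<circ> sandwich e a b = sandwich e (p * a) (b * q)"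
  by (auto simp: sandwich_def twist_def mult.assoc)

lemma sandwich_comp_right:
  "sandwich e a b \<circ> sandwich False p q
    = (if e then sandwich e (a * \<kappa> q) (\<kappa> p * b) else sandwich e (a * p) (q * b))"
  by (auto simp: sandwich_def twist_def kappa_mult mult.assoc)

lemma sandwich_id: "sandwich False 1 1 = id"
  by (auto simp: sandwich_def twist_def)

lemma sandwich_inverse:
  assumes "nrd p \<noteq> 0" "nrd q \<noteq> 0"
  shows "sandwich False p q \<circ> sandwich False (ainv p) (ainv q) = id"
    "sandwich False (ainv p) (ainv q) \<circ> sandwich False p q = id"
  using assms by (simp_all add: sandwich_comp_left sandwich_id)

lemma L_eq_sandwich: "L a = sandwich False a 1" and R_eq_sandwich: "R a = sandwich False 1 a"
  by (auto simp: L_def R_def sandwich_def twist_def)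

lemma sandwich_in_GL:
  assumes "nrd a \<noteq> 0" "nrd b \<noteq> 0" shows "sandwich e a b \<in> carrier GL"
proof -
  have "sandwich e a b \<circ> (twist e \<circ> sandwich False (ainv a) (ainv b)) = id"
    "(twist e \<circ> sandwich False (ainv a) (ainv b)) \<circ> sandwich e a b = id"
    using assms by (auto simp: sandwich_def twist_def mult.assoc fun_eq_iff)
  then show ?thesis using o_bij linear_sandwich by (auto simp: carrier_GL)
qed

lemma inv_GL_sandwich:
  assumes "nrd p \<noteq> 0" "nrd q \<noteq> 0"
  shows "inv\<^bsub>GL\<^esub> (sandwich False p q) = sandwich False (ainv p) (ainv q)"
  by (rule inv_GL_eqI) (use assms in \<open>auto simp: sandwich_inverse nrd_ainv intro!: sandwich_in_GL\<close>)

lemma inv_R: "nrd w \<noteq> 0 \<Longrightarrow> inv\<^bsub>GL\<^esub> (R w) = R (ainv w)"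
  by (simp add: R_eq_sandwich inv_GL_sandwich)

text \<open>
  If \<open>a z b = c a' z b'\<close> for all \<open>z\<close>, then \<open>r = a'\<^sup>-\<^sup>1 a\<close> satisfies \<open>r z = z s\<close> for a fixed \<open>s\<close>. Taking
  \<open>z = 1\<close> gives \<open>r = s\<close>, so \<open>r\<close> is central.
\<close>

lemma cls_sandwich_eq_iff:
  assumes u: "nrd a \<noteq> 0" "nrd b \<noteq> 0" "nrd a' \<noteq> 0" "nrd b' \<noteq> 0"
  shows "cls (sandwich e a b) = cls (sandwich e a' b') \<longleftrightarrow> a \<approx> a' \<and> b \<approx> b'"
proof
  assume "a \<approx> a' \<and> b \<approx> b'"
  then obtain c d where "c \<noteq> 0" "a = scale c a'" "d \<noteq> 0" "b = scale d b'" by (auto simp: proportional_def)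
  then show "cls (sandwich e a b) = cls (sandwich e a' b')"
    by (auto simp: cls_eq_iff sandwich_def scale_mult_left scale_mult_right intro!: exI[of _ "c * d"])
next
  assume "cls (sandwich e a b) = cls (sandwich e a' b')"
  then obtain c where c: "c \<noteq> 0" "\<And>x. a * twist e x * b = scale c (a' * twist e x * b')"
    by (auto simp: cls_eq_iff sandwich_def)
  have *: "a * z * b = scale c (a' * z * b')" for z
    using c(2)[of "twist e z"] by (simp add: twist_def split: if_splits)
  define r where "r = ainv a' * a"
  have r: "r * z = z * scale c (b' * ainv b)" for z
  proof -
    have "r * z = ainv a' * (a * z * b) * ainv b" using u by (simp add: r_def mult.assoc)
    also have "\<dots> = z * scale c (b' * ainv b)" unfolding * using u by (simp add: qa_simps)
    finally show ?thesis .
  qed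
  from r[of 1] r have "r * z = z * r" for z by simp
  then have "scalar r" by (simp add: scalar_iff_central)
  then obtain d where d: "r = scale d 1" by (auto simp: scalar_def)
  have "nrd r \<noteq> 0" using u by (simp add: r_def nrd_mult nrd_ainv)
  then have "d \<noteq> 0" using d by (auto simp: nrd_scale)
  have "a = a' * r" using u by (simp add: r_def)
  then have "a = scale d a'" by (simp add: d qa_simps)
  moreover have "b \<approx> b'"
  proof -
    have "scale d 1 = scale c (b' * ainv b)" using r[of 1] d by simp
    then have "scale d 1 * b = scale c (b' * ainv b) * b" by simp
    then have "scale d b = scale c b'" using u by (simp add: qa_simps)
    then show ?thesis using \<open>d \<noteq> 0\<close> c(1) by (metis proportional_refl proportional_scale_left proportional_scale_right)
  qed
  ultimately show "a \<approx> a' \<and> b \<approx> b'" using \<open>d \<noteq> 0\<close> by (auto simp: proportional_def)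
qed

lemma GO_eq: "GO = {sandwich e a b | e a b. nrd a \<noteq> 0 \<and> nrd b \<noteq> 0}"
proof -
  have "\<exists>e a b. nrd a \<noteq> 0 \<and> nrd b \<noteq> 0 \<and> \<phi> = sandwich e a b" if "\<phi> \<in> GO" for \<phi>
    using that similitude_is_sandwich unfolding GO_def carrier_GL by blast
  moreover have "sandwich e a b \<in> GO" if "nrd a \<noteq> 0" "nrd b \<noteq> 0" for e a b
    unfolding GO_def using that sandwich_in_GL[OF that] by (auto simp: nrd_sandwich intro!: exI[of _ "nrd a * nrd b"])
  ultimately show ?thesis by blast
qed

lemma carrier_GOp: "carrier GOp = {sandwich False a b | a b. nrd a \<noteq> 0 \<and> nrd b \<noteq> 0}"
  unfolding GOp_def by (auto simp: GO_eq proper_sandwich_iff) blast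

lemma sandwich_in_GOp: "nrd a \<noteq> 0 \<Longrightarrow> nrd b \<noteq> 0 \<Longrightarrow> sandwich False a b \<in> carrier GOp"
  unfolding carrier_GOp by blast

lemma carrier_PGOp: "carrier PGOp = {cls (sandwich False a b) | a b. nrd a \<noteq> 0 \<and> nrd b \<noteq> 0}"
proof -
  have "homotheties #>\<^bsub>GOp\<^esub> \<phi> = cls \<phi>" for \<phi> by (simp add: cls_def r_coset_def GOp_def)
  then show ?thesis by (auto simp: PGOp_def FactGroup_def RCOSETS_def carrier_GOp)
qed

lemma cls_in_PGOp: "nrd p \<noteq> 0 \<Longrightarrow> nrd q \<noteq> 0 \<Longrightarrow> cls (sandwich False p q) \<in> carrier PGOp"
  unfolding carrier_PGOp by blast

lemma mult_PGOp: "\<phi> \<in> carrier GL \<Longrightarrow> cls \<phi> \<otimes>\<^bsub>PGOp\<^esub> cls \<psi> = cls (\<phi> \<circ> \<psi>)"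
  using set_mult_cls by (simp add: PGOp_def FactGroup_def GOp_def set_mult_def)

lemma one_PGOp: "\<one>\<^bsub>PGOp\<^esub> = cls (sandwich False 1 1)"
  by (auto simp: PGOp_def FactGroup_def homotheties_def cls_eq sandwich_id)

lemma mult_PGOp_sandwich:
  "nrd p \<noteq> 0 \<Longrightarrow> nrd q \<noteq> 0 \<Longrightarrow> cls (sandwich False p q) \<otimes>\<^bsub>PGOp\<^esub> cls (sandwich False p' q')
    = cls (sandwich False (p * p') (q' * q))"
  by (simp add: mult_PGOp sandwich_in_GL sandwich_comp_left)

lemma group_PGOp: "group PGOp"
proof (rule groupI)
  fix x assume "x \<in> carrier PGOp"
  then obtain p q where pq: "nrd p \<noteq> 0" "nrd q \<noteq> 0" "x = cls (sandwich False p q)" by (auto simp: carrier_PGOp)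
  have "cls (sandwich False (ainv p) (ainv q)) \<in> carrier PGOp"
    using pq by (simp add: cls_in_PGOp nrd_ainv)
  then show "\<exists>y\<in>carrier PGOp. y \<otimes>\<^bsub>PGOp\<^esub> x = \<one>\<^bsub>PGOp\<^esub>"
    using pq by (intro bexI[of _ "cls (sandwich False (ainv p) (ainv q))"])
      (auto simp: mult_PGOp_sandwich one_PGOp nrd_ainv)
next
  show "\<one>\<^bsub>PGOp\<^esub> \<in> carrier PGOp" by (simp add: one_PGOp cls_in_PGOp)
next
  fix x y assume "x \<in> carrier PGOp" "y \<in> carrier PGOp"
  then obtain p q p' q' where "nrd p \<noteq> 0" "nrd q \<noteq> 0" "x = cls (sandwich False p q)"
    "nrd p' \<noteq> 0" "nrd q' \<noteq> 0" "y = cls (sandwich False p' q')" by (auto simp: carrier_PGOp)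
  then show "x \<otimes>\<^bsub>PGOp\<^esub> y \<in> carrier PGOp"
    by (simp add: mult_PGOp_sandwich nrd_mult cls_in_PGOp)
qed (auto simp: carrier_PGOp mult_PGOp_sandwich one_PGOp nrd_mult mult.assoc)

definition flag_sign :: "bool \<Rightarrow> int" where "flag_sign e = (if e then -1 else 1)"

lemma PGO_flag_sign: "PGO (flag_sign e) = {cls (sandwich e a b) | a b. nrd a \<noteq> 0 \<and> nrd b \<noteq> 0}"
proof (cases e)
  case True
  have "\<phi> \<in> GO \<and> \<not> proper \<phi> \<longleftrightarrow> (\<exists>a b. nrd a \<noteq> 0 \<and> nrd b \<noteq> 0 \<and> \<phi> = sandwich True a b)" for \<phi>
  proof
    assume \<phi>: "\<phi> \<in> GO \<and> \<not> proper \<phi>"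
    then obtain f a b where "nrd a \<noteq> 0" "nrd b \<noteq> 0" "\<phi> = sandwich f a b" unfolding GO_eq by blast
    moreover from this \<phi> have f using proper_sandwich_iff[of a b f] by simp
    ultimately show "\<exists>a b. nrd a \<noteq> 0 \<and> nrd b \<noteq> 0 \<and> \<phi> = sandwich True a b" by auto
  next
    assume "\<exists>a b. nrd a \<noteq> 0 \<and> nrd b \<noteq> 0 \<and> \<phi> = sandwich True a b"
    then obtain a b where "nrd a \<noteq> 0" "nrd b \<noteq> 0" "\<phi> = sandwich True a b" by blast
    then show "\<phi> \<in> GO \<and> \<not> proper \<phi>" using proper_sandwich_iff[of a b True] by (auto simp: GO_eq)
  qed
  then show ?thesis unfolding PGO_def flag_sign_def using True by (auto 4 3)
qed (simp add: PGO_def flag_sign_def carrier_PGOp)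

lemma mult_PGL: "\<phi> \<in> carrier GL \<Longrightarrow> cls \<phi> \<otimes>\<^bsub>PGL\<^esub> cls \<psi> = cls (\<phi> \<circ> \<psi>)"
  using set_mult_cls by (simp add: PGL_def FactGroup_def)

lemma carrier_PGL: "carrier PGL = {cls \<phi> | \<phi>. \<phi> \<in> carrier GL}"
  by (auto simp: PGL_def FactGroup_def RCOSETS_def cls_def)

lemma R_in_GL: "nrd w \<noteq> 0 \<Longrightarrow> R w \<in> carrier GL" and L_in_GL: "nrd w \<noteq> 0 \<Longrightarrow> L w \<in> carrier GL"
  by (auto simp: R_eq_sandwich L_eq_sandwich intro: sandwich_in_GL)

lemma Astar_act_cls:
  "nrd w \<noteq> 0 \<Longrightarrow> Astar_act w (cls \<alpha>, cls \<beta>) = (cls (R (ainv w) \<circ> \<alpha>), cls (L w \<circ> \<beta>))"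
  by (simp add: Astar_act_def inv_R mult_PGL R_in_GL L_in_GL nrd_ainv)

lemma cls2_eq: "cls2 \<alpha> \<beta> = {(cls (R (ainv w) \<circ> \<alpha>), cls (L w \<circ> \<beta>)) | w. nrd w \<noteq> 0}"
  unfolding cls2_def orbit_def using Astar_act_cls by (auto simp: carrier_Astar) (metis)

lemma cls2_eq_iff:
  "cls2 \<alpha> \<beta> = cls2 \<alpha>' \<beta>' \<longleftrightarrow>
    (\<exists>w. nrd w \<noteq> 0 \<and> cls \<alpha>' = cls (R (ainv w) \<circ> \<alpha>) \<and> cls \<beta>' = cls (L w \<circ> \<beta>))"
proof
  assume eq: "cls2 \<alpha> \<beta> = cls2 \<alpha>' \<beta>'"
  have "R 1 = id" "L 1 = id" by (auto simp: R_def L_def)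
  then have "(cls \<alpha>', cls \<beta>') \<in> cls2 \<alpha>' \<beta>'" unfolding cls2_eq by (auto intro!: exI[of _ 1])
  then show "\<exists>w. nrd w \<noteq> 0 \<and> cls \<alpha>' = cls (R (ainv w) \<circ> \<alpha>) \<and> cls \<beta>' = cls (L w \<circ> \<beta>)"
    unfolding eq[symmetric] unfolding cls2_eq by blast
next
  assume "\<exists>w. nrd w \<noteq> 0 \<and> cls \<alpha>' = cls (R (ainv w) \<circ> \<alpha>) \<and> cls \<beta>' = cls (L w \<circ> \<beta>)"
  then obtain w where w: "nrd w \<noteq> 0" "cls \<alpha>' = cls (R (ainv w) \<circ> \<alpha>)" "cls \<beta>' = cls (L w \<circ> \<beta>)" by blast
  have shift: "cls (R (ainv v) \<circ> \<alpha>') = cls (R (ainv (v * w)) \<circ> \<alpha>)" "cls (L v \<circ> \<beta>') = cls (L (v * w) \<circ> \<beta>)"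
    if v: "nrd v \<noteq> 0" for v
  proof -
    have "R (ainv v) \<circ> (R (ainv w) \<circ> \<alpha>) = R (ainv (v * w)) \<circ> \<alpha>" "L v \<circ> (L w \<circ> \<beta>) = L (v * w) \<circ> \<beta>"
      using v w(1) by (auto simp: R_def L_def ainv_mult mult.assoc)
    then show "cls (R (ainv v) \<circ> \<alpha>') = cls (R (ainv (v * w)) \<circ> \<alpha>)" "cls (L v \<circ> \<beta>') = cls (L (v * w) \<circ> \<beta>)"
      using cls_comp_left[OF R_in_GL w(2), of "ainv v"] cls_comp_left[OF L_in_GL w(3), of v] v
      by (simp_all add: nrd_ainv)
  qed
  show "cls2 \<alpha> \<beta> = cls2 \<alpha>' \<beta>'"
  proof
    show "cls2 \<alpha>' \<beta>' \<subseteq> cls2 \<alpha> \<beta>"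
    proof
      fix z assume "z \<in> cls2 \<alpha>' \<beta>'"
      then obtain v where "nrd v \<noteq> 0" "z = (cls (R (ainv v) \<circ> \<alpha>'), cls (L v \<circ> \<beta>'))" unfolding cls2_eq by blast
      then show "z \<in> cls2 \<alpha> \<beta>" unfolding cls2_eq using w(1) shift by (auto simp: nrd_mult intro!: exI[of _ "v * w"])
    qed
    show "cls2 \<alpha> \<beta> \<subseteq> cls2 \<alpha>' \<beta>'"
    proof
      fix z assume "z \<in> cls2 \<alpha> \<beta>"
      then obtain u where u: "nrd u \<noteq> 0" "z = (cls (R (ainv u) \<circ> \<alpha>), cls (L u \<circ> \<beta>))" unfolding cls2_eq by blast
      have "u * ainv w * w = u" using w(1) by (simp add: mult.assoc)
      then show "z \<in> cls2 \<alpha>' \<beta>'" unfolding cls2_eq using u w(1) shift[of "u * ainv w"]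
        by (auto simp: nrd_mult nrd_ainv intro!: exI[of _ "u * ainv w"])
    qed
  qed
qed

lemma X_A_eq: "X_A = {cls2 \<alpha> \<beta> | \<alpha> \<beta>. \<alpha> \<in> carrier GL \<and> \<beta> \<in> carrier GL}"
  by (auto simp: X_A_def orbits_def carrier_PGL cls2_def)

text \<open>
  The unit is \<open>w = \<psi>\<^sub>2 y\<^sub>0\<close>. The lemma applies to two pairs of components of the same similitude.
  It also applies after shifting a pair by a unit \<open>v\<close>, since \<open>(x v\<^sup>-\<^sup>1) (v y) = x y\<close>.
\<close>

lemma triality_components_unique:
  assumes "\<phi>\<^sub>1 x\<^sub>0 = 1" "\<phi>\<^sub>2 y\<^sub>0 = 1" and eq: "\<And>x y. \<phi>\<^sub>1 x * \<phi>\<^sub>2 y = \<psi>\<^sub>1 x * \<psi>\<^sub>2 y"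
  obtains w where "nrd w \<noteq> 0" "\<psi>\<^sub>1 = R (ainv w) \<circ> \<phi>\<^sub>1" "\<psi>\<^sub>2 = L w \<circ> \<phi>\<^sub>2"
proof
  let ?w = "\<psi>\<^sub>2 y\<^sub>0"
  have 1: "\<psi>\<^sub>1 x\<^sub>0 * ?w = 1" using eq[of x\<^sub>0 y\<^sub>0] assms by simp
  then show w: "nrd ?w \<noteq> 0" using nrd_mult[of "\<psi>\<^sub>1 x\<^sub>0" ?w] by auto
  have iw: "\<psi>\<^sub>1 x\<^sub>0 = ainv ?w" using 1 w by (metis ainv(1) mult.assoc mult_1 mult_1_right)
  have "\<psi>\<^sub>1 x = \<phi>\<^sub>1 x * ainv ?w" for x
    using eq[of x y\<^sub>0] assms w by (metis ainv(1) mult.assoc mult_1_right)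
  then show "\<psi>\<^sub>1 = R (ainv ?w) \<circ> \<phi>\<^sub>1" by (auto simp: R_def)
  have "\<psi>\<^sub>2 y = ?w * \<phi>\<^sub>2 y" for y
  proof -
    have "\<phi>\<^sub>2 y = ainv ?w * \<psi>\<^sub>2 y" using eq[of x\<^sub>0 y] assms iw by simp
    then show ?thesis using w by simp
  qed
  then show "\<psi>\<^sub>2 = L ?w \<circ> \<phi>\<^sub>2" unfolding L_def comp_def by (rule ext)
qed

lemma GOp_subset_GL: "carrier GOp \<subseteq> carrier GL"
  by (auto simp: carrier_GOp intro: sandwich_in_GL)

lemma inv_GL_scaled:
  assumes "\<phi> \<in> carrier GOp" "\<phi>' \<in> carrier GOp" and c: "c \<noteq> 0" and eq: "\<And>x. \<phi>' x = scale c (\<phi> x)"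
  shows "(inv\<^bsub>GL\<^esub> \<phi>) x = scale c ((inv\<^bsub>GL\<^esub> \<phi>') x)"
proof -
  obtain p q p' q' where u: "nrd p \<noteq> 0" "nrd q \<noteq> 0" "nrd p' \<noteq> 0" "nrd q' \<noteq> 0"
    and e: "\<phi> = sandwich False p q" "\<phi>' = sandwich False p' q'" using assms(1,2) by (auto simp: carrier_GOp)
  let ?i = "sandwich False (ainv p) (ainv q)" and ?i' = "sandwich False (ainv p') (ainv q')"
  have inv: "inv\<^bsub>GL\<^esub> \<phi> = ?i" "inv\<^bsub>GL\<^esub> \<phi>' = ?i'" using u e inv_GL_sandwich by auto
  have "?i x = ?i (\<phi>' (?i' x))" using sandwich_inverse(1)[OF u(3,4)] unfolding e by (metis comp_apply id_apply)
  also have "\<dots> = scale c (?i (\<phi> (?i' x)))" by (simp add: eq sandwich_def twist_def qa_simps)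
  also have "?i (\<phi> (?i' x)) = ?i' x" using sandwich_inverse(2)[OF u(1,2)] unfolding e by (metis comp_apply id_apply)
  finally show ?thesis using inv by simp
qed

text \<open>
  Every other choice of representatives and components changes the pair on the right-hand side by
  the action of a unit, up to scalars: \<open>u\<close> accounts for the similitude and its components, \<open>w\<close> for the
  representatives of the orbit.
\<close>

lemma triality_act_eq:
  assumes \<phi>: "\<phi> \<in> carrier GOp" and t: "triality_components \<phi> \<phi>\<^sub>1 \<phi>\<^sub>2" and \<alpha>: "\<alpha> \<in> carrier GL" and \<beta>: "\<beta> \<in> carrier GL"
  shows "triality_act (cls \<phi>) (cls2 \<alpha> \<beta>) = cls2 (\<phi>\<^sub>1 \<circ> \<alpha> \<circ> inv\<^bsub>GL\<^esub> \<phi>) (\<phi>\<^sub>2 \<circ> \<beta> \<circ> inv\<^bsub>GL\<^esub> \<phi>)"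
  unfolding triality_act_def
proof (rule the_equality)
  show "\<exists>\<phi>' \<psi>\<^sub>1 \<psi>\<^sub>2 \<alpha>' \<beta>'. \<phi>' \<in> carrier GOp \<and> cls \<phi> = cls \<phi>' \<and> triality_components \<phi>' \<psi>\<^sub>1 \<psi>\<^sub>2 \<and>
    \<alpha>' \<in> carrier GL \<and> \<beta>' \<in> carrier GL \<and> cls2 \<alpha> \<beta> = cls2 \<alpha>' \<beta>' \<and>
    cls2 (\<phi>\<^sub>1 \<circ> \<alpha> \<circ> inv\<^bsub>GL\<^esub> \<phi>) (\<phi>\<^sub>2 \<circ> \<beta> \<circ> inv\<^bsub>GL\<^esub> \<phi>) = cls2 (\<psi>\<^sub>1 \<circ> \<alpha>' \<circ> inv\<^bsub>GL\<^esub> \<phi>') (\<psi>\<^sub>2 \<circ> \<beta>' \<circ> inv\<^bsub>GL\<^esub> \<phi>')"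
    using assms by blast
next
  fix y assume "\<exists>\<phi>' \<psi>\<^sub>1 \<psi>\<^sub>2 \<alpha>' \<beta>'. \<phi>' \<in> carrier GOp \<and> cls \<phi> = cls \<phi>' \<and> triality_components \<phi>' \<psi>\<^sub>1 \<psi>\<^sub>2 \<and>
    \<alpha>' \<in> carrier GL \<and> \<beta>' \<in> carrier GL \<and> cls2 \<alpha> \<beta> = cls2 \<alpha>' \<beta>' \<and>
    y = cls2 (\<psi>\<^sub>1 \<circ> \<alpha>' \<circ> inv\<^bsub>GL\<^esub> \<phi>') (\<psi>\<^sub>2 \<circ> \<beta>' \<circ> inv\<^bsub>GL\<^esub> \<phi>')"
  then obtain \<phi>' \<psi>\<^sub>1 \<psi>\<^sub>2 \<alpha>' \<beta>' where \<phi>': "\<phi>' \<in> carrier GOp" "cls \<phi> = cls \<phi>'"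
    and t': "triality_components \<phi>' \<psi>\<^sub>1 \<psi>\<^sub>2" and "cls2 \<alpha> \<beta> = cls2 \<alpha>' \<beta>'"
    and y: "y = cls2 (\<psi>\<^sub>1 \<circ> \<alpha>' \<circ> inv\<^bsub>GL\<^esub> \<phi>') (\<psi>\<^sub>2 \<circ> \<beta>' \<circ> inv\<^bsub>GL\<^esub> \<phi>')" by blast
  then obtain v where v: "nrd v \<noteq> 0" "cls \<alpha>' = cls (R (ainv v) \<circ> \<alpha>)" "cls \<beta>' = cls (L v \<circ> \<beta>)"
    unfolding cls2_eq_iff by blast
  obtain c where c: "c \<noteq> 0" "\<And>x. \<phi>' x = scale c (\<phi> x)" using \<phi>'(2) cls_eq_iff by metis
  have \<phi>i: "(inv\<^bsub>GL\<^esub> \<phi>) x = scale c ((inv\<^bsub>GL\<^esub> \<phi>') x)" for x by (rule inv_GL_scaled[OF \<phi> \<phi>'(1) c])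
  have cls_inv: "cls (\<theta> \<circ> inv\<^bsub>GL\<^esub> \<phi>') = cls (\<theta> \<circ> inv\<^bsub>GL\<^esub> \<phi>)" if "\<theta> \<in> carrier GL" for \<theta>
  proof -
    have "cls (inv\<^bsub>GL\<^esub> \<phi>) = cls (inv\<^bsub>GL\<^esub> \<phi>')" using \<phi>i c(1) cls_eq_iff by blast
    then show ?thesis using cls_comp_left[OF that] by metis
  qed
  have GL: "\<phi>\<^sub>1 \<in> carrier GL" "\<phi>\<^sub>2 \<in> carrier GL" "\<psi>\<^sub>1 \<in> carrier GL" "\<psi>\<^sub>2 \<in> carrier GL" "\<phi> \<in> carrier GL"
    using t t' \<phi> GOp_subset_GL by (auto simp: triality_components_def)
  obtain x\<^sub>0 y\<^sub>0 where xy\<^sub>0: "\<phi>\<^sub>1 x\<^sub>0 = 1" "\<phi>\<^sub>2 y\<^sub>0 = 1" using GL(1,2) by (metis carrier_GL bij_pointE)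
  \<comment> \<open>Rescaling the similitude changes its components by a unit up to scalars.\<close>
  have "scale c (\<phi>\<^sub>1 (scale (inverse c) x\<^sub>0)) = 1" using xy\<^sub>0 GL_scale[OF GL(1)] c(1) by simp
  moreover have "scale c (\<phi>\<^sub>1 x) * \<phi>\<^sub>2 y = \<psi>\<^sub>1 x * \<psi>\<^sub>2 y" for x y
  proof -
    have "\<psi>\<^sub>1 x * \<psi>\<^sub>2 y = scale c (\<phi> (x * y))" using t' c(2) by (simp add: triality_components_def)
    then show ?thesis using t by (simp add: triality_components_def scale_mult_left)
  qed
  ultimately obtain u where u: "nrd u \<noteq> 0" "\<psi>\<^sub>1 = R (ainv u) \<circ> (\<lambda>x. scale c (\<phi>\<^sub>1 x))" "\<psi>\<^sub>2 = L u \<circ> \<phi>\<^sub>2"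
    using triality_components_unique[of "\<lambda>x. scale c (\<phi>\<^sub>1 x)" _ \<phi>\<^sub>2 y\<^sub>0] xy\<^sub>0(2) by metis
  \<comment> \<open>So does moving the representatives of the orbit.\<close>
  have "\<phi>\<^sub>1 (R (ainv v) x) * \<phi>\<^sub>2 (L v y) = \<phi>\<^sub>1 x * \<phi>\<^sub>2 y" for x y
  proof -
    have "R (ainv v) x * L v y = x * y" using v(1) by (simp add: R_def L_def mult.assoc)
    then show ?thesis using t unfolding triality_components_def by metis
  qed
  then obtain w where w: "nrd w \<noteq> 0" "\<phi>\<^sub>1 \<circ> R (ainv v) = R (ainv w) \<circ> \<phi>\<^sub>1" "\<phi>\<^sub>2 \<circ> L v = L w \<circ> \<phi>\<^sub>2"
    using triality_components_unique[of \<phi>\<^sub>1 x\<^sub>0 \<phi>\<^sub>2 y\<^sub>0 "\<phi>\<^sub>1 \<circ> R (ainv v)" "\<phi>\<^sub>2 \<circ> L v"] xy\<^sub>0 by auto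
  have "cls (\<psi>\<^sub>1 \<circ> \<alpha>' \<circ> inv\<^bsub>GL\<^esub> \<phi>') = cls (R (ainv (u * w)) \<circ> (\<phi>\<^sub>1 \<circ> \<alpha> \<circ> inv\<^bsub>GL\<^esub> \<phi>))"
  proof -
    have "cls (\<psi>\<^sub>1 \<circ> \<alpha>') = cls (\<psi>\<^sub>1 \<circ> (R (ainv v) \<circ> \<alpha>))" by (rule cls_comp_left[OF GL(3) v(2)])
    also have "\<dots> = cls (R (ainv u) \<circ> (\<phi>\<^sub>1 \<circ> R (ainv v)) \<circ> \<alpha>)"
      unfolding u(2) cls_eq_iff using c(1) by (auto simp: R_def scale_mult_left)
    also have "\<dots> = cls (R (ainv (u * w)) \<circ> (\<phi>\<^sub>1 \<circ> \<alpha>))"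
      unfolding w(2) using u(1) w(1) by (auto simp: R_def ainv_mult mult.assoc comp_def)
    finally have "cls (\<psi>\<^sub>1 \<circ> \<alpha>' \<circ> inv\<^bsub>GL\<^esub> \<phi>') = cls (R (ainv (u * w)) \<circ> (\<phi>\<^sub>1 \<circ> \<alpha>) \<circ> inv\<^bsub>GL\<^esub> \<phi>')"
      by (rule cls_comp_right)
    also have "\<dots> = cls (R (ainv (u * w)) \<circ> (\<phi>\<^sub>1 \<circ> \<alpha>) \<circ> inv\<^bsub>GL\<^esub> \<phi>)"
      by (intro cls_inv GL_comp R_in_GL GL \<alpha>) (use u(1) w(1) in \<open>simp add: nrd_ainv nrd_mult\<close>)
    finally show ?thesis by (simp add: comp_assoc)
  qed
  moreover have "cls (\<psi>\<^sub>2 \<circ> \<beta>' \<circ> inv\<^bsub>GL\<^esub> \<phi>') = cls (L (u * w) \<circ> (\<phi>\<^sub>2 \<circ> \<beta> \<circ> inv\<^bsub>GL\<^esub> \<phi>))"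
  proof -
    have "cls (\<psi>\<^sub>2 \<circ> \<beta>') = cls (\<psi>\<^sub>2 \<circ> (L v \<circ> \<beta>))" by (rule cls_comp_left[OF GL(4) v(3)])
    also have "\<psi>\<^sub>2 \<circ> (L v \<circ> \<beta>) = L u \<circ> (\<phi>\<^sub>2 \<circ> L v) \<circ> \<beta>" unfolding u(3) by (simp add: comp_assoc)
    also have "\<dots> = L (u * w) \<circ> (\<phi>\<^sub>2 \<circ> \<beta>)"
      unfolding w(3) by (auto simp: L_def mult.assoc comp_def)
    finally have "cls (\<psi>\<^sub>2 \<circ> \<beta>' \<circ> inv\<^bsub>GL\<^esub> \<phi>') = cls (L (u * w) \<circ> (\<phi>\<^sub>2 \<circ> \<beta>) \<circ> inv\<^bsub>GL\<^esub> \<phi>')"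
      by (rule cls_comp_right)
    also have "\<dots> = cls (L (u * w) \<circ> (\<phi>\<^sub>2 \<circ> \<beta>) \<circ> inv\<^bsub>GL\<^esub> \<phi>)"
      by (intro cls_inv GL_comp L_in_GL GL \<beta>) (use u(1) w(1) in \<open>simp add: nrd_mult\<close>)
    finally show ?thesis by (simp add: comp_assoc)
  qed
  moreover have "nrd (u * w) \<noteq> 0" using u(1) w(1) by (simp add: nrd_mult)
  ultimately have "cls2 (\<phi>\<^sub>1 \<circ> \<alpha> \<circ> inv\<^bsub>GL\<^esub> \<phi>) (\<phi>\<^sub>2 \<circ> \<beta> \<circ> inv\<^bsub>GL\<^esub> \<phi>)
    = cls2 (\<psi>\<^sub>1 \<circ> \<alpha>' \<circ> inv\<^bsub>GL\<^esub> \<phi>') (\<psi>\<^sub>2 \<circ> \<beta>' \<circ> inv\<^bsub>GL\<^esub> \<phi>')"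
    unfolding cls2_eq_iff by blast
  then show "y = cls2 (\<phi>\<^sub>1 \<circ> \<alpha> \<circ> inv\<^bsub>GL\<^esub> \<phi>) (\<phi>\<^sub>2 \<circ> \<beta> \<circ> inv\<^bsub>GL\<^esub> \<phi>)"
    unfolding y by (rule sym)
qed

lemma triality_act_sandwich:
  assumes pq: "nrd p \<noteq> 0" "nrd q \<noteq> 0" and \<alpha>: "\<alpha> \<in> carrier GL" and \<beta>: "\<beta> \<in> carrier GL"
  shows "triality_act (cls (sandwich False p q)) (cls2 \<alpha> \<beta>)
    = cls2 (L p \<circ> \<alpha> \<circ> sandwich False (ainv p) (ainv q)) (R q \<circ> \<beta> \<circ> sandwich False (ainv p) (ainv q))"
proof -
  have "sandwich False p q \<in> carrier GOp" "L p \<in> carrier GOp" "R q \<in> carrier GOp"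
    unfolding L_eq_sandwich R_eq_sandwich by (intro sandwich_in_GOp; simp add: pq)+
  moreover have "sandwich False p q (x * y) = L p x * R q y" for x y
    by (simp add: sandwich_def twist_def L_def R_def mult.assoc)
  ultimately show ?thesis
    using triality_act_eq[OF _ _ \<alpha> \<beta>, of "sandwich False p q" "L p" "R q"] inv_GL_sandwich[OF pq]
    by (simp add: triality_components_def)
qed

lemma XX_acting: "group_acting PGOp X_A triality_act"
proof -
  interpret group PGOp by (rule group_PGOp)
  show ?thesis
  proof
    fix x assume "x \<in> X_A"
    then obtain \<alpha> \<beta> where "x = cls2 \<alpha> \<beta>" "\<alpha> \<in> carrier GL" "\<beta> \<in> carrier GL" by (auto simp: X_A_eq)
    moreover have "L 1 = id" "R 1 = id" by (auto simp: L_def R_def)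
    ultimately show "triality_act \<one>\<^bsub>PGOp\<^esub> x = x"
      using triality_act_sandwich[of 1 1 \<alpha> \<beta>] by (simp add: one_PGOp sandwich_id)
  next
    fix g h x assume "g \<in> carrier PGOp" "h \<in> carrier PGOp" "x \<in> X_A"
    then obtain p q p' q' \<alpha> \<beta> where u: "nrd p \<noteq> 0" "nrd q \<noteq> 0" "nrd p' \<noteq> 0" "nrd q' \<noteq> 0"
      and g: "g = cls (sandwich False p q)" and h: "h = cls (sandwich False p' q')"
      and x: "x = cls2 \<alpha> \<beta>" "\<alpha> \<in> carrier GL" "\<beta> \<in> carrier GL"
      by (auto simp: carrier_PGOp X_A_eq)
    let ?s = "sandwich False (ainv p) (ainv q)" and ?s' = "sandwich False (ainv p') (ainv q')"
    have s': "?s' \<in> carrier GL" by (rule sandwich_in_GL) (use u in \<open>auto simp: nrd_ainv\<close>)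
    have "triality_act g (triality_act h x) = cls2 (L p \<circ> (L p' \<circ> \<alpha> \<circ> ?s') \<circ> ?s) (R q \<circ> (R q' \<circ> \<beta> \<circ> ?s') \<circ> ?s)"
      unfolding g h x(1) triality_act_sandwich[OF u(3,4) x(2,3)]
      by (intro triality_act_sandwich u GL_comp L_in_GL R_in_GL x s')
    moreover have "triality_act (g \<otimes>\<^bsub>PGOp\<^esub> h) x = cls2 (L (p * p') \<circ> \<alpha> \<circ> sandwich False (ainv (p * p')) (ainv (q' * q)))
        (R (q' * q) \<circ> \<beta> \<circ> sandwich False (ainv (p * p')) (ainv (q' * q)))"
      unfolding g h x(1) mult_PGOp_sandwich[OF u(1,2)]
      by (intro triality_act_sandwich x) (use u in \<open>auto simp: nrd_mult\<close>)
    moreover have "sandwich False (ainv (p * p')) (ainv (q' * q)) = ?s' \<circ> ?s"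
      using u by (simp add: sandwich_comp_left ainv_mult)
    moreover have "L (p * p') = L p \<circ> L p'" "R (q' * q) = R q \<circ> R q'" by (auto simp: L_def R_def mult.assoc)
    ultimately show "triality_act (g \<otimes>\<^bsub>PGOp\<^esub> h) x = triality_act g (triality_act h x)"
      by (simp add: comp_assoc)
  qed
qed

section \<open>The equivalences\<close>

text \<open>
  Coordinates for the orbits of pairs of similitudes. The action of a unit \<open>w\<close> multiplies the right
  factor of the first map by \<open>w\<^sup>-\<^sup>1\<close> and the left factor of the second one by \<open>w\<close>, so the latter can
  be made \<open>1\<close>.
\<close>

definition triple :: "bool \<Rightarrow> bool \<Rightarrow> 'a \<Rightarrow> 'a \<Rightarrow> 'a \<Rightarrow> (('a \<Rightarrow> 'a) set \<times> ('a \<Rightarrow> 'a) set) set" where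
  "triple e f A B D = cls2 (sandwich e A B) (sandwich f 1 D)"

lemma cls2_sandwich:
  assumes "nrd b \<noteq> 0" "nrd c \<noteq> 0"
  shows "cls2 (sandwich e a b) (sandwich f c d) = triple e f a (b * c) d"
  unfolding triple_def cls2_eq_iff
proof (intro exI conjI)
  show "nrd (ainv c) \<noteq> 0" using assms by (simp add: nrd_ainv)
  show "cls (sandwich e a (b * c)) = cls (R (ainv (ainv c)) \<circ> sandwich e a b)"
    using assms by (simp add: R_eq_sandwich sandwich_comp_left)
  show "cls (sandwich f 1 d) = cls (L (ainv c) \<circ> sandwich f c d)"
    using assms by (simp add: L_eq_sandwich sandwich_comp_left)
qed

lemma triple_eq_iff:
  assumes u: "nrd A \<noteq> 0" "nrd B \<noteq> 0" "nrd D \<noteq> 0" "nrd A' \<noteq> 0" "nrd B' \<noteq> 0" "nrd D' \<noteq> 0"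
  shows "triple e f A B D = triple e f A' B' D' \<longleftrightarrow> A \<approx> A' \<and> B \<approx> B' \<and> D \<approx> D'"
proof
  assume "triple e f A B D = triple e f A' B' D'"
  then obtain w where w: "nrd w \<noteq> 0" "cls (sandwich e A' B') = cls (sandwich e A (B * ainv w))"
    "cls (sandwich f 1 D') = cls (sandwich f w D)"
    unfolding triple_def cls2_eq_iff by (auto simp: R_eq_sandwich L_eq_sandwich sandwich_comp_left)
  then have 1: "A' \<approx> A" "B' \<approx> B * ainv w" "1 \<approx> w" "D' \<approx> D"
    using u by (simp_all add: cls_sandwich_eq_iff nrd_mult nrd_ainv)
  then obtain c where "c \<noteq> 0" "w = scale c 1" by (metis proportional_def proportional_sym)
  then have "B' \<approx> B" using 1(2) by (simp add: ainv_scale qa_simps)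
  then show "A \<approx> A' \<and> B \<approx> B' \<and> D \<approx> D'" using 1 proportional_sym by blast
next
  assume "A \<approx> A' \<and> B \<approx> B' \<and> D \<approx> D'"
  then have "cls (sandwich e A' B') = cls (sandwich e A B)" "cls (sandwich f 1 D') = cls (sandwich f 1 D)"
    using u by (simp_all add: cls_sandwich_eq_iff proportional_sym)
  then show "triple e f A B D = triple e f A' B' D'"
    unfolding triple_def cls2_eq_iff by (intro exI[of _ 1]) (simp add: R_eq_sandwich L_eq_sandwich sandwich_comp_left)
qed

lemma orbits_PGO:
  "orbits Astar (PGO (flag_sign e) \<times> PGO (flag_sign f)) Astar_act
    = {triple e f A B D | A B D. nrd A \<noteq> 0 \<and> nrd B \<noteq> 0 \<and> nrd D \<noteq> 0}" (is "?l = ?r")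
proof
  show "?l \<subseteq> ?r"
  proof
    fix z assume "z \<in> ?l"
    then obtain a b c d where u: "nrd a \<noteq> 0" "nrd b \<noteq> 0" "nrd c \<noteq> 0" "nrd d \<noteq> 0"
      and z: "z = cls2 (sandwich e a b) (sandwich f c d)"
      unfolding orbits_def PGO_flag_sign cls2_def by blast
    have "z = triple e f a (b * c) d" using u z by (simp add: cls2_sandwich)
    moreover have "nrd (b * c) \<noteq> 0" using u by (simp add: nrd_mult)
    ultimately show "z \<in> ?r" using u by blast
  qed
  show "?r \<subseteq> ?l"
  proof
    fix z assume "z \<in> ?r"
    then obtain A B D where u: "nrd A \<noteq> 0" "nrd B \<noteq> 0" "nrd D \<noteq> 0" and z: "z = triple e f A B D" by blast
    have "nrd 1 \<noteq> 0" by simp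
    then have "(cls (sandwich e A B), cls (sandwich f 1 D)) \<in> PGO (flag_sign e) \<times> PGO (flag_sign f)"
      unfolding PGO_flag_sign using u by blast
    then show "z \<in> ?l" unfolding z triple_def cls2_def orbits_def by blast
  qed
qed

lemma triple_in_orbits: "nrd A \<noteq> 0 \<Longrightarrow> nrd B \<noteq> 0 \<Longrightarrow> nrd D \<noteq> 0 \<Longrightarrow>
  triple e f A B D \<in> orbits Astar (PGO (flag_sign e) \<times> PGO (flag_sign f)) Astar_act"
  unfolding orbits_PGO by blast

lemma triple_in_X_A: "nrd A \<noteq> 0 \<Longrightarrow> nrd B \<noteq> 0 \<Longrightarrow> nrd D \<noteq> 0 \<Longrightarrow> triple e f A B D \<in> X_A"
  unfolding X_A_eq triple_def using sandwich_in_GL[of A B e] sandwich_in_GL[of 1 D f] by auto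

text \<open>
  Composing with the inverse of \<open>x \<mapsto> p x q\<close> contributes the factors \<open>p\<^sup>-\<^sup>1\<close> and \<open>q\<^sup>-\<^sup>1\<close>. Passing them
  through \<open>\<kappa>\<close> exchanges their sides and turns them, up to scalars, into \<open>q\<close> and \<open>p\<close>.
\<close>

lemma triality_act_triple:
  assumes u: "nrd p \<noteq> 0" "nrd q \<noteq> 0" "nrd A \<noteq> 0" "nrd B \<noteq> 0" "nrd D \<noteq> 0"
  shows "triality_act (cls (sandwich False p q)) (triple e f A B D)
    = triple e f (p * A * (if e then q else ainv p))
        ((if e then p else ainv q) * B * (if f then q else ainv p)) ((if f then p else ainv q) * D * q)"
proof -
  let ?A = "p * A * (if e then \<kappa> (ainv q) else ainv p)"
  let ?B = "(if e then \<kappa> (ainv p) else ainv q) * B"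
  let ?C = "if f then \<kappa> (ainv q) else ainv p"
  let ?D = "(if f then \<kappa> (ainv p) else ainv q) * D * q"
  have "triality_act (cls (sandwich False p q)) (triple e f A B D)
    = cls2 (L p \<circ> sandwich e A B \<circ> sandwich False (ainv p) (ainv q))
        (R q \<circ> sandwich f 1 D \<circ> sandwich False (ainv p) (ainv q))"
    unfolding triple_def by (rule triality_act_sandwich) (use u in \<open>auto intro!: sandwich_in_GL\<close>)
  also have "\<dots> = cls2 (sandwich e ?A ?B) (sandwich f ?C ?D)"
    by (simp add: L_eq_sandwich R_eq_sandwich sandwich_comp_left sandwich_comp_right mult.assoc)
  also have "\<dots> = triple e f ?A (?B * ?C) ?D"
    by (rule cls2_sandwich) (use u in \<open>simp_all add: nrd_mult nrd_ainv\<close>)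
  also have "\<dots> = triple e f (p * A * (if e then q else ainv p))
        ((if e then p else ainv q) * B * (if f then q else ainv p)) ((if f then p else ainv q) * D * q)"
    by (subst triple_eq_iff) (use u in \<open>simp_all add: nrd_mult nrd_ainv nrd_scale kappa_ainv_proportional scale_mult_left scale_mult_right del: scale_scale\<close>)
  finally show ?thesis .
qed

text \<open>
  A coordinate that \<open>x \<mapsto> p x q\<close> multiplies by \<open>p\<close> and \<open>q\<close>, or by both of their inverses, is normalized
  to \<open>1\<close>. If both flags are set, all three coordinates have this property and the middle one is taken.
\<close>

definition Hc :: "bool \<Rightarrow> bool \<Rightarrow> 'a \<Rightarrow> 'a \<Rightarrow> (('a \<Rightarrow> 'a) set \<times> ('a \<Rightarrow> 'a) set) set" where
  "Hc e f a b = (if e = f then triple e f a 1 b else if e then triple e f 1 a b else triple e f a b 1)"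

lemma Hc_obj_eq_Hc:
  assumes "nrd a \<noteq> 0" "nrd b \<noteq> 0" shows "Hc_obj (flag_sign e) (flag_sign f) a b = Hc e f a b"
proof -
  have "L a = sandwich False a 1" "R b = sandwich False 1 b" "L b \<circ> \<kappa> = sandwich True b 1"
    "R a \<circ> \<kappa> = sandwich True 1 a" "L a \<circ> \<kappa> = sandwich True a 1" "R b \<circ> \<kappa> = sandwich True 1 b"
    by (auto simp: L_def R_def sandwich_def twist_def)
  then show ?thesis using assms
    by (cases e; cases f) (simp_all add: Hc_obj_def flag_sign_def Hc_def cls2_sandwich)
qed

lemma Hc_cong:
  assumes "nrd a \<noteq> 0" "nrd b \<noteq> 0" "nrd a' \<noteq> 0" "nrd b' \<noteq> 0" "a \<approx> a'" "b \<approx> b'"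
  shows "Hc e f a b = Hc e f a' b'"
  using assms by (simp add: Hc_def triple_eq_iff)

lemma Hc_in_orbits:
  assumes "nrd a \<noteq> 0" "nrd b \<noteq> 0"
  shows "Hc e f a b \<in> orbits Astar (PGO (flag_sign e) \<times> PGO (flag_sign f)) Astar_act"
  using assms by (simp add: Hc_def triple_in_orbits)

lemma mult_proportional_one_iff:
  assumes "nrd p \<noteq> 0" "nrd q \<noteq> 0"
  shows "p * q \<approx> 1 \<longleftrightarrow> q \<approx> ainv p" "ainv q * ainv p \<approx> 1 \<longleftrightarrow> q \<approx> ainv p"
proof -
  show "p * q \<approx> 1 \<longleftrightarrow> q \<approx> ainv p"
    using proportional_mult_left_cancel[of p q "ainv p"] assms by simp
  show "ainv q * ainv p \<approx> 1 \<longleftrightarrow> q \<approx> ainv p"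
    using proportional_mult_left_cancel[of q "ainv q * ainv p" 1] assms proportional_sym by simp
qed

text \<open>
  The normalized coordinate becomes \<open>p q\<close> or \<open>q\<^sup>-\<^sup>1 p\<^sup>-\<^sup>1\<close>, so it stays \<open>1\<close> modulo scalars only for
  \<open>q = p\<^sup>-\<^sup>1\<close>. Then all factors acting on the other two coordinates are \<open>p\<close> on the left and \<open>p\<^sup>-\<^sup>1\<close> on
  the right.
\<close>

lemma triality_act_Hc_iff:
  assumes u: "nrd p \<noteq> 0" "nrd q \<noteq> 0" "nrd a \<noteq> 0" "nrd b \<noteq> 0" "nrd a' \<noteq> 0" "nrd b' \<noteq> 0"
  shows "triality_act (cls (sandwich False p q)) (Hc e f a b) = Hc e f a' b' \<longleftrightarrow>
    q \<approx> ainv p \<and> p * a * ainv p \<approx> a' \<and> p * b * ainv p \<approx> b'"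
proof (cases "q \<approx> ainv p")
  case False
  then show ?thesis using u mult_proportional_one_iff[OF u(1,2)]
    by (cases e; cases f) (simp_all add: Hc_def triality_act_triple triple_eq_iff nrd_mult nrd_ainv)
next
  case True
  then obtain c where c: "c \<noteq> 0" "q = scale c (ainv p)" by (auto simp: proportional_def)
  show ?thesis using u c
    by (cases e; cases f) (simp_all add: Hc_def triality_act_triple triple_eq_iff nrd_mult nrd_ainv
      ainv_scale scale_mult_left scale_mult_right nrd_scale mult.assoc del: scale_scale)
qed

text \<open>
  With \<open>p = 1\<close> the normalized coordinate becomes \<open>q\<close> or its inverse. This determines \<open>q\<close>, and the other
  two coordinates can be solved for \<open>a\<close> and \<open>b\<close>.
\<close>

lemma Hc_reaches_every_triple:
  assumes u: "nrd A \<noteq> 0" "nrd B \<noteq> 0" "nrd D \<noteq> 0"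
  shows "\<exists>q a b. nrd q \<noteq> 0 \<and> nrd a \<noteq> 0 \<and> nrd b \<noteq> 0 \<and>
    triality_act (cls (sandwich False 1 q)) (Hc e f a b) = triple e f A B D"
proof (cases e)
  case True
  show ?thesis
  proof (cases f)
    case True
    show ?thesis using u \<open>e\<close> True
      by (intro exI[of _ B] exI[of _ "A * ainv B"] exI[of _ "D * ainv B"])
        (simp add: Hc_def triality_act_triple nrd_mult nrd_ainv mult.assoc)
  next
    case False
    show ?thesis using u \<open>e\<close> False
      by (intro exI[of _ A] exI[of _ B] exI[of _ "A * D * ainv A"])
        (simp add: Hc_def triality_act_triple nrd_mult nrd_ainv mult.assoc)
  qed
next
  case False
  show ?thesis
  proof (cases f)
    case True
    show ?thesis using u \<open>\<not> e\<close> True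
      by (intro exI[of _ D] exI[of _ A] exI[of _ "D * B * ainv D"])
        (simp add: Hc_def triality_act_triple nrd_mult nrd_ainv mult.assoc)
  next
    case False
    show ?thesis using u \<open>\<not> e\<close> False
      by (intro exI[of _ "ainv B"] exI[of _ A] exI[of _ "ainv B * D * B"])
        (simp add: Hc_def triality_act_triple nrd_mult nrd_ainv mult.assoc)
  qed
qed

lemma Acls_in_PAstar: "nrd a \<noteq> 0 \<Longrightarrow> Acls a \<in> carrier PAstar"
  unfolding carrier_PAstar by blast

lemma conj_cls_eq: "nrd s \<noteq> 0 \<Longrightarrow> conj_cls s = cls (sandwich False s (ainv s))"
  by (simp add: conj_cls_def R_eq_sandwich L_eq_sandwich inv_GL_sandwich sandwich_comp_left)

lemma conj_cls_eq_iff: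
  "nrd s \<noteq> 0 \<Longrightarrow> nrd t \<noteq> 0 \<Longrightarrow> conj_cls s = conj_cls t \<longleftrightarrow> s \<approx> t"
proof -
  assume u: "nrd s \<noteq> 0" "nrd t \<noteq> 0"
  have "ainv s \<approx> ainv t" if "s \<approx> t"
  proof -
    obtain c where "c \<noteq> 0" "s = scale c t" using \<open>s \<approx> t\<close> by (auto simp: proportional_def)
    then show ?thesis by (simp add: ainv_scale)
  qed
  with u show ?thesis by (auto simp: conj_cls_eq cls_sandwich_eq_iff nrd_ainv)
qed

definition Hc_functor_obj :: "bool \<Rightarrow> bool \<Rightarrow> 'a set \<times> 'a set \<Rightarrow> (('a \<Rightarrow> 'a) set \<times> ('a \<Rightarrow> 'a) set) set" where
  "Hc_functor_obj e f = (\<lambda>(P, Q). Hc e f (SOME a. nrd a \<noteq> 0 \<and> P = Acls a) (SOME b. nrd b \<noteq> 0 \<and> Q = Acls b))"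

definition Hc_functor_mor :: "'a set \<Rightarrow> ('a \<Rightarrow> 'a) set" where
  "Hc_functor_mor S = conj_cls (SOME s. nrd s \<noteq> 0 \<and> S = Acls s)"

lemma some_representative:
  assumes "nrd a \<noteq> 0"
  shows "nrd (SOME a'. nrd a' \<noteq> 0 \<and> Acls a = Acls a') \<noteq> 0 \<and> a \<approx> (SOME a'. nrd a' \<noteq> 0 \<and> Acls a = Acls a')"
  using someI[of "\<lambda>a'. nrd a' \<noteq> 0 \<and> Acls a = Acls a'" a] assms by (simp add: Acls_eq_iff)

lemma Hc_functor_obj_Acls:
  assumes "nrd a \<noteq> 0" "nrd b \<noteq> 0" shows "Hc_functor_obj e f (Acls a, Acls b) = Hc e f a b"
  using some_representative[OF assms(1)] some_representative[OF assms(2)] assms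
    Hc_cong[of a b "SOME a'. nrd a' \<noteq> 0 \<and> Acls a = Acls a'" "SOME a'. nrd a' \<noteq> 0 \<and> Acls b = Acls a'" e f]
  by (simp add: Hc_functor_obj_def)

lemma Hc_functor_mor_Acls: "nrd s \<noteq> 0 \<Longrightarrow> Hc_functor_mor (Acls s) = conj_cls s"
  using some_representative[of s] conj_cls_eq_iff[of s "SOME a'. nrd a' \<noteq> 0 \<and> Acls s = Acls a'"]
  by (simp add: Hc_functor_mor_def)

text \<open>
  From right to left, the functor maps morphisms to morphisms; from left to right, it is full.
\<close>

lemma Hc_Hom_iff:
  assumes u: "nrd a \<noteq> 0" "nrd b \<noteq> 0" "nrd a' \<noteq> 0" "nrd b' \<noteq> 0"
  shows "g \<in> Hom (XXc (flag_sign e) (flag_sign f)) (Hc e f a b) (Hc e f a' b') \<longleftrightarrow>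
    (\<exists>s. nrd s \<noteq> 0 \<and> g = conj_cls s \<and> Acls s \<in> Hom ZZc (Acls a, Acls b) (Acls a', Acls b'))"
proof -
  have Z: "Acls s \<in> Hom ZZc (Acls a, Acls b) (Acls a', Acls b') \<longleftrightarrow>
      s * a * ainv s \<approx> a' \<and> s * b * ainv s \<approx> b'" if "nrd s \<noteq> 0" for s
    using that by (simp add: ZZc_def action_groupoid_def Acls_in_PAstar conj_act_Acls Acls_eq_iff)
  show ?thesis
  proof
    assume "g \<in> Hom (XXc (flag_sign e) (flag_sign f)) (Hc e f a b) (Hc e f a' b')"
    then have g: "g \<in> carrier PGOp" "triality_act g (Hc e f a b) = Hc e f a' b'"
      by (auto simp: XXc_def XX_def full_subcategory_def action_groupoid_def)
    then obtain p q where pq: "nrd p \<noteq> 0" "nrd q \<noteq> 0" "g = cls (sandwich False p q)" by (auto simp: carrier_PGOp)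
    have "q \<approx> ainv p" "p * a * ainv p \<approx> a'" "p * b * ainv p \<approx> b'"
      using g(2) triality_act_Hc_iff[OF pq(1,2) u] unfolding pq(3) by blast+
    moreover from this have "g = conj_cls p"
      unfolding pq(3) using pq by (simp add: conj_cls_eq cls_sandwich_eq_iff nrd_ainv)
    ultimately show "\<exists>s. nrd s \<noteq> 0 \<and> g = conj_cls s \<and> Acls s \<in> Hom ZZc (Acls a, Acls b) (Acls a', Acls b')"
      using pq(1) Z by blast
  next
    assume "\<exists>s. nrd s \<noteq> 0 \<and> g = conj_cls s \<and> Acls s \<in> Hom ZZc (Acls a, Acls b) (Acls a', Acls b')"
    then obtain s where s: "nrd s \<noteq> 0" "g = conj_cls s" "s * a * ainv s \<approx> a'" "s * b * ainv s \<approx> b'"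
      using Z by blast
    then show "g \<in> Hom (XXc (flag_sign e) (flag_sign f)) (Hc e f a b) (Hc e f a' b')"
      using triality_act_Hc_iff[OF s(1) _ u, of "ainv s" e f]
      by (simp add: XXc_def XX_def full_subcategory_def action_groupoid_def conj_cls_eq cls_in_PGOp nrd_ainv)
  qed
qed

lemma ZZc_objE:
  assumes "x \<in> Obj ZZc"
  obtains a b where "nrd a \<noteq> 0" "nrd b \<noteq> 0" "x = (Acls a, Acls b)"
  using assms by (auto simp: ZZc_def action_groupoid_def carrier_PAstar)

lemma ZZc_HomE:
  assumes "g \<in> Hom ZZc x y" obtains s where "nrd s \<noteq> 0" "g = Acls s"
  using assms by (auto simp: ZZc_def action_groupoid_def carrier_PAstar)

lemma category_ZZc: "category ZZc"
proof -
  interpret group_acting PAstar "carrier PAstar \<times> carrier PAstar" conj_act by (rule ZZc_acting)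
  have "full_subcategory ZZc (carrier PAstar \<times> carrier PAstar) = ZZc"
    by (simp add: full_subcategory_def ZZc_def action_groupoid_def)
  then show ?thesis using category_full_subcategory[OF subset_refl] by (simp add: ZZc_def)
qed

lemma orbits_PGO_subset: "orbits Astar (PGO (flag_sign e) \<times> PGO (flag_sign f)) Astar_act \<subseteq> X_A"
  unfolding orbits_PGO using triple_in_X_A by blast

lemma category_XXc: "category (XXc (flag_sign e) (flag_sign f))"
proof -
  interpret group_acting PGOp X_A triality_act by (rule XX_acting)
  show ?thesis unfolding XXc_def XX_def by (rule category_full_subcategory[OF orbits_PGO_subset])
qed

lemma functor_Hc: "category_functor ZZc (XXc (flag_sign e) (flag_sign f)) (Hc_functor_obj e f) (\<lambda>x y. Hc_functor_mor)"
proof -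
  interpret Z: category ZZc by (rule category_ZZc)
  interpret X: category "XXc (flag_sign e) (flag_sign f)" by (rule category_XXc)
  show ?thesis
  proof
    fix x assume "x \<in> Obj ZZc"
    then show "Hc_functor_obj e f x \<in> Obj (XXc (flag_sign e) (flag_sign f))"
      by (elim ZZc_objE) (simp add: Hc_functor_obj_Acls Hc_in_orbits XXc_def full_subcategory_def)
  next
    fix x y g assume "x \<in> Obj ZZc" "y \<in> Obj ZZc" and g: "g \<in> Hom ZZc x y"
    then obtain a b a' b' where u: "nrd a \<noteq> 0" "nrd b \<noteq> 0" "nrd a' \<noteq> 0" "nrd b' \<noteq> 0"
      and xy: "x = (Acls a, Acls b)" "y = (Acls a', Acls b')" by (metis ZZc_objE)
    obtain s where "nrd s \<noteq> 0" "g = Acls s" using ZZc_HomE[OF g] .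
    then show "Hc_functor_mor g \<in> Hom (XXc (flag_sign e) (flag_sign f)) (Hc_functor_obj e f x) (Hc_functor_obj e f y)"
      using g u unfolding xy by (auto simp: Hc_functor_obj_Acls Hc_functor_mor_Acls Hc_Hom_iff)
  next
    fix x assume "x \<in> Obj ZZc"
    then show "Hc_functor_mor (Ide ZZc x) = Ide (XXc (flag_sign e) (flag_sign f)) (Hc_functor_obj e f x)"
      by (simp add: ZZc_def XXc_def XX_def full_subcategory_def action_groupoid_def
          one_PAstar one_PGOp Hc_functor_mor_Acls conj_cls_eq)
  next
    fix x y z g h assume "g \<in> Hom ZZc x y" "h \<in> Hom ZZc y z"
    then obtain s t where "nrd s \<noteq> 0" "g = Acls s" "nrd t \<noteq> 0" "h = Acls t" by (metis ZZc_HomE)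
    then show "Hc_functor_mor (Comp ZZc x y z h g)
      = Comp (XXc (flag_sign e) (flag_sign f)) (Hc_functor_obj e f x) (Hc_functor_obj e f y) (Hc_functor_obj e f z) (Hc_functor_mor h) (Hc_functor_mor g)"
      by (simp add: ZZc_def XXc_def XX_def full_subcategory_def action_groupoid_def Acls_mult Hc_functor_mor_Acls
          conj_cls_eq mult_PGOp_sandwich nrd_mult nrd_ainv ainv_mult)
  qed
qed

theorem equivalence_Hc:
  "equivalence_of_categories ZZc (XXc (flag_sign e) (flag_sign f)) (Hc_functor_obj e f) (\<lambda>x y. Hc_functor_mor)"
proof (rule equivalence_if_fully_faithful)
  show "category_functor ZZc (XXc (flag_sign e) (flag_sign f)) (Hc_functor_obj e f) (\<lambda>x y. Hc_functor_mor)" by (rule functor_Hc)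
next
  fix x y assume "x \<in> Obj ZZc" "y \<in> Obj ZZc"
  then obtain a b a' b' where u: "nrd a \<noteq> 0" "nrd b \<noteq> 0" "nrd a' \<noteq> 0" "nrd b' \<noteq> 0"
    and xy: "x = (Acls a, Acls b)" "y = (Acls a', Acls b')" by (metis ZZc_objE)
  have inj: "inj_on Hc_functor_mor (Hom ZZc x y)"
  proof (rule inj_onI)
    fix g h assume "g \<in> Hom ZZc x y" "h \<in> Hom ZZc x y" and eq: "Hc_functor_mor g = Hc_functor_mor h"
    then obtain s t where "nrd s \<noteq> 0" "g = Acls s" "nrd t \<noteq> 0" "h = Acls t" by (metis ZZc_HomE)
    then show "g = h" using eq by (simp add: Hc_functor_mor_Acls conj_cls_eq_iff Acls_eq_iff)
  qed
  have img: "g \<in> Hc_functor_mor ` Hom ZZc x y \<longleftrightarrow>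
      (\<exists>s. nrd s \<noteq> 0 \<and> g = conj_cls s \<and> Acls s \<in> Hom ZZc x y)" for g
  proof
    assume "g \<in> Hc_functor_mor ` Hom ZZc x y"
    then obtain h where h: "h \<in> Hom ZZc x y" "g = Hc_functor_mor h" by blast
    obtain s where "nrd s \<noteq> 0" "h = Acls s" using ZZc_HomE[OF h(1)] .
    then show "\<exists>s. nrd s \<noteq> 0 \<and> g = conj_cls s \<and> Acls s \<in> Hom ZZc x y"
      using h by (auto simp: Hc_functor_mor_Acls)
  next
    assume "\<exists>s. nrd s \<noteq> 0 \<and> g = conj_cls s \<and> Acls s \<in> Hom ZZc x y"
    then obtain s where "nrd s \<noteq> 0" "g = conj_cls s" "Acls s \<in> Hom ZZc x y" by blast
    then show "g \<in> Hc_functor_mor ` Hom ZZc x y" by (intro image_eqI[of _ _ "Acls s"]) (simp_all add: Hc_functor_mor_Acls)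
  qed
  have "Hc_functor_mor ` Hom ZZc x y = Hom (XXc (flag_sign e) (flag_sign f)) (Hc_functor_obj e f x) (Hc_functor_obj e f y)"
  proof (rule Set.set_eqI)
    fix g
    show "g \<in> Hc_functor_mor ` Hom ZZc x y \<longleftrightarrow> g \<in> Hom (XXc (flag_sign e) (flag_sign f)) (Hc_functor_obj e f x) (Hc_functor_obj e f y)"
      unfolding img unfolding xy Hc_functor_obj_Acls[OF u(1,2)] Hc_functor_obj_Acls[OF u(3,4)] Hc_Hom_iff[OF u] ..
  qed
  with inj show "bij_betw Hc_functor_mor (Hom ZZc x y) (Hom (XXc (flag_sign e) (flag_sign f)) (Hc_functor_obj e f x) (Hc_functor_obj e f y))"
    by (simp add: bij_betw_def)
next
  fix d assume "d \<in> Obj (XXc (flag_sign e) (flag_sign f))"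
  then obtain A B D where "nrd A \<noteq> 0" "nrd B \<noteq> 0" "nrd D \<noteq> 0" "d = triple e f A B D"
    by (auto simp: XXc_def full_subcategory_def orbits_PGO)
  then obtain q a b where q: "nrd q \<noteq> 0" "nrd a \<noteq> 0" "nrd b \<noteq> 0"
    and act: "triality_act (cls (sandwich False 1 q)) (Hc e f a b) = d"
    using Hc_reaches_every_triple by metis
  interpret group_acting PGOp X_A triality_act by (rule XX_acting)
  have "isomorphism_in (XXc (flag_sign e) (flag_sign f)) (Hc e f a b) d (cls (sandwich False 1 q))"
    unfolding XXc_def XX_def
    by (rule isomorphism_in_full_subcategory[OF orbits_PGO_subset Hc_in_orbits])
      (use q act in \<open>simp_all add: cls_in_PGOp\<close>)
  moreover have "(Acls a, Acls b) \<in> Obj ZZc" "Hc_functor_obj e f (Acls a, Acls b) = Hc e f a b"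
    using q by (simp_all add: ZZc_def action_groupoid_def Acls_in_PAstar Hc_functor_obj_Acls)
  ultimately show "\<exists>c\<in>Obj ZZc. \<exists>f'. isomorphism_in (XXc (flag_sign e) (flag_sign f)) (Hc_functor_obj e f c) d f'"
    by metis
qed

end

theorem proposition16:
  fixes scale :: "'k::field \<Rightarrow> 'a::ring_1 \<Rightarrow> 'a"
  assumes "quaternion_algebra scale"
  shows "\<forall>i\<in>{-1, 1}. \<forall>j\<in>{-1, 1}. \<exists>H0 H1.
    equivalence_of_categories
      (quaternion_algebra.ZZc scale) (quaternion_algebra.XXc scale i j) H0 H1 \<and>
    (\<forall>x\<in>Obj (quaternion_algebra.ZZc scale). \<forall>y\<in>Obj (quaternion_algebra.ZZc scale).
      \<forall>s\<in>carrier quaternion_algebra.Astar.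
        quaternion_algebra.Acls scale s \<in> Hom (quaternion_algebra.ZZc scale) x y \<longrightarrow>
        H1 x y (quaternion_algebra.Acls scale s) = quaternion_algebra.conj_cls scale s) \<and>
    (\<forall>a\<in>carrier quaternion_algebra.Astar. \<forall>b\<in>carrier quaternion_algebra.Astar.
      H0 (quaternion_algebra.Acls scale a, quaternion_algebra.Acls scale b) =
        quaternion_algebra.Hc_obj scale i j a b)"
proof -
  interpret quaternion_algebra scale by fact
  have "\<exists>H0 H1. equivalence_of_categories ZZc (XXc (flag_sign e) (flag_sign f)) H0 H1 \<and>
    (\<forall>x\<in>Obj ZZc. \<forall>y\<in>Obj ZZc. \<forall>s\<in>carrier Astar.
        Acls s \<in> Hom ZZc x y \<longrightarrow> H1 x y (Acls s) = conj_cls s) \<and>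
    (\<forall>a\<in>carrier Astar. \<forall>b\<in>carrier Astar. H0 (Acls a, Acls b) = Hc_obj (flag_sign e) (flag_sign f) a b)" for e f
    by (rule exI[of _ "Hc_functor_obj e f"], rule exI[of _ "\<lambda>x y. Hc_functor_mor"])
      (simp add: equivalence_Hc carrier_Astar Hc_functor_mor_Acls Hc_functor_obj_Acls Hc_obj_eq_Hc)
  from this[of True True] this[of True False] this[of False True] this[of False False]
  show ?thesis by (simp add: flag_sign_def)
qed

end
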